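(* Let $n\ge 1$ be an integer and let $G$ be the image of a continuous and injective homomorphism from the $n$-fold connected covering $\mathrm{PSL}_2^{(n)}(\mathbf{R})$ of $\mathrm{PSL}_2(\mathbf{R})$ to $\mathrm{Homeo}(\mathbf{R}/\mathbf{Z})$. Suppose that $G\subset\mathrm{PC}^0_{\mathbf{Proj}}(\mathbf{R}/\mathbf{Z})$. Then $G$ is uniquely determined (given $n$) up to conjugation in $\mathrm{PC}^0_{\mathbf{Proj}}(\mathbf{R}/\mathbf{Z})$; that is, any two such subgroups $G$ are conjugate in $\mathrm{PC}^0_{\mathbf{Proj}}(\mathbf{R}/\mathbf{Z})$. If moreover $G\subset\mathrm{PC}^1_{\mathbf{Proj}}(\mathbf{R}/\mathbf{Z})$, then $G$ is uniquely determined up to conjugation in $\mathrm{PC}^1_{\mathbf{Proj}}(\mathbf{R}/\mathbf{Z})$; that is, any two such subgroups contained in $\mathrm{PC}^1_{\mathbf{Proj}}(\mathbf{R}/\mathbf{Z})$ are conjugate in $\mathrm{PC}^1_{\mathbf{Proj}}(\mathbf{R}/\mathbf{Z})$.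
   Context: $\mathrm{Homeo}(\mathbf{R}/\mathbf{Z})$ has the compact-open topology. $\mathrm{PC}^0_{\mathbf{Proj}}(\mathbf{R}/\mathbf{Z})$ is the group of self-homeomorphisms of $\mathbf{R}/\mathbf{Z}$ that are piecewise projective: outside a finite subset, in the local coordinates given by local inverses of $\mathbf{R}\to\mathbf{R}/\mathbf{Z}$, they are locally of the form $x\mapsto(ax+b)/(cx+d)$, $ad-bc\neq 0$. $\mathrm{PC}^1_{\mathbf{Proj}}(\mathbf{R}/\mathbf{Z})$ is the subgroup of those that are $\mathcal{C}^1$-diffeomorphisms. *)

theory Defs
  imports "HOL-Analysis.Analysis" "HOL-Algebra.Group"
begin

section \<open>The circle \<open>R/Z\<close>\<close>

quotient_type circle = real / "\<lambda>x y::real. x - y \<in> \<int>"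
  morphisms rep_circle circle_of
proof (rule equivpI)
  show "reflp (\<lambda>x y::real. x - y \<in> \<int>)"
    by (simp add: reflp_def)
  show "symp (\<lambda>x y::real. x - y \<in> \<int>)"
    by (metis (mono_tags, lifting) Ints_minus minus_diff_eq sympI)
  show "transp (\<lambda>x y::real. x - y \<in> \<int>)"
  proof (rule transpI)
    fix x y z :: real
    assume "x - y \<in> \<int>" "y - z \<in> \<int>"
    from Ints_add[OF this] show "x - z \<in> \<int>" by simp
  qed
qed

instantiation circle :: topological_space
begin

definition open_circle :: "circle set \<Rightarrow> bool"
  where "open_circle U \<longleftrightarrow> open (circle_of -` U)"

instance
proof
  show "open (UNIV :: circle set)"
    by (simp add: open_circle_def)
  show "open (S \<inter> T)" if "open S" "open T" for S T :: "circle set"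
    using that by (simp add: open_circle_def open_Int)
  show "open (\<Union>K)" if "\<forall>S\<in>K. open S" for K :: "circle set set"
    using that by (auto simp: open_circle_def vimage_Union)
qed

end

text \<open>Local inverses of the projection \<open>circle_of\<close>, i.e. the local coordinates on the circle.\<close>

definition local_coordinate :: "circle set \<Rightarrow> (circle \<Rightarrow> real) \<Rightarrow> bool"
  where "local_coordinate U \<sigma> \<longleftrightarrow>
    open U \<and> continuous_on U \<sigma> \<and> (\<forall>x\<in>U. circle_of (\<sigma> x) = x)"

text \<open>Local coordinates exist around every point, so quantifying universally over them in the
  definitions below is not vacuous.\<close>

lemma circle_of_eq_iff: "circle_of x = circle_of y \<longleftrightarrow> x - y \<in> \<int>"
  by (rule circle.abs_eq_iff)

lemma open_circle_of_image:
  fixes W :: "real set"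
  assumes "open W"
  shows "open (circle_of ` W)"
proof -
  have "circle_of -` (circle_of ` W) = (\<Union>k::int. (\<lambda>t. of_int k + t) ` W)"
  proof (intro subset_antisym subsetI)
    fix t assume "t \<in> circle_of -` (circle_of ` W)"
    then obtain w where w: "w \<in> W" "t - w \<in> \<int>"
      by (auto simp: circle_of_eq_iff)
    then obtain k :: int where "t - w = of_int k" by (auto elim: Ints_cases)
    then have "t = of_int k + w" by simp
    with w show "t \<in> (\<Union>k::int. (\<lambda>t. of_int k + t) ` W)" by blast
  next
    fix t assume "t \<in> (\<Union>k::int. (\<lambda>t. of_int k + t) ` W)"
    then obtain k :: int and w where "w \<in> W" "t = of_int k + w" by blast
    then show "t \<in> circle_of -` (circle_of ` W)"
      by (metis Ints_of_int add_diff_cancel_right' circle_of_eq_iff image_eqI vimageI)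
  qed
  then show ?thesis
    using assms by (auto simp: open_circle_def intro: open_translation)
qed

lemma local_coordinate_exists:
  "\<exists>U \<sigma>. local_coordinate U \<sigma> \<and> circle_of t \<in> U \<and> \<sigma> (circle_of t) = t"
proof -
  define W where "W = ball t (1/2)"
  have inj: "inj_on circle_of W"
  proof (rule inj_onI)
    fix x y assume xy: "x \<in> W" "y \<in> W" "circle_of x = circle_of y"
    then have "x - y \<in> \<int>" by (simp add: circle_of_eq_iff)
    moreover have "\<bar>x - y\<bar> < 1"
      using xy by (auto simp: W_def dist_real_def abs_if split: if_splits)
    ultimately show "x = y"
      by (metis Ints_nonzero_abs_less1 right_minus_eq)
  qed
  define \<sigma> where "\<sigma> = the_inv_into W circle_of"
  have "open (circle_of ` W)"
    by (rule open_circle_of_image) (simp add: W_def)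
  moreover have "continuous_on (circle_of ` W) \<sigma>"
    unfolding continuous_on_open_vimage[OF \<open>open (circle_of ` W)\<close>]
  proof (intro allI impI)
    fix B :: "real set" assume "open B"
    have "\<sigma> -` B \<inter> circle_of ` W = circle_of ` (W \<inter> B)"
      using inj by (auto simp: \<sigma>_def the_inv_into_f_f)
    then show "open (\<sigma> -` B \<inter> circle_of ` W)"
      using \<open>open B\<close> by (auto simp: W_def intro!: open_circle_of_image)
  qed
  moreover have "\<forall>x\<in>circle_of ` W. circle_of (\<sigma> x) = x"
    using inj by (auto simp: \<sigma>_def the_inv_into_f_f)
  moreover have "t \<in> W" by (simp add: W_def)
  moreover have "\<sigma> (circle_of t) = t"
    using inj \<open>t \<in> W\<close> by (simp add: \<sigma>_def the_inv_into_f_f)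
  ultimately show ?thesis
    unfolding local_coordinate_def by blast
qed


section \<open>Homeomorphisms of the circle\<close>

definition Homeo :: "(circle \<Rightarrow> circle) set"
  where "Homeo = {f. \<exists>g. homeomorphism UNIV UNIV f g}"

definition Homeo_group :: "(circle \<Rightarrow> circle) monoid"
  where "Homeo_group = \<lparr>carrier = Homeo, mult = (\<circ>), one = id\<rparr>"

lemma group_Homeo_group: "group Homeo_group"
proof (rule groupI)
  show "\<exists>g\<in>carrier Homeo_group. g \<otimes>\<^bsub>Homeo_group\<^esub> f = \<one>\<^bsub>Homeo_group\<^esub>"
    if "f \<in> carrier Homeo_group" for f
  proof -
    from that obtain g where g: "homeomorphism UNIV UNIV f g"
      by (auto simp: Homeo_group_def Homeo_def)
    then have "g \<in> Homeo" "g \<circ> f = id"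
      by (auto simp: Homeo_def homeomorphism_def fun_eq_iff)
    then show ?thesis by (auto simp: Homeo_group_def)
  qed
qed (auto simp: Homeo_group_def Homeo_def comp_assoc id_def
       intro: homeomorphism_compose homeomorphism_ident)

definition compact_open :: "(circle \<Rightarrow> circle) topology"
  where "compact_open =
    topology_generated_by {{f \<in> Homeo. f ` K \<subseteq> U} | K U. compact K \<and> open U}"

definition locally_projective_at :: "(circle \<Rightarrow> circle) \<Rightarrow> circle \<Rightarrow> bool"
  where "locally_projective_at f x \<longleftrightarrow>
    (\<forall>U \<sigma> V \<tau>. local_coordinate U \<sigma> \<and> x \<in> U \<and> local_coordinate V \<tau> \<and> f x \<in> V \<longrightarrow>
      (\<exists>a b c d. a * d - b * c \<noteq> 0 \<and>
        (\<forall>\<^sub>F y in nhds x. c * \<sigma> y + d \<noteq> 0 \<and> \<tau> (f y) = (a * \<sigma> y + b) / (c * \<sigma> y + d))))"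

definition PC0_Proj :: "(circle \<Rightarrow> circle) set"
  where "PC0_Proj = {f \<in> Homeo. \<exists>F. finite F \<and> (\<forall>x. x \<notin> F \<longrightarrow> locally_projective_at f x)}"

text \<open>\<open>W\<close> is a neighbourhood in the chart \<open>\<sigma>\<close>, whose inverse is \<open>circle_of\<close>; the map
  \<open>\<tau> \<circ> f \<circ> circle_of\<close> is thus \<open>f\<close> read in local coordinates.\<close>

definition C1_map :: "(circle \<Rightarrow> circle) \<Rightarrow> bool"
  where "C1_map f \<longleftrightarrow>
    (\<forall>x U \<sigma> V \<tau>. local_coordinate U \<sigma> \<and> x \<in> U \<and> local_coordinate V \<tau> \<and> f x \<in> V \<longrightarrow>
      (\<exists>W D. open W \<and> \<sigma> x \<in> W \<and> W \<subseteq> \<sigma> ` U \<and> f ` circle_of ` W \<subseteq> V \<and>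
        (\<forall>t\<in>W. ((\<lambda>s. \<tau> (f (circle_of s))) has_real_derivative D t) (at t)) \<and>
        continuous_on W D))"

definition PC1_Proj :: "(circle \<Rightarrow> circle) set"
  where "PC1_Proj = {f \<in> PC0_Proj. C1_map f \<and> C1_map (inv_into UNIV f)}"

definition conjugate_in ::
    "(circle \<Rightarrow> circle) set \<Rightarrow> (circle \<Rightarrow> circle) set \<Rightarrow> (circle \<Rightarrow> circle) set \<Rightarrow> bool"
  where "conjugate_in K G G' \<longleftrightarrow> (\<exists>h\<in>K. G' = (\<lambda>g. h \<circ> g \<circ> inv_into UNIV h) ` G)"


section \<open>\<open>PSL\<^sub>2(R)\<close> and its connected coverings\<close>

definition SL2 :: "(real^2^2) set"
  where "SL2 = {A. det A = 1}"

quotient_type psl2 = "real^2^2" / partial: "\<lambda>A B. A \<in> SL2 \<and> B \<in> SL2 \<and> (A = B \<or> A = - B)"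
  morphisms rep_psl2 psl2_of
proof (rule part_equivpI)
  show "\<exists>A::real^2^2. A \<in> SL2 \<and> A \<in> SL2 \<and> (A = A \<or> A = - A)"
    by (rule exI[of _ "mat 1"]) (simp add: SL2_def)
  show "symp (\<lambda>A B. A \<in> SL2 \<and> B \<in> SL2 \<and> (A = B \<or> A = - B))"
    by (auto intro: sympI)
  show "transp (\<lambda>A B. A \<in> SL2 \<and> B \<in> SL2 \<and> (A = B \<or> A = - B))"
    by (auto intro: transpI)
qed

text \<open>\<open>psl2_of\<close> is only meaningful on \<open>SL2\<close>; the topology is the quotient of the subspace
  topology of \<open>SL2\<close>.\<close>

instantiation psl2 :: topological_space
begin

definition open_psl2 :: "psl2 set \<Rightarrow> bool"
  where "open_psl2 U \<longleftrightarrow> openin (top_of_set SL2) {A \<in> SL2. psl2_of A \<in> U}"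

instance
proof
  show "open (UNIV :: psl2 set)"
    by (simp add: open_psl2_def)
  show "open (S \<inter> T)" if "open S" "open T" for S T :: "psl2 set"
  proof -
    have "{A \<in> SL2. psl2_of A \<in> S \<inter> T} = {A \<in> SL2. psl2_of A \<in> S} \<inter> {A \<in> SL2. psl2_of A \<in> T}"
      by blast
    with that show ?thesis by (simp add: open_psl2_def openin_Int)
  qed
  show "open (\<Union>K)" if "\<forall>S\<in>K. open S" for K :: "psl2 set set"
  proof -
    have "{A \<in> SL2. psl2_of A \<in> \<Union>K} = (\<Union>S\<in>K. {A \<in> SL2. psl2_of A \<in> S})"
      by blast
    with that show ?thesis by (auto simp: open_psl2_def)
  qed
qed

end

lemma minus_matrix_mult:
  fixes A B :: "real^2^2"
  shows "(- A) ** B = - (A ** B)" "A ** (- B) = - (A ** B)"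
  by (simp_all add: matrix_matrix_mult_def vec_eq_iff sum_negf)

lift_definition psl2_mult :: "psl2 \<Rightarrow> psl2 \<Rightarrow> psl2" is "(**)"
  by (auto simp: SL2_def det_mul minus_matrix_mult)

lift_definition psl2_one :: psl2 is "mat 1"
  by (simp add: SL2_def)

definition PSL2 :: "psl2 monoid"
  where "PSL2 = \<lparr>carrier = UNIV, mult = psl2_mult, one = psl2_one\<rparr>"

lemma group_PSL2: "group PSL2"
proof (rule groupI)
  show "\<exists>y\<in>carrier PSL2. y \<otimes>\<^bsub>PSL2\<^esub> x = \<one>\<^bsub>PSL2\<^esub>" for x
    unfolding PSL2_def
  proof (simp, transfer)
    fix A :: "real^2^2"
    assume "A \<in> SL2 \<and> A \<in> SL2 \<and> (A = A \<or> A = - A)"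
    then have A: "det A = 1" by (simp add: SL2_def)
    then obtain B where B: "B ** A = mat 1"
      by (metis invertible_det_nz invertible_left_inverse zero_neq_one)
    then have "det B = 1"
      by (metis A det_I det_mul mult.right_neutral)
    with B have "B \<in> SL2" "B ** A \<in> SL2" "mat 1 \<in> SL2" "B ** A = mat 1"
      by (auto simp: SL2_def)
    then show "\<exists>B\<in>{B. B \<in> SL2 \<and> B \<in> SL2 \<and> (B = B \<or> B = - B)}.
        B ** A \<in> SL2 \<and> mat 1 \<in> SL2 \<and> (B ** A = mat 1 \<or> B ** A = - mat 1)"
      by blast
  qed
qed (simp_all add: PSL2_def, (transfer, simp add: SL2_def det_mul matrix_mul_assoc)+)

definition topological_group :: "('h::topological_space) monoid \<Rightarrow> bool"
  where "topological_group H \<longleftrightarrow> group H \<and>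
    continuous_on (carrier H \<times> carrier H) (\<lambda>(x, y). x \<otimes>\<^bsub>H\<^esub> y) \<and>
    continuous_on (carrier H) (\<lambda>x. inv\<^bsub>H\<^esub> x)"

text \<open>\<open>H\<close>, together with the covering homomorphism \<open>p\<close>, is the \<open>n\<close>-fold connected covering group
  of \<open>PSL\<^sub>2(R)\<close> (which is unique up to isomorphism of topological groups).  Only
  meaningful for \<open>n \<ge> 1\<close>, where the condition on \<open>card\<close> forces the fibres to be finite.\<close>

definition connected_covering_of_PSL2 ::
    "nat \<Rightarrow> ('h::topological_space) monoid \<Rightarrow> ('h \<Rightarrow> psl2) \<Rightarrow> bool"
  where "connected_covering_of_PSL2 n H p \<longleftrightarrow>
    topological_group H \<and> connected (carrier H) \<and>
    p \<in> hom H PSL2 \<and> covering_space (carrier H) p UNIV \<and>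
    (\<forall>y. card {x \<in> carrier H. p x = y} = n)"

definition continuous_injective_image ::
    "('h::topological_space) monoid \<Rightarrow> (circle \<Rightarrow> circle) set \<Rightarrow> bool"
  where "continuous_injective_image H G \<longleftrightarrow>
    (\<exists>\<phi>. \<phi> \<in> hom H Homeo_group \<and>
      continuous_map (top_of_set (carrier H)) compact_open \<phi> \<and>
      inj_on \<phi> (carrier H) \<and> G = \<phi> ` carrier H)"

end

theory Submission
  imports Defs
begin

text \<open>Lift the rotations \<open>k\<close>, the diagonal matrices \<open>a\<close> and the upper unipotents \<open>u\<close> to one-parameter
  subgroups of the covering.  A flow on the circle has open non-constant orbits; hence a flow without
  fixed points is transitive and periodic, which faithfulness excludes for \<open>u\<close>, and the boundary of the
  fixed point set of \<open>u\<close> is fixed by \<open>a\<close> as well.  The periodic flow \<open>k\<close> is transitive, with stabilizers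
  equal to its kernel.  By the Iwasawa decomposition, two faithful actions are conjugate through
  \<open>h (k\<^sub>\<theta> x) = k'\<^sub>\<theta> x'\<close>, where \<open>x\<close> and \<open>x'\<close> are common fixed points of \<open>a\<close> and \<open>u\<close>.

  For piecewise projective actions, Baire's theorem and the relation between \<open>a\<close> and \<open>u\<close> show that the
  orbit maps \<open>t \<mapsto> u\<^sub>t y\<close> are projective in \<open>t\<close> on some interval.  As \<open>h\<close> intertwines these orbit maps, it
  is projective near some point, and by equivariance and transitivity it is piecewise projective
  everywhere, and \<open>C\<^sup>1\<close> if both actions are.\<close>


section \<open>Moebius relations\<close>

text \<open>The actions are merely continuous, so nothing may be differentiated in the time
  \<open>t\<close>, and the break points of the piecewise projective map \<open>u\<^sub>t\<close>
  may depend on \<open>t\<close> without any control; Baire's theorem replaces a uniform bound. The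
  unipotent flow alone would not determine the orbit chart, since tan and exp also turn translations
  into Moebius maps. The diagonal flow excludes them: it conjugates the unipotent flow to its
  rescalings, and elliptic or hyperbolic one-parameter groups are not conjugate to theirs. The
  number \<open>n\<close> enters only through the finiteness of the kernel of the covering, which
  makes \<open>k\<close> periodic. The conjugacy intertwines the two homomorphisms element by
  element and not merely their images, which is why \<open>h\<close> may have to reverse the
  orientation.\<close>

declare split_paired_Ex [simp del] split_paired_All [simp del]

text \<open>A quadruple \<open>(a, b, c, d)\<close> stands for the matrix with rows \<open>(a, b)\<close> and \<open>(c, d)\<close>, and \<open>mrel\<close> for the
  graph of \<open>z \<mapsto> (a z + b) / (c z + d)\<close>; cleared of denominators it is a closed condition, and for
  \<open>dt \<noteq> 0\<close> it forces \<open>c z + d \<noteq> 0\<close>.\<close>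

type_synonym mat2 = "real \<times> real \<times> real \<times> real"

fun dt :: "mat2 \<Rightarrow> real" where "dt (a, b, c, d) = a * d - b * c"

fun tr :: "mat2 \<Rightarrow> real" where "tr (a, b, c, d) = a + d"

fun adj :: "mat2 \<Rightarrow> mat2" where "adj (a, b, c, d) = (d, - b, - c, a)"

fun mmul :: "mat2 \<Rightarrow> mat2 \<Rightarrow> mat2" where
  "mmul (a, b, c, d) (a', b', c', d') =
    (a * a' + b * c', a * b' + b * d', c * a' + d * c', c * b' + d * d')"

fun mrel :: "mat2 \<Rightarrow> real \<Rightarrow> real \<Rightarrow> bool" where
  "mrel (a, b, c, d) z w \<longleftrightarrow> a * z + b = w * (c * z + d)"

lemma dt_mmul: "dt (mmul M N) = dt M * dt N"
  by (cases M; cases N) (simp add: algebra_simps)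

lemma dt_adj [simp]: "dt (adj M) = dt M"
  by (cases M) simp

lemma moebius_adj: "mrel M z w \<Longrightarrow> mrel (adj M) w z"
  by (cases M) (simp add: algebra_simps)

lemma moebius_denominator:
  assumes "dt (a, b, c, d) \<noteq> 0" "mrel (a, b, c, d) z w"
  shows "c * z + d \<noteq> 0"
proof
  assume "c * z + d = 0"
  moreover from this have "a * z + b = 0" using assms(2) by simp
  moreover have "a * d - b * c = a * (c * z + d) - c * (a * z + b)"
    by (simp add: algebra_simps)
  ultimately show False using assms(1) by simp
qed

lemma moebius_mmul:
  assumes "mrel M z w" "mrel N w v"
  shows "mrel (mmul N M) z v"
proof (cases M, cases N)
  fix a b c d a' b' c' d' assume M: "M = (a, b, c, d)" and N: "N = (a', b', c', d')"
  have 1: "a * z + b = w * (c * z + d)" and 2: "a' * w + b' = v * (c' * w + d')"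
    using assms M N by auto
  have "a' * (a * z + b) + b' * (c * z + d) = (a' * w + b') * (c * z + d)"
    by (simp add: distrib_right mult.assoc 1[symmetric])
  also have "\<dots> = v * (c' * (w * (c * z + d)) + d' * (c * z + d))"
    by (simp add: 2) (simp add: algebra_simps)
  also have "\<dots> = v * (c' * (a * z + b) + d' * (c * z + d))" by (simp add: 1)
  finally show ?thesis by (simp add: M N algebra_simps)
qed

lemma moebius_functional:
  assumes "dt M \<noteq> 0" "mrel M z w" "mrel M z w'"
  shows "w = w'"
proof (cases M)
  case (fields a b c d)
  then have "c * z + d \<noteq> 0" using moebius_denominator assms by blast
  moreover have "w * (c * z + d) = w' * (c * z + d)" using assms fields by simp
  ultimately show ?thesis by simp
qed

lemma moebius_inj:
  assumes "dt M \<noteq> 0" "mrel M z w" "mrel M z' w"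
  shows "z = z'"
  using moebius_functional[of "adj M" w z z'] assms by (simp add: moebius_adj)

lemma moebius_scaleR: "mrel M z w \<Longrightarrow> mrel (l *\<^sub>R M) z w"
  by (cases M) (simp add: scaleR_prod_def, metis distrib_left mult.assoc mult.left_commute)

lemma dt_scaleR: "dt (l *\<^sub>R M) = l\<^sup>2 * dt M"
  by (cases M) (simp add: power2_eq_square algebra_simps)

lemma tr_scaleR: "tr (l *\<^sub>R M) = l * tr M"
  by (cases M) (simp add: algebra_simps)

lemma quadratic_three_zeros:
  fixes A B C :: real
  assumes "x \<noteq> y" "y \<noteq> z" "x \<noteq> z"
    and "A * x\<^sup>2 + B * x + C = 0" "A * y\<^sup>2 + B * y + C = 0" "A * z\<^sup>2 + B * z + C = 0"
  shows "A = 0 \<and> B = 0 \<and> C = 0"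
proof -
  have "(x - y) * (A * (x + y) + B) = 0" "(y - z) * (A * (y + z) + B) = 0"
    using assms by (simp_all add: algebra_simps power2_eq_square)
  then have 1: "A * (x + y) + B = 0" "A * (y + z) + B = 0" using assms by auto
  have "A * (x - z) = (A * (x + y) + B) - (A * (y + z) + B)" by (simp add: algebra_simps)
  then have "A * (x - z) = 0" using 1 by simp
  then have "A = 0" using assms by auto
  then show ?thesis using 1 assms by auto
qed

text \<open>At a common pair the two relations give
  \<open>(a z + b) (c' z + d') = (a' z + b') (c z + d)\<close>, a quadratic equation in
  \<open>z\<close>. With three roots all its coefficients vanish, and this amounts to
  proportionality of the matrices.\<close>

lemma moebius_unique:
  assumes M: "dt M \<noteq> 0" and N: "dt N \<noteq> 0" and ne: "x \<noteq> y" "y \<noteq> z" "x \<noteq> z"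
    and "mrel M x (f x)" "mrel M y (f y)" "mrel M z (f z)"
    and "mrel N x (f x)" "mrel N y (f y)" "mrel N z (f z)"
  obtains l where "N = l *\<^sub>R M"
proof (cases M, cases N)
  fix a b c d a' b' c' d' assume MN: "M = (a, b, c, d)" "N = (a', b', c', d')"
  have key: "(a * c' - a' * c) * v\<^sup>2 + (a * d' + b * c' - a' * d - b' * c) * v + (b * d' - b' * d) = 0"
    if "mrel M v w" "mrel N v w" for v w
  proof -
    have "(a * v + b) * (c' * v + d') = (a' * v + b') * (c * v + d)"
      using that MN by simp
    then show ?thesis by (simp add: algebra_simps power2_eq_square)
  qed
  have z: "a * c' = a' * c" "a * d' + b * c' - a' * d - b' * c = 0" "b * d' = b' * d"
    using quadratic_three_zeros[OF ne key key key] assms(6-) by auto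
  \<comment> \<open>\<open>e\<close> and the expression equated to it in \<open>e'\<close> are the
    diagonal entries of \<open>mmul (adj M) N\<close>, whose off-diagonal entries vanish by
    \<open>z\<close>. So this product is \<open>e\<close> times the identity, and \<open>N\<close>
    is \<open>e / D\<close> times \<open>M\<close>.\<close>
  define D where "D = a * d - b * c"
  have D: "D \<noteq> 0" using M MN D_def by simp
  define e where "e = a' * d - b * c'"
  have e': "e = a * d' - b' * c" using z e_def by simp
  have "a' * D - e * a = b * (a * c' - a' * c)" "c' * D - e * c = d * (a * c' - a' * c)"
    unfolding D_def e_def by (simp_all add: algebra_simps)
  moreover have "b' * D - e * b = - a * (b * d' - b' * d)" "d' * D - e * d = - c * (b * d' - b' * d)"
    unfolding D_def e' by (simp_all add: algebra_simps)
  ultimately have "N = (e / D) *\<^sub>R M" using D MN z by (simp add: field_simps)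
  then show ?thesis by (rule that)
qed

text \<open>The graph of a nonzero singular matrix lies in the union of one horizontal and one
  vertical line, which cannot hold three pairs that are distinct in both coordinates. This keeps
  limits of normalized matrices invertible.\<close>

lemma dt_nonzero_if_injective:
  assumes "M \<noteq> 0" and ne: "x \<noteq> y" "y \<noteq> z" "x \<noteq> z" and ne': "x' \<noteq> y'" "y' \<noteq> z'" "x' \<noteq> z'"
    and "mrel M x x'" "mrel M y y'" "mrel M z z'"
  shows "dt M \<noteq> 0"
proof
  assume 0: "dt M = 0"
  obtain a b c d where M: "M = (a, b, c, d)" by (cases M)
  have ad: "a * d = b * c" using 0 M by simp
  have eq: "a * x + b = x' * (c * x + d)" "a * y + b = y' * (c * y + d)" "a * z + b = z' * (c * z + d)"
    using assms M by auto
  show False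
  proof (cases "c = 0 \<and> d = 0")
    case True
    then have "a * x + b = 0" "a * y + b = 0" using eq by auto
    then have "a * (x - y) = 0" unfolding right_diff_distrib by linarith
    then have "a = 0" using ne by simp
    moreover from this have "b = 0" using \<open>a * x + b = 0\<close> by simp
    ultimately show False using True M assms(1) by (simp add: zero_prod_def)
  next
    case False
    \<comment> \<open>Rank one: the first row is \<open>l\<close> times the second, so the relation
      factors as \<open>(l - w) * (c * z + d) = 0\<close>.\<close>
    obtain l where l: "a = l * c" "b = l * d"
    proof (cases "c = 0")
      case True
      then show thesis using that[of "b / d"] ad False by auto
    next
      case c: False
      have "b = a * d / c" using ad c by (simp add: field_simps)
      then show thesis using that[of "a / c"] c by simp
    qed
    have l': "(l - x') * (c * x + d) = 0" "(l - y') * (c * y + d) = 0" "(l - z') * (c * z + d) = 0"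
      using eq unfolding l by (simp_all add: algebra_simps)
    have two: False if "s \<noteq> t" "c * s + d = 0" "c * t + d = 0" for s t
    proof -
      have "c * (s - t) = 0" using that unfolding right_diff_distrib by linarith
      then have "c = 0" using that by simp
      then show False using that False by simp
    qed
    have "l = x' \<or> c * x + d = 0" "l = y' \<or> c * y + d = 0" "l = z' \<or> c * z + d = 0"
      using l' by auto
    then show False using two ne ne' by metis
  qed
qed

lemma infinite_three_points:
  assumes "infinite X"
  obtains x y z where "x \<in> X" "y \<in> X" "z \<in> X" "x \<noteq> y" "y \<noteq> z" "x \<noteq> z"
proof -
  obtain T where "T \<subseteq> X" "card T = 3"
    using assms by (metis infinite_arbitrarily_large)
  then show thesis using that by (metis card_3_iff insert_subset)
qed

section \<open>Parabolic maps and translations\<close>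

text \<open>The trace condition says that \<open>M\<close> has a double eigenvalue: as a map it is
  the identity or has a single fixed point on the projective line. \<open>Q\<close> moves that point
  to infinity and turns \<open>M\<close> into the translation by \<open>k\<close>;
  \<open>z \<noteq> w\<close> keeps \<open>z\<close> away from the pole of \<open>g\<close>.\<close>

lemma parabolic_normal_form:
  assumes "dt M \<noteq> 0" "(tr M)\<^sup>2 = 4 * dt M"
  obtains Q g k where "dt Q \<noteq> 0"
    "\<And>z w. mrel M z w \<Longrightarrow> z \<noteq> w \<Longrightarrow> mrel Q z (g z) \<and> g w = g z + k \<and> isCont g z"
proof -
  obtain a b c d where M: "M = (a, b, c, d)" by (cases M)
  have D: "a * d - b * c \<noteq> 0" and p: "(a + d)\<^sup>2 = 4 * (a * d - b * c)" using assms M by auto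
  have p': "(a - d)\<^sup>2 = - 4 * b * c" using p by (simp add: power2_eq_square algebra_simps)
  show thesis
  proof (cases "c = 0")
    case True
    then have ad: "a = d" "d \<noteq> 0" using p' D by auto
    show thesis
    proof (rule that[of "(1, 0, 0, 1)" "\<lambda>z. z" "b / d"])
      fix z w assume "mrel M z w"
      then have "w * d = d * z + b" using M ad True by simp
      then have "w = z + b / d" using ad by (simp add: field_simps)
      then show "mrel (1, 0, 0, 1) z z \<and> w = z + b / d \<and> isCont (\<lambda>z. z) z" by simp
    qed simp
  next
    case False
    \<comment> \<open>\<open>e\<close> is the double eigenvalue and \<open>f\<close> the fixed
      point; the entries \<open>a\<close>, \<open>b\<close>, \<open>d\<close> are then expressed
      through \<open>e\<close>, \<open>f\<close> and \<open>c\<close>.\<close>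
    define e where "e = (a + d) / 2"
    have e: "e \<noteq> 0" using p D e_def by auto
    define f where "f = (a - d) / (2 * c)"
    have a: "a = e + c * f" and d: "d = e - c * f"
      using False by (simp_all add: e_def f_def field_simps)
    have "(a - d)\<^sup>2 = 4 * c\<^sup>2 * f\<^sup>2" unfolding a d by (simp add: power2_eq_square algebra_simps)
    then have "4 * c * (c * f\<^sup>2 + b) = 0" using p' by (simp add: algebra_simps power2_eq_square)
    then have b: "b = - c * f\<^sup>2" using False by simp
    show thesis
    proof (rule that[of "(0, 1, 1, - f)" "\<lambda>z. 1 / (z - f)" "c / e"])
      fix z w assume m: "mrel M z w" and ne: "z \<noteq> w"
      have den: "c * z + d \<noteq> 0" using moebius_denominator assms m M by blast
      have num: "a * z + b = w * (c * z + d)" using m M by simp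
      then have eq: "(w - f) * (c * z + d) = e * (z - f)"
        by (simp add: algebra_simps a b d power2_eq_square)
      have zf: "z \<noteq> f"
      proof
        assume "z = f"
        then have "w = f" using eq den by simp
        then show False using ne \<open>z = f\<close> by simp
      qed
      then have wf: "w \<noteq> f" using eq e by auto
      have "1 / (w - f) = (c * z + d) / (e * (z - f))"
        using wf by (simp add: eq[symmetric] den)
      also have "\<dots> = 1 / (z - f) + c / e"
        using zf e by (simp add: field_simps d)
      finally show "mrel (0, 1, 1, - f) z (1 / (z - f)) \<and> 1 / (w - f) = 1 / (z - f) + c / e \<and>
          isCont (\<lambda>z. 1 / (z - f)) z"
        using zf by (auto simp: field_simps intro!: continuous_intros)
    qed simp
  qed
qed

text \<open>A Moebius map commuting with a nontrivial translation is a translation. Commutation is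
  known here only at the points \<open>x i\<close>, where comparing the two relations gives
  \<open>c * (x i + y i + k) = a - d\<close>. If \<open>c \<noteq> 0\<close>, then \<open>P\<close>
  would agree with a reflection \<open>x \<mapsto> C - x\<close>, whose matrix has lower left entry
  0.\<close>

lemma moebius_commutes_translation:
  fixes x y :: "'i \<Rightarrow> real"
  assumes P: "dt P \<noteq> 0" and k: "k \<noteq> 0" and I: "infinite I" "inj_on x I"
    and m: "\<And>i. i \<in> I \<Longrightarrow> mrel P (x i) (y i) \<and> mrel P (x i + k) (y i + k)"
  obtains \<tau> where "\<And>i. i \<in> I \<Longrightarrow> y i = x i + \<tau>"
proof -
  obtain a b c d where Pd: "P = (a, b, c, d)" by (cases P)
  obtain i1 i2 i3 where i: "i1 \<in> I" "i2 \<in> I" "i3 \<in> I" "i1 \<noteq> i2" "i2 \<noteq> i3" "i1 \<noteq> i3"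
    by (rule infinite_three_points[OF I(1)])
  then have ne: "x i1 \<noteq> x i2" "x i2 \<noteq> x i3" "x i1 \<noteq> x i3"
    using I(2) by (auto simp: inj_on_def)
  have sum: "c * (x i + y i + k) = a - d" if "i \<in> I" for i
  proof -
    have "a * x i + b = y i * (c * x i + d)" "a * (x i + k) + b = (y i + k) * (c * (x i + k) + d)"
      using m[OF that] Pd by auto
    then have "k * a = k * (c * (x i + y i + k) + d)" by (simp add: algebra_simps)
    then show ?thesis using k by simp
  qed
  have c: "c = 0"
  proof (rule ccontr)
    assume c: "c \<noteq> 0"
    define C where "C = (a - d) / c - k"
    have "c * (x i)\<^sup>2 + (a - C * c + d) * x i + (b - C * d) = 0" if "i \<in> I" for i
    proof -
      have "y i = C - x i" using sum[OF that] c by (simp add: C_def field_simps)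
      moreover have "a * x i + b = y i * (c * x i + d)" using m[OF that] Pd by auto
      ultimately have "a * x i + b = (C - x i) * (c * x i + d)" by simp
      then show ?thesis by (simp add: algebra_simps power2_eq_square)
    qed
    then show False using quadratic_three_zeros[OF ne] i c by blast
  qed
  then have ad: "a = d" using sum[OF i(1)] by simp
  then have d: "d \<noteq> 0" using P Pd c by auto
  show thesis
  proof (rule that[of "b / d"])
    fix i assume "i \<in> I"
    then have "d * x i + b = y i * d" using m[of i] Pd c ad by auto
    then show "y i = x i + b / d" using d by (simp add: field_simps)
  qed
qed

text \<open>A maximum principle: the leftmost maximum point \<open>w\<close> cannot be interior,
  because the midpoint identity on the largest symmetric interval around it would make
  \<open>w - e\<close> a maximum point too.\<close>

lemma midpoint_affine_le_0:
  fixes g :: "real \<Rightarrow> real"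
  assumes pq: "p \<le> q" and cont: "continuous_on {p..q} g" and end0: "g p = 0" "g q = 0"
    and mid: "\<And>x e. p \<le> x - e \<Longrightarrow> x + e \<le> q \<Longrightarrow> 0 < e \<Longrightarrow> 2 * g x = g (x - e) + g (x + e)"
    and x: "x \<in> {p..q}"
  shows "g x \<le> 0"
proof -
  obtain y where y: "y \<in> {p..q}" "\<And>z. z \<in> {p..q} \<Longrightarrow> g z \<le> g y"
    using continuous_attains_sup[OF _ _ cont] pq by auto
  define Y where "Y = {p..q} \<inter> g -` {g y}"
  have "closed Y"
    unfolding Y_def by (rule continuous_closed_preimage[OF cont]) simp_all
  then have "compact ({p..q} \<inter> Y)" by (intro compact_Int_closed) simp_all
  moreover have "{p..q} \<inter> Y = Y" by (auto simp: Y_def)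
  ultimately have "compact Y" by simp
  moreover have "Y \<noteq> {}" using y(1) by (auto simp: Y_def)
  ultimately have "\<exists>w\<in>Y. \<forall>z\<in>Y. w \<le> z" by (rule compact_attains_inf)
  then obtain w where "w \<in> Y" "\<forall>z\<in>Y. w \<le> z" by (elim bexE)
  then have w: "w \<in> {p..q}" "g w = g y" "\<And>z. z \<in> {p..q} \<Longrightarrow> g z = g y \<Longrightarrow> w \<le> z"
    unfolding Y_def by simp_all
  have "w = p \<or> w = q"
  proof (rule ccontr)
    assume "\<not> ?thesis"
    define e where "e = min (w - p) (q - w)"
    have e: "0 < e" "p \<le> w - e" "w + e \<le> q" using \<open>\<not> (w = p \<or> w = q)\<close> w(1) by (auto simp: e_def)
    have "g (w - e) \<le> g y" "g (w + e) \<le> g y" by (rule y(2), use e w(1) in auto)+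
    then have gw: "g (w - e) = g y" using mid[OF e(2,3,1)] w(2) by linarith
    have "w - e \<in> {p..q}" using e w(1) by auto
    then show False using w(3)[of "w - e"] gw e(1) by linarith
  qed
  then have "g y = 0" using w(2) end0 by metis
  then show ?thesis using y(2)[OF x] by simp
qed

text \<open>Subtracting the chord reduces the claim to the maximum principle for \<open>g\<close>
  and \<open>- g\<close>. This stands in for differentiating \<open>v\<close>, which is only known
  to be continuous.\<close>

lemma midpoint_affine:
  fixes v :: "real \<Rightarrow> real"
  assumes pq: "p < q" and cont: "continuous_on {p..q} v"
    and mid: "\<And>x e. p \<le> x - e \<Longrightarrow> x + e \<le> q \<Longrightarrow> 0 < e \<Longrightarrow> 2 * v x = v (x - e) + v (x + e)"
  obtains \<alpha> \<beta> where "\<And>x. x \<in> {p..q} \<Longrightarrow> v x = \<alpha> * x + \<beta>"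
proof -
  define \<alpha> where "\<alpha> = (v q - v p) / (q - p)"
  define \<beta> where "\<beta> = v p - \<alpha> * p"
  define g where "g = (\<lambda>x. v x - (\<alpha> * x + \<beta>))"
  have "g x \<le> 0" "- g x \<le> 0" if "x \<in> {p..q}" for x
  proof -
    have "\<alpha> * (q - p) = v q - v p" using pq by (simp add: \<alpha>_def)
    then have "\<alpha> * q + \<beta> = v q" unfolding right_diff_distrib \<beta>_def by linarith
    then have e: "g p = 0" "g q = 0" by (simp_all add: g_def \<beta>_def)
    have c: "continuous_on {p..q} g" unfolding g_def by (intro continuous_intros cont)
    have m: "2 * g x = g (x - e) + g (x + e)" if "p \<le> x - e" "x + e \<le> q" "0 < e" for x e
      using mid[OF that] by (simp add: g_def algebra_simps)
    show "g x \<le> 0" by (rule midpoint_affine_le_0[OF _ c e m that]) (use pq in auto)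
    have m': "2 * - g x = - g (x - e) + - g (x + e)" if "p \<le> x - e" "x + e \<le> q" "0 < e" for x e
      using m[OF that] by simp
    show "- g x \<le> 0"
      by (rule midpoint_affine_le_0[OF _ continuous_on_minus[OF c] _ _ m' that]) (use pq e in auto)
  qed
  then have "v x = \<alpha> * x + \<beta>" if "x \<in> {p..q}" for x using that by (force simp: g_def)
  then show thesis by (rule that)
qed


section \<open>Charts in which affine maps act by Moebius maps\<close>

lemma moebius_tendsto:
  assumes L: "(L \<longlongrightarrow> N) F" and w: "(w \<longlongrightarrow> v) F" and F: "F \<noteq> bot"
    and m: "\<And>n. mrel (L n) z (w n)"
  shows "mrel N z v"
proof -
  obtain a b c d where N: "N = (a, b, c, d)" by (cases N)
  define a' b' c' d' where "a' = (\<lambda>n. fst (L n))" and "b' = (\<lambda>n. fst (snd (L n)))"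
    and "c' = (\<lambda>n. fst (snd (snd (L n))))" and "d' = (\<lambda>n. snd (snd (snd (L n))))"
  note defs = this
  have L': "L n = (a' n, b' n, c' n, d' n)" for n by (simp add: defs)
  have lim: "(a' \<longlongrightarrow> a) F" "(b' \<longlongrightarrow> b) F" "(c' \<longlongrightarrow> c) F" "(d' \<longlongrightarrow> d) F"
    using tendsto_fst[OF L] tendsto_fst[OF tendsto_snd[OF L]]
      tendsto_fst[OF tendsto_snd[OF tendsto_snd[OF L]]]
      tendsto_snd[OF tendsto_snd[OF tendsto_snd[OF L]]] by (simp_all add: N defs)
  have "((\<lambda>n. a' n * z + b' n) \<longlongrightarrow> a * z + b) F"
    by (intro tendsto_intros lim)
  moreover have "((\<lambda>n. w n * (c' n * z + d' n)) \<longlongrightarrow> v * (c * z + d)) F"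
    by (intro tendsto_intros lim w)
  moreover have "a' n * z + b' n = w n * (c' n * z + d' n)" for n
    using m[of n] by (simp add: L')
  ultimately have "a * z + b = v * (c * z + d)"
    using tendsto_unique[OF F] by simp
  then show ?thesis by (simp add: N)
qed

lemma tr_dt_tendsto:
  assumes L: "(L \<longlongrightarrow> N) F"
  shows "((\<lambda>n. tr (L n)) \<longlongrightarrow> tr N) F" "((\<lambda>n. dt (L n)) \<longlongrightarrow> dt N) F"
proof -
  have tr: "tr M = fst M + snd (snd (snd M))"
    and dt: "dt M = fst M * snd (snd (snd M)) - fst (snd M) * fst (snd (snd M))" for M
    by (cases M; simp)+
  show "((\<lambda>n. tr (L n)) \<longlongrightarrow> tr N) F" "((\<lambda>n. dt (L n)) \<longlongrightarrow> dt N) F"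
    unfolding tr dt by (intro tendsto_intros L)+
qed

text \<open>The limit is found by compactness after rescaling all matrices to norm one.\<close>

lemma moebius_limit:
  fixes M :: "nat \<Rightarrow> mat2" and z w :: "'i \<Rightarrow> real"
  assumes "\<And>n. dt (M n) \<noteq> 0" and m: "\<And>n i. i \<in> I \<Longrightarrow> mrel (M n) (z i) (W n i)"
    and lim: "\<And>i. i \<in> I \<Longrightarrow> (\<lambda>n. W n i) \<longlonglongrightarrow> w i"
    and inj: "inj_on z I" "inj_on w I" and I: "infinite I"
  obtains N where "dt N \<noteq> 0" "\<And>i. i \<in> I \<Longrightarrow> mrel N (z i) (w i)"
    "\<And>\<kappa>. (\<And>n. (tr (M n))\<^sup>2 = \<kappa> * dt (M n)) \<Longrightarrow> (tr N)\<^sup>2 = \<kappa> * dt N"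
proof -
  have nz: "M n \<noteq> 0" for n
  proof
    assume "M n = 0"
    then have "M n = (0, 0, 0, 0)" by (simp add: zero_prod_def)
    then have "dt (M n) = 0" by simp
    then show False using assms(1) by blast
  qed
  define L where "L n = inverse (norm (M n)) *\<^sub>R M n" for n
  have "L n \<in> sphere 0 1" for n using nz[of n] by (simp add: L_def)
  moreover have "seq_compact (sphere (0::mat2) 1)"
    by (simp add: compact_eq_seq_compact_metric[symmetric])
  ultimately obtain N r where N: "N \<in> sphere 0 1" and r: "strict_mono r" and LN: "(L \<circ> r) \<longlonglongrightarrow> N"
    by (meson seq_compactE)
  have mN: "mrel N (z i) (w i)" if "i \<in> I" for i
  proof (rule moebius_tendsto[OF LN, of "\<lambda>n. W (r n) i"])
    show "(\<lambda>n. W (r n) i) \<longlonglongrightarrow> w i"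
      using LIMSEQ_subseq_LIMSEQ[OF lim[OF that] r] by (simp add: o_def)
    show "mrel ((L \<circ> r) n) (z i) (W (r n) i)" for n
      using m[OF that] by (simp add: L_def moebius_scaleR)
  qed simp
  obtain i j k where ijk: "i \<in> I" "j \<in> I" "k \<in> I" "i \<noteq> j" "j \<noteq> k" "i \<noteq> k"
    by (rule infinite_three_points[OF I])
  \<comment> \<open>The normalized limit is nonzero but might be singular; injectivity of
    \<open>z\<close> and \<open>w\<close> at three indices rules this out.\<close>
  have dtN: "dt N \<noteq> 0"
  proof (rule dt_nonzero_if_injective)
    show "N \<noteq> 0" using N by auto
    show "z i \<noteq> z j" "z j \<noteq> z k" "z i \<noteq> z k" "w i \<noteq> w j" "w j \<noteq> w k" "w i \<noteq> w k"
      using ijk inj by (auto simp: inj_on_def)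
    show "mrel N (z i) (w i)" "mrel N (z j) (w j)" "mrel N (z k) (w k)"
      using mN ijk by auto
  qed
  \<comment> \<open>Both sides are homogeneous of degree two in the matrix, so the equation survives
    the rescaling and passes to the limit.\<close>
  have trN: "(tr N)\<^sup>2 = \<kappa> * dt N" if "\<And>n. (tr (M n))\<^sup>2 = \<kappa> * dt (M n)" for \<kappa>
  proof -
    have "(tr ((L \<circ> r) n))\<^sup>2 = \<kappa> * dt ((L \<circ> r) n)" for n
      using that[of "r n"] by (simp add: L_def tr_scaleR dt_scaleR power_mult_distrib mult_ac)
    moreover have "(\<lambda>n. (tr ((L \<circ> r) n))\<^sup>2) \<longlonglongrightarrow> (tr N)\<^sup>2"
      "(\<lambda>n. \<kappa> * dt ((L \<circ> r) n)) \<longlonglongrightarrow> \<kappa> * dt N"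
      by (intro tendsto_intros tr_dt_tendsto LN)+
    ultimately show ?thesis by (simp add: LIMSEQ_unique)
  qed
  show thesis by (rule that[OF dtN mN trN])
qed

text \<open>For each \<open>t\<close>, a point off the finite exceptional set has a rational
  interval around it on which one matrix serves; hence the sets \<open>E (a, b)\<close> cover
  \<open>X\<close>. They are closed by \<open>moebius_limit\<close>, so by Baire one of them
  contains an interval of parameters, and quotients of matrices move that interval to 0.\<close>

lemma translations_moebius_near_zero:
  fixes u :: "real \<Rightarrow> real"
  assumes \<delta>: "\<delta> > 0" and cont: "continuous_on {-\<delta><..<\<delta>} u" and inj: "inj_on u {-\<delta><..<\<delta>}"
    and tra: "\<And>t. \<bar>t\<bar> < \<delta> / 2 \<Longrightarrow> \<exists>F. finite F \<and> (\<forall>s. \<bar>s\<bar> < \<delta> / 2 \<longrightarrow> s \<notin> F \<longrightarrow>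
      (\<exists>M. dt M \<noteq> 0 \<and> (\<forall>\<^sub>F s' in nhds s. mrel M (u s') (u (s' + t)))))"
  obtains p q \<epsilon> where "p < q" "0 < \<epsilon>" "\<epsilon> < \<delta> / 4" "- \<delta> / 2 < p" "q < \<delta> / 2"
    "\<And>t. \<bar>t\<bar> < \<epsilon> \<Longrightarrow> \<exists>M. dt M \<noteq> 0 \<and> (\<forall>s\<in>{p<..<q}. mrel M (u s) (u (s + t)))"
proof -
  \<comment> \<open>With \<open>\<bar>t\<bar> \<le> \<delta> / 8\<close> and \<open>s\<close> within
    \<open>\<delta> / 4\<close> of 0, \<open>s + t\<close> never leaves the domain of
    \<open>u\<close>.\<close>
  define X where "X = {- \<delta> / 8 .. \<delta> / 8}"
  define E where "E = (\<lambda>(a, b). {t \<in> X. \<exists>M. dt M \<noteq> 0 \<and> (\<forall>s\<in>{a<..<b}. mrel M (u s) (u (s + t)))})"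
  have E_iff: "t \<in> E (a, b) \<longleftrightarrow> t \<in> X \<and> (\<exists>M. dt M \<noteq> 0 \<and> (\<forall>s\<in>{a<..<b}. mrel M (u s) (u (s + t))))" for t a b
    by (simp add: E_def)
  have EX: "E ab \<subseteq> X" for ab
    by (cases ab) (auto simp: E_def)
  define R where "R = {(a, b). a \<in> \<rat> \<and> b \<in> \<rat> \<and> a < b \<and> - \<delta> / 4 < a \<and> b < \<delta> / 4}"
  have R: "countable R"
    by (rule countable_subset[of _ "\<rat> \<times> \<rat>"]) (auto simp: R_def countable_rat)
  have cover: "\<exists>ab\<in>R. t \<in> E ab" if t: "t \<in> X" for t
  proof -
    have "\<bar>t\<bar> < \<delta> / 2" using t \<delta> by (auto simp: X_def)
    then obtain F where F: "finite F" "\<And>s. \<bar>s\<bar> < \<delta> / 2 \<Longrightarrow> s \<notin> F \<Longrightarrow>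
      \<exists>M. dt M \<noteq> 0 \<and> (\<forall>\<^sub>F s' in nhds s. mrel M (u s') (u (s' + t)))" using tra by blast
    have "infinite {- \<delta> / 4 <..< \<delta> / 4}" using \<delta> by simp
    then obtain s where s: "s \<in> {- \<delta> / 4 <..< \<delta> / 4}" "s \<notin> F" using F(1)
      by (meson finite_subset subsetI)
    then obtain M e where M: "dt M \<noteq> 0" and e: "e > 0" "\<And>s'. dist s' s < e \<Longrightarrow> mrel M (u s') (u (s' + t))"
    proof -
      have "\<bar>s\<bar> < \<delta> / 2" using s(1) by auto
      then show thesis using F(2)[of s] s(2) that unfolding eventually_nhds_metric by blast
    qed
    define e' where "e' = min e (min (\<delta> / 4 - s) (s + \<delta> / 4))"
    have e': "0 < e'" "e' \<le> e" "e' \<le> \<delta> / 4 - s" "e' \<le> s + \<delta> / 4" using s(1) e(1) by (auto simp: e'_def)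
    obtain a where a: "a \<in> \<rat>" "s - e' < a" "a < s" using Rats_dense_in_real[of "s - e'" s] e' by auto
    obtain b where b: "b \<in> \<rat>" "s < b" "b < s + e'" using Rats_dense_in_real[of s "s + e'"] e' by auto
    have "(a, b) \<in> R" using a b e'(3,4) by (auto simp: R_def)
    moreover have "mrel M (u s') (u (s' + t))" if "s' \<in> {a<..<b}" for s'
      using that a(2) b(3) e'(2) by (intro e(2)) (auto simp: dist_real_def)
    then have "t \<in> E (a, b)" using t M unfolding E_iff by blast
    ultimately show ?thesis by blast
  qed
  have clos: "closed (E (a, b))" if ab: "(a, b) \<in> R" for a b
    unfolding closed_sequential_limits
  proof (intro allI impI, elim conjE)
    fix f t assume f: "\<forall>n. f n \<in> E (a, b)" and ft: "f \<longlonglongrightarrow> t"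
    have "f n \<in> X" for n using f by (simp add: E_iff)
    then have tX: "t \<in> X" using ft closed_sequentially[of X f t] by (auto simp: X_def)
    have "\<exists>M. \<forall>n. dt (M n) \<noteq> 0 \<and> (\<forall>s\<in>{a<..<b}. mrel (M n) (u s) (u (s + f n)))"
      using f by (intro choice) (simp add: E_iff)
    then obtain M where M: "\<And>n. dt (M n) \<noteq> 0" "\<And>n s. s \<in> {a<..<b} \<Longrightarrow> mrel (M n) (u s) (u (s + f n))"
      by blast
    have dom: "s \<in> {-\<delta><..<\<delta>} \<and> s + t \<in> {-\<delta><..<\<delta>}" if "s \<in> {a<..<b}" "t \<in> X" for s t
      using that ab by (auto simp: R_def X_def)
    obtain N where "dt N \<noteq> 0" "\<And>s. s \<in> {a<..<b} \<Longrightarrow> mrel N (u s) (u (s + t))"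
    proof (rule moebius_limit[of M "{a<..<b}" u "\<lambda>n s. u (s + f n)" "\<lambda>s. u (s + t)"])
      show "(\<lambda>n. u (s + f n)) \<longlonglongrightarrow> u (s + t)" if "s \<in> {a<..<b}" for s
      proof (rule isCont_tendsto_compose[of _ u])
        show "isCont u (s + t)"
          using cont dom[OF that tX] by (simp add: continuous_on_eq_continuous_at)
        show "(\<lambda>n. s + f n) \<longlonglongrightarrow> s + t" by (intro tendsto_intros ft)
      qed
      show "inj_on u {a<..<b}" using inj by (rule inj_on_subset) (use dom[OF _ tX] in blast)
      show "inj_on (\<lambda>s. u (s + t)) {a<..<b}"
      proof (rule inj_onI)
        fix x y assume "x \<in> {a<..<b}" "y \<in> {a<..<b}" "u (x + t) = u (y + t)"
        then have "x + t = y + t" using dom[OF _ tX] by (blast intro: inj_onD[OF inj, of "x + t" "y + t"])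
        then show "x = y" by simp
      qed
      show "infinite {a<..<b}" using ab by (auto simp: R_def)
    qed (use M in blast)+
    then show "t \<in> E (a, b)" using tX unfolding E_iff by blast
  qed
  have "top_of_set X interior_of \<Union>(E ` R) \<noteq> {}"
  proof -
    have "\<Union>(E ` R) = X" using cover EX by blast
    then have "top_of_set X interior_of \<Union>(E ` R) = X" by (metis interior_of_topspace topspace_euclidean_subtopology)
    then show ?thesis using \<delta> by (auto simp: X_def)
  qed
  moreover have "completely_metrizable_space (top_of_set X)"
    by (simp add: X_def completely_metrizable_space_closedin completely_metrizable_space_euclidean)
  moreover have "countable (E ` R)" using R by simp
  ultimately obtain A where A: "A \<in> E ` R" "\<not> (closedin (top_of_set X) A \<and> top_of_set X interior_of A = {})"
    using Baire_category_alt by meson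
  then obtain a b where ab: "(a, b) \<in> R" "A = E (a, b)" by auto
  have "closedin (top_of_set X) A"
    unfolding ab(2) by (rule closed_subset) (fact EX, fact clos[OF ab(1)])
  then have "top_of_set X interior_of A \<noteq> {}" using A by simp
  then obtain T x where T: "open T" "X \<inter> T \<subseteq> E (a, b)" "x \<in> X \<inter> T"
    unfolding interior_of_def openin_open ab(2) by blast
  obtain e where e: "e > 0" "ball x e \<subseteq> T" using T openE by blast
  \<comment> \<open>\<open>x\<close> may be an endpoint of \<open>X\<close>. Pulling it slightly
    towards 0 gives a point \<open>y\<close> within \<open>e / 16\<close> of \<open>x\<close> that
    has a two-sided neighbourhood in \<open>X\<close>.\<close>
  define y where "y = x * (1 - min 1 (e / (2 * \<delta>)))"
  define \<epsilon> where "\<epsilon> = min (e / 2) (min (\<delta> / 8) (\<delta> / 8 - \<bar>y\<bar>))"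
  have x8: "\<bar>x\<bar> \<le> \<delta> / 8" using T(3) by (auto simp: X_def)
  define l where "l = min 1 (e / (2 * \<delta>))"
  have l: "0 < l" "l \<le> 1" "l * \<delta> \<le> e / 2" using e \<delta> by (auto simp: l_def min_def field_simps)
  have y: "y = x - l * x" by (simp add: y_def l_def algebra_simps)
  have "\<bar>l * x\<bar> = l * \<bar>x\<bar>" using l by (simp add: abs_mult)
  also have "\<dots> \<le> l * (\<delta> / 8)" using l x8 by (intro mult_left_mono) auto
  finally have lx: "\<bar>l * x\<bar> \<le> e / 16" using l by simp
  have "\<bar>y\<bar> = (1 - l) * \<bar>x\<bar>" using l by (simp add: y_def l_def[symmetric] abs_mult)
  also have "\<dots> \<le> (1 - l) * (\<delta> / 8)" using l x8 by (intro mult_left_mono) auto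
  also have "\<dots> < \<delta> / 8" using l \<delta> by simp
  finally have y8: "\<bar>y\<bar> < \<delta> / 8" .
  have \<epsilon>: "0 < \<epsilon>" "\<epsilon> \<le> e / 2" "\<epsilon> \<le> \<delta> / 8" "\<epsilon> \<le> \<delta> / 8 - \<bar>y\<bar>" using y8 e(1) \<delta> unfolding \<epsilon>_def by linarith+
  have E: "y + t \<in> E (a, b)" if "\<bar>t\<bar> < \<epsilon>" for t
  proof -
    have "\<bar>y + t\<bar> \<le> \<delta> / 8" using that \<epsilon>(4) by linarith
    then have "y + t \<in> X" unfolding X_def abs_le_iff atLeastAtMost_iff by linarith
    moreover have "y + t \<in> ball x e"
      using that lx \<epsilon> e(1) unfolding y mem_ball dist_real_def by linarith
    ultimately show ?thesis using e T by blast
  qed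
  show thesis
  proof (rule that[of "a + y" "b + y" \<epsilon>])
    show "a + y < b + y" "- \<delta> / 2 < a + y" "b + y < \<delta> / 2" using ab(1) y8 by (auto simp: R_def)
    show "0 < \<epsilon>" "\<epsilon> < \<delta> / 4" using \<epsilon> \<delta> by auto
    fix t assume t: "\<bar>t\<bar> < \<epsilon>"
    obtain M where M: "dt M \<noteq> 0" "\<And>s. s \<in> {a<..<b} \<Longrightarrow> mrel M (u s) (u (s + (y + t)))"
      using E[OF t] unfolding E_iff by blast
    obtain M0 where M0: "dt M0 \<noteq> 0" "\<And>s. s \<in> {a<..<b} \<Longrightarrow> mrel M0 (u s) (u (s + (y + 0)))"
    proof -
      have "y + 0 \<in> E (a, b)" using \<epsilon>(1) by (intro E) simp
      then show thesis using that unfolding E_iff by blast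
    qed
    \<comment> \<open>\<open>M\<close> belongs to the translation by \<open>y + t\<close> and
      \<open>M0\<close> to that by \<open>y\<close>; their quotient is the translation by
      \<open>t\<close>, on the interval shifted by \<open>y\<close>.\<close>
    have "mrel (mmul M (adj M0)) (u s) (u (s + t))" if "s \<in> {a + y<..<b + y}" for s
    proof -
      have s: "s - y \<in> {a<..<b}" using that by auto
      have eq: "s - y + (y + 0) = s" "s - y + (y + t) = s + t" by simp_all
      show ?thesis
        using moebius_mmul[OF moebius_adj[OF M0(2)[OF s]] M(2)[OF s]] unfolding eq .
    qed
    moreover have "dt (mmul M (adj M0)) \<noteq> 0" using M M0 by (simp add: dt_mmul)
    ultimately show "\<exists>M. dt M \<noteq> 0 \<and> (\<forall>s\<in>{a + y<..<b + y}. mrel M (u s) (u (s + t)))" by blast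
  qed
qed

text \<open>\<open>N\<close> is \<open>l\<close> times the conjugate of \<open>M\<close> by
  \<open>Q\<close>. The factor appears because a Moebius map determines its matrix only up to a
  scalar; it cancels in the ratio of \<open>tr\<^sup>2\<close> to \<open>dt\<close>.\<close>

lemma conjugate_trace:
  assumes "mmul N Q = l *\<^sub>R mmul Q M" "dt Q \<noteq> 0"
  shows "tr N = l * tr M" "dt N = l\<^sup>2 * dt M"
proof -
  have 1: "tr (mmul (mmul N Q) (adj Q)) = tr N * dt Q"
    by (cases N; cases Q) (simp add: algebra_simps)
  have 2: "tr (mmul (mmul Q M) (adj Q)) = tr M * dt Q"
    by (cases M; cases Q) (simp add: algebra_simps)
  have "tr (mmul (l *\<^sub>R A) (adj Q)) = l * tr (mmul A (adj Q))" for A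
    by (cases A; cases Q) (simp add: algebra_simps)
  then have "tr N * dt Q = l * (tr M * dt Q)" using 1 2 assms(1) by metis
  then show "tr N = l * tr M" using assms(2) by simp
  have "dt N * dt Q = l\<^sup>2 * (dt Q * dt M)" using assms(1) by (metis dt_mmul dt_scaleR)
  then show "dt N = l\<^sup>2 * dt M" using assms(2) by simp
qed

text \<open>Read in the coordinate \<open>u\<close>, translations form a local one-parameter family of Moebius maps
  with conjugation-invariant ratio \<open>tr\<^sup>2 / dt\<close>.  The scaling \<open>s \<mapsto> r * s + c\<close> multiplies the
  parameter by \<open>r \<noteq> 1\<close>, so this ratio equals its limit \<open>4\<close> at the identity: all the maps are
  parabolic, and their common fixed point sent to infinity makes \<open>u\<close> affine.\<close>

lemma affine_equivariant_chart_moebius: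
  fixes u :: "real \<Rightarrow> real"
  assumes \<delta>: "\<delta> > 0" and cont: "continuous_on {-\<delta><..<\<delta>} u" and inj: "inj_on u {-\<delta><..<\<delta>}"
    and tra: "\<And>t. \<bar>t\<bar> < \<delta> / 2 \<Longrightarrow> \<exists>F. finite F \<and> (\<forall>s. \<bar>s\<bar> < \<delta> / 2 \<longrightarrow> s \<notin> F \<longrightarrow>
      (\<exists>M. dt M \<noteq> 0 \<and> (\<forall>\<^sub>F s' in nhds s. mrel M (u s') (u (s' + t)))))"
    and sca: "\<And>\<eta>. \<eta> > 0 \<Longrightarrow> \<exists>r c F. r \<noteq> 1 \<and> \<bar>r - 1\<bar> < \<eta> \<and> \<bar>c\<bar> < \<eta> \<and> finite F \<and>
      (\<forall>s. \<bar>s\<bar> < \<delta> / 2 \<longrightarrow> s \<notin> F \<longrightarrow>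
        (\<exists>M. dt M \<noteq> 0 \<and> (\<forall>\<^sub>F s' in nhds s. mrel M (u s') (u (r * s' + c)))))"
  obtains p q M where "p < q" "- \<delta> < p" "q < \<delta>" "dt M \<noteq> 0" "\<And>s. s \<in> {p<..<q} \<Longrightarrow> mrel M s (u s)"
proof -
  obtain p q \<epsilon> where pq: "p < q" "- \<delta> / 2 < p" "q < \<delta> / 2" and \<epsilon>: "0 < \<epsilon>" "\<epsilon> < \<delta> / 4"
    and ex: "\<And>t. \<bar>t\<bar> < \<epsilon> \<Longrightarrow> \<exists>M. dt M \<noteq> 0 \<and> (\<forall>s\<in>{p<..<q}. mrel M (u s) (u (s + t)))"
    by (rule translations_moebius_near_zero[OF \<delta> cont inj tra]) blast+
  define m where "m t = (SOME M. dt M \<noteq> 0 \<and> (\<forall>s\<in>{p<..<q}. mrel M (u s) (u (s + t))))" for t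
  have m: "dt (m t) \<noteq> 0" "\<And>s. s \<in> {p<..<q} \<Longrightarrow> mrel (m t) (u s) (u (s + t))" if "\<bar>t\<bar> < \<epsilon>" for t
    using someI_ex[OF ex[OF that]] unfolding m_def by blast+
  define w where "w = (q - p) / 2"
  define z0 where "z0 = (p + q) / 2"
  have pz: "p = z0 - w" and qz: "q = z0 + w" and w: "w > 0"
    using pq by (simp_all add: z0_def w_def field_simps)
  have sub: "{p<..<q} \<subseteq> {-\<delta><..<\<delta>}" using pq \<delta> by auto
  have injpq: "inj_on u {p<..<q}" by (rule inj_on_subset[OF inj sub])

  have "\<exists>\<rho>>0. \<rho> \<le> \<epsilon> \<and> (\<forall>t. \<bar>t\<bar> < \<rho> \<longrightarrow> (tr (m t))\<^sup>2 = 4 * dt (m t))"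
  proof -
    \<comment> \<open>Chosen so that \<open>s \<mapsto> r * s + c\<close> moves points of the domain
      by at most \<open>w / 4\<close>, a fraction of the half-length \<open>w\<close> of
      \<open>{p<..<q}\<close>.\<close>
    define \<eta> where "\<eta> = min (1 / 2) (w / (4 * (\<delta> + 1)))"
    have \<eta>: "\<eta> > 0" "\<eta> \<le> 1 / 2" "\<eta> \<le> w / (4 * (\<delta> + 1))"
    proof -
      show "\<eta> > 0" using w \<delta> by (simp add: \<eta>_def)
      show "\<eta> \<le> 1 / 2" "\<eta> \<le> w / (4 * (\<delta> + 1))"
        unfolding \<eta>_def by (rule min.cobounded1, rule min.cobounded2)
    qed
    have \<eta>w: "\<eta> * (\<delta> + 1) \<le> w / 4" using \<eta>(3) \<delta> by (simp add: field_simps)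
    obtain r c F where r: "r \<noteq> 1" "\<bar>r - 1\<bar> < \<eta>" and c: "\<bar>c\<bar> < \<eta>" and F: "finite F"
      and scal: "\<And>s. \<bar>s\<bar> < \<delta> / 2 \<Longrightarrow> s \<notin> F \<Longrightarrow>
        \<exists>M. dt M \<noteq> 0 \<and> (\<forall>\<^sub>F s' in nhds s. mrel M (u s') (u (r * s' + c)))"
      using sca[OF \<eta>(1)] by blast
    have r2: "1 / 2 < r" "r < 3 / 2" using r \<eta> by linarith+
    have near: "\<bar>(r * s + c) - s\<bar> \<le> w / 4" if "\<bar>s\<bar> < \<delta>" for s
    proof -
      have "\<bar>(r * s + c) - s\<bar> = \<bar>(r - 1) * s + c\<bar>" by (simp add: algebra_simps)
      also have "\<dots> \<le> \<bar>r - 1\<bar> * \<bar>s\<bar> + \<bar>c\<bar>" by (metis abs_mult abs_triangle_ineq)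
      also have "\<dots> \<le> \<eta> * \<delta> + \<eta>" using r c that \<eta> by (intro add_mono mult_mono) auto
      also have "\<dots> \<le> w / 4" using \<eta>w by (simp add: algebra_simps)
      finally show ?thesis .
    qed
    have "infinite {z0 - w / 4 <..< z0 + w / 4}" using w by simp
    then obtain s1 where s1: "s1 \<in> {z0 - w / 4 <..< z0 + w / 4}" "s1 \<notin> F"
      using F by (meson finite_subset subsetI)
    have "\<bar>s1\<bar> < \<delta> / 2" using s1(1) pq pz qz w unfolding greaterThanLessThan_iff by linarith
    from scal[OF this s1(2)] obtain Q e0 where Q: "dt Q \<noteq> 0" and e0: "e0 > 0"
      and Qm0: "\<And>s. dist s s1 < e0 \<Longrightarrow> mrel Q (u s) (u (r * s + c))"
      unfolding eventually_nhds_metric by blast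
    define e where "e = min e0 (w / 4)"
    have e: "e > 0" "e \<le> e0" "e \<le> w / 4" using e0 w by (auto simp: e_def)
    have Qm: "mrel Q (u s) (u (r * s + c))" "s \<in> {p<..<q}" "r * s + c \<in> {p<..<q}"
      if "\<bar>s - s1\<bar> < e" for s
    proof -
      show "mrel Q (u s) (u (r * s + c))" using that e by (intro Qm0) (simp add: dist_real_def)
      have s: "\<bar>s - z0\<bar> < w / 2" using that e(3) s1(1) unfolding greaterThanLessThan_iff by linarith
      then show spq: "s \<in> {p<..<q}" using pz qz w unfolding greaterThanLessThan_iff by linarith
      then have "\<bar>s\<bar> < \<delta>" using pq \<delta> unfolding greaterThanLessThan_iff by linarith
      from near[OF this] show "r * s + c \<in> {p<..<q}" using s pz qz w unfolding greaterThanLessThan_iff by linarith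
    qed
    \<comment> \<open>The bound \<open>e / 2\<close> keeps \<open>s + t\<close> where
      \<open>Q\<close> is valid; the bound \<open>\<epsilon> / 2\<close>, with
      \<open>r < 3 / 2\<close>, keeps \<open>r * t\<close> where \<open>m\<close> is
      specified.\<close>
    define \<rho> where "\<rho> = min (e / 2) (\<epsilon> / 2)"
    have \<rho>: "\<rho> > 0" "\<rho> \<le> e / 2" "\<rho> \<le> \<epsilon> / 2" unfolding \<rho>_def using e(1) \<epsilon>(1) by linarith+
    define \<kappa> where "\<kappa> t = (tr (m t))\<^sup>2 / dt (m t)" for t
    have inv1: "\<kappa> (r * t) = \<kappa> t" if t: "\<bar>t\<bar> < \<rho>" for t
    proof -
      have "\<bar>r * t\<bar> \<le> (3 / 2) * \<bar>t\<bar>" unfolding abs_mult using r2 by (intro mult_right_mono) auto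
      then have rt: "\<bar>r * t\<bar> < \<epsilon>" using t \<rho> by linarith
      have t\<epsilon>: "\<bar>t\<bar> < \<epsilon>" using t \<rho> by linarith
      define I where "I = {s1 - e / 2 <..< s1 + e / 2}"
      have I: "infinite I" using e by (simp add: I_def)
      \<comment> \<open>Scaling after translating by \<open>t\<close> equals translating by
        \<open>r * t\<close> after scaling: both products send \<open>u s\<close> to
        \<open>u (r * (s + t) + c)\<close>.\<close>
      have A: "mrel (mmul Q (m t)) (u s) (u (r * (s + t) + c))"
        and B: "mrel (mmul (m (r * t)) Q) (u s) (u (r * (s + t) + c))" and s: "s \<in> {p<..<q}"
        if "s \<in> I" for s
      proof -
        have s: "\<bar>s - s1\<bar> < e" using that e(1) unfolding I_def greaterThanLessThan_iff by linarith
        have st: "\<bar>s + t - s1\<bar> < e" using that t \<rho> unfolding I_def greaterThanLessThan_iff by linarith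
        show "s \<in> {p<..<q}" by (rule Qm(2)[OF s])
        show "mrel (mmul Q (m t)) (u s) (u (r * (s + t) + c))"
          by (rule moebius_mmul[OF m(2)[OF t\<epsilon> Qm(2)[OF s]] Qm(1)[OF st]])
        have "mrel (mmul (m (r * t)) Q) (u s) (u (r * s + c + r * t))"
          by (rule moebius_mmul[OF Qm(1)[OF s] m(2)[OF rt Qm(3)[OF s]]])
        moreover have "r * s + c + r * t = r * (s + t) + c" by (simp add: algebra_simps)
        ultimately show "mrel (mmul (m (r * t)) Q) (u s) (u (r * (s + t) + c))" by simp
      qed
      obtain i j k where ijk: "i \<in> I" "j \<in> I" "k \<in> I" "i \<noteq> j" "j \<noteq> k" "i \<noteq> k"
        by (rule infinite_three_points[OF I])
      have ne: "u i \<noteq> u j" "u j \<noteq> u k" "u i \<noteq> u k"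
        using ijk s injpq by (auto dest: inj_onD)
      \<comment> \<open>\<open>moebius_unique\<close> expects the common pairs as the graph of a
        function of the first coordinate; injectivity of \<open>u\<close> supplies it.\<close>
      define f where "f = (\<lambda>x. u (r * (the_inv_into {p<..<q} u x + t) + c))"
      have f: "u (r * (s + t) + c) = f (u s)" if "s \<in> I" for s
        using s[OF that] by (simp add: f_def the_inv_into_f_f[OF injpq])
      obtain l where l: "mmul (m (r * t)) Q = l *\<^sub>R mmul Q (m t)"
      proof (rule moebius_unique[of "mmul Q (m t)" "mmul (m (r * t)) Q" "u i" "u j" "u k" f])
        show "dt (mmul Q (m t)) \<noteq> 0" "dt (mmul (m (r * t)) Q) \<noteq> 0"
          using m(1)[OF rt] m(1)[OF t\<epsilon>] Q by (auto simp: dt_mmul)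
        show "mrel (mmul Q (m t)) (u i) (f (u i))" "mrel (mmul Q (m t)) (u j) (f (u j))"
          "mrel (mmul Q (m t)) (u k) (f (u k))"
          using A ijk f by metis+
        show "mrel (mmul (m (r * t)) Q) (u i) (f (u i))" "mrel (mmul (m (r * t)) Q) (u j) (f (u j))"
          "mrel (mmul (m (r * t)) Q) (u k) (f (u k))"
          using B ijk f by metis+
      qed (use ne that in blast)+
      note ct = conjugate_trace[OF l Q]
      have "l \<noteq> 0" using ct(2) m(1)[OF rt] by auto
      then show ?thesis unfolding \<kappa>_def ct by (simp add: power_mult_distrib)
    qed
    \<comment> \<open>Whichever of \<open>r\<close> and \<open>1 / r\<close> is below 1, so that its
      powers drive the parameter to 0.\<close>
    define r0 where "r0 = (if r < 1 then r else 1 / r)"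
    have r0: "0 < r0" "r0 < 1" using r r2 by (auto simp: r0_def)
    have inv2: "\<kappa> (r0 * t) = \<kappa> t" if t: "\<bar>t\<bar> < \<rho>" for t
    proof (cases "r < 1")
      case False
      have "1 * \<bar>t\<bar> \<le> r * \<bar>t\<bar>" using False by (intro mult_right_mono) auto
      then have "\<bar>t / r\<bar> \<le> \<bar>t\<bar>" using r2 by (simp add: abs_divide pos_divide_le_eq mult.commute)
      then have "\<bar>t / r\<bar> < \<rho>" using t by linarith
      from inv1[OF this] show ?thesis using False r2 by (simp add: r0_def)
    qed (use inv1[OF t] r0_def in simp)
    have small: "\<bar>r0 ^ n * t\<bar> < \<rho>" if "\<bar>t\<bar> < \<rho>" for n t
    proof -
      have "\<bar>r0 ^ n * t\<bar> \<le> 1 * \<bar>t\<bar>"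
        unfolding abs_mult using r0 by (intro mult_right_mono) (auto intro: power_le_one)
      then show ?thesis using that by simp
    qed
    have "(tr (m t))\<^sup>2 = 4 * dt (m t)" if t: "\<bar>t\<bar> < \<rho>" for t
    proof -
      have iter: "\<kappa> (r0 ^ n * t) = \<kappa> t" for n
      proof (induction n)
        case (Suc n)
        then show ?case using inv2[OF small[OF t], of n] by (simp add: mult.assoc)
      qed simp
      have f\<epsilon>: "\<bar>r0 ^ n * t\<bar> < \<epsilon>" for n using small[OF t, of n] \<rho> by linarith
      have "(\<lambda>n. r0 ^ n * t) \<longlonglongrightarrow> 0 * t"
        using r0 by (intro tendsto_intros LIMSEQ_realpow_zero) auto
      then have f0: "(\<lambda>n. r0 ^ n * t) \<longlonglongrightarrow> 0" by simp
      \<comment> \<open>The limit \<open>N\<close> of the maps for \<open>r0 ^ n * t\<close> fixes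
        every \<open>u s\<close>, so it is scalar, and its ratio 4 is the common value
        \<open>\<kappa> t\<close>.\<close>
      obtain N where N: "dt N \<noteq> 0" "\<And>s. s \<in> {p<..<q} \<Longrightarrow> mrel N (u s) (u s)"
        and trN: "\<And>\<kappa>. (\<And>n. (tr (m (r0 ^ n * t)))\<^sup>2 = \<kappa> * dt (m (r0 ^ n * t))) \<Longrightarrow> (tr N)\<^sup>2 = \<kappa> * dt N"
      proof (rule moebius_limit[of "\<lambda>n. m (r0 ^ n * t)" "{p<..<q}" u "\<lambda>n s. u (s + r0 ^ n * t)" u])
        show "(\<lambda>n. u (s + r0 ^ n * t)) \<longlonglongrightarrow> u s" if "s \<in> {p<..<q}" for s
        proof (rule isCont_tendsto_compose[of _ u])
          show "isCont u s"
            using cont sub that by (auto simp: continuous_on_eq_continuous_at)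
          show "(\<lambda>n. s + r0 ^ n * t) \<longlonglongrightarrow> s" using tendsto_add[OF tendsto_const f0, of s] by simp
        qed
        show "infinite {p<..<q}" using pq by simp
      qed (use m f\<epsilon> injpq in blast)+
      have "infinite {p<..<q}" using pq by simp
      then obtain i j k where ijk: "i \<in> {p<..<q}" "j \<in> {p<..<q}" "k \<in> {p<..<q}" "i \<noteq> j" "j \<noteq> k" "i \<noteq> k"
        by (rule infinite_three_points)
      have ne: "u i \<noteq> u j" "u j \<noteq> u k" "u i \<noteq> u k"
        using ijk injpq by (auto dest: inj_onD)
      obtain l where "N = l *\<^sub>R (1, 0, 0, 1)"
      proof (rule moebius_unique[of "(1, 0, 0, 1)" N "u i" "u j" "u k" "\<lambda>x. x"])
        show "mrel N (u i) (u i)" "mrel N (u j) (u j)" "mrel N (u k) (u k)" using N(2) ijk by blast+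
        show "dt (1, 0, 0, 1) \<noteq> 0" "mrel (1, 0, 0, 1) (u i) (u i)" "mrel (1, 0, 0, 1) (u j) (u j)"
          "mrel (1, 0, 0, 1) (u k) (u k)" by simp_all
      qed (use ne N(1) that in blast)+
      then have N': "N = (l, 0, 0, l)" by simp
      have "(tr N)\<^sup>2 = \<kappa> t * dt N"
      proof (rule trN)
        show "(tr (m (r0 ^ n * t)))\<^sup>2 = \<kappa> t * dt (m (r0 ^ n * t))" for n
          using iter[of n, symmetric] m(1)[OF f\<epsilon>[of n]] by (simp add: \<kappa>_def)
      qed
      then have "l * l * \<kappa> t = l * l * 4" "l \<noteq> 0" using N(1) N' by (auto simp: power2_eq_square)
      then have "\<kappa> t = 4" by simp
      moreover have "dt (m t) \<noteq> 0" using f\<epsilon>[of 0] by (intro m(1)) simp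
      ultimately show ?thesis by (simp add: \<kappa>_def divide_eq_eq)
    qed
    then show ?thesis using \<rho> \<epsilon> by (intro exI[of _ \<rho>]) auto
  qed
  then obtain \<rho> where \<rho>: "\<rho> > 0" "\<rho> \<le> \<epsilon>" and para: "\<And>t. \<bar>t\<bar> < \<rho> \<Longrightarrow> (tr (m t))\<^sup>2 = 4 * dt (m t)"
    by blast
  \<comment> \<open>One nontrivial translation fixes the coordinate \<open>v\<close>, in which it
    acts by adding \<open>k\<close>; the others are handled by commuting with it. The bound
    \<open>w / 8\<close> leaves room for two small shifts inside \<open>{p<..<q}\<close>.\<close>
  define t1 where "t1 = min \<rho> (w / 8) / 2"
  have t1: "0 < t1" "t1 < \<rho>" "t1 < w / 8" "\<bar>t1\<bar> < \<rho>" "\<bar>t1\<bar> < \<epsilon>"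
    using \<rho> w by (auto simp: t1_def min_def)
  obtain Q g k where Q: "dt Q \<noteq> 0" and
    g: "\<And>z w. mrel (m t1) z w \<Longrightarrow> z \<noteq> w \<Longrightarrow> mrel Q z (g z) \<and> g w = g z + k \<and> isCont g z"
    by (rule parabolic_normal_form[OF m(1)[OF t1(5)] para[OF t1(4)]], rule that) blast+
  define v where "v s = g (u s)" for s
  have gu: "mrel Q (u s) (v s)" "v (s + t1) = v s + k" "isCont v s" if s: "s \<in> {p<..<q}" for s
  proof -
    have dom: "s \<in> {-\<delta><..<\<delta>}" "s + t1 \<in> {-\<delta><..<\<delta>}"
      using s pq t1 \<epsilon> \<delta> unfolding greaterThanLessThan_iff by linarith+
    have "u s \<noteq> u (s + t1)" using inj_onD[OF inj _ dom] t1(1) by force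
    note gs = g[OF m(2)[OF t1(5) s] this]
    then show "mrel Q (u s) (v s)" "v (s + t1) = v s + k" by (simp_all add: v_def)
    have "isCont u s" using dom(1) cont by (simp add: continuous_on_eq_continuous_at)
    then have "isCont (\<lambda>s. g (u s)) s" by (rule isCont_o2) (use gs in blast)
    then show "isCont v s" unfolding v_def[abs_def] .
  qed
  have injv: "s = s'" if "s \<in> {p<..<q}" "s' \<in> {p<..<q}" "v s = v s'" for s s'
    using moebius_inj[OF Q gu(1)[OF that(1)]] gu(1)[OF that(2)] that inj_onD[OF injpq] by metis
  have k: "k \<noteq> 0"
  proof
    assume "k = 0"
    have "z0 \<in> {p<..<q}" "z0 + t1 \<in> {p<..<q}" using pz qz w t1 by auto
    then show False using gu(2)[of z0] injv[of z0 "z0 + t1"] \<open>k = 0\<close> t1 by simp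
  qed
  define J where "J = {z0 - w / 4 <..< z0 + w / 4}"
  have J: "infinite J" using w by (simp add: J_def)
  have shift: "\<exists>\<tau>. \<forall>s\<in>J. v (s + t) = v s + \<tau>" if t: "\<bar>t\<bar> < \<epsilon>" "\<bar>t\<bar> < w / 8" for t
  proof -
    \<comment> \<open>\<open>P\<close> is the translation by \<open>t\<close> read in the coordinate
      \<open>v\<close>. Used at \<open>s\<close> and at \<open>s + t1\<close>, it is seen to commute
      with adding \<open>k\<close>.\<close>
    define P where "P = mmul (mmul Q (m t)) (adj Q)"
    have P: "dt P \<noteq> 0" using Q m(1)[OF t(1)] by (simp add: P_def dt_mmul)
    have Pm: "mrel P (v s) (v (s + t))" if "s \<in> {p<..<q}" "s + t \<in> {p<..<q}" for s
      unfolding P_def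
      by (rule moebius_mmul[OF moebius_adj[OF gu(1)[OF that(1)]]
            moebius_mmul[OF m(2)[OF t(1) that(1)] gu(1)[OF that(2)]]])
    have mem: "s \<in> {p<..<q}" "s + t \<in> {p<..<q}" "s + t1 \<in> {p<..<q}" "s + t1 + t \<in> {p<..<q}"
      if "s \<in> J" for s
      using that t t1 pz qz w unfolding J_def greaterThanLessThan_iff by linarith+
    obtain \<tau> where "\<And>s. s \<in> J \<Longrightarrow> v (s + t) = v s + \<tau>"
    proof (rule moebius_commutes_translation[OF P k J, of v "\<lambda>s. v (s + t)"])
      show "inj_on v J" using injv mem(1) by (auto simp: inj_on_def)
      fix s assume s: "s \<in> J"
      have "v (s + t1 + t) = v (s + t) + k" using gu(2)[OF mem(2)[OF s]] by (simp add: add_ac)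
      then show "mrel P (v s) (v (s + t)) \<and> mrel P (v s + k) (v (s + t) + k)"
        using Pm[OF mem(1,2)[OF s]] Pm[OF mem(3,4)[OF s]] gu(2)[OF mem(1)[OF s]] by simp
    qed blast
    then show ?thesis by blast
  qed
  define \<mu> where "\<mu> = min \<epsilon> (w / 8) / 2"
  have \<mu>: "\<mu> > 0" "\<mu> < \<epsilon>" "\<mu> < w / 8" using \<epsilon> w by (auto simp: \<mu>_def min_def)
  have memJ: "x \<in> J" "x \<in> {p<..<q}" if "x \<in> {z0 - \<mu>..z0 + \<mu>}" for x
    using that \<mu> pz qz w by (auto simp: J_def)
  obtain \<alpha> \<beta> where \<alpha>: "\<And>x. x \<in> {z0 - \<mu>..z0 + \<mu>} \<Longrightarrow> v x = \<alpha> * x + \<beta>"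
  proof (rule midpoint_affine[of "z0 - \<mu>" "z0 + \<mu>" v])
    show "z0 - \<mu> < z0 + \<mu>" using \<mu> by simp
    show "continuous_on {z0 - \<mu>..z0 + \<mu>} v"
      using gu(3) memJ(2) by (intro continuous_at_imp_continuous_on) blast
    fix x h assume h: "z0 - \<mu> \<le> x - h" "x + h \<le> z0 + \<mu>" "0 < h"
    have "\<bar>h\<bar> < \<epsilon>" "\<bar>h\<bar> < w / 8" using h \<mu> by auto
    \<comment> \<open>The same \<open>\<tau>\<close> belongs to the step from \<open>x - h\<close>
      to \<open>x\<close> and to the step from \<open>x\<close> to \<open>x + h\<close>, whence the
      midpoint identity.\<close>
    then obtain \<tau> where \<tau>: "\<And>s. s \<in> J \<Longrightarrow> v (s + h) = v s + \<tau>" using shift by blast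
    have "x - h \<in> J" "x \<in> J" using h by (auto intro!: memJ(1))
    then show "2 * v x = v (x - h) + v (x + h)" using \<tau>[of "x - h"] \<tau>[of x] by simp
  qed blast
  have "\<alpha> \<noteq> 0"
  proof
    assume "\<alpha> = 0"
    then have "v z0 = v (z0 + \<mu>)" using \<alpha> \<mu> by simp
    then show False using injv[of z0 "z0 + \<mu>"] memJ(2) \<mu> by simp
  qed
  show thesis
  proof (rule that[of "z0 - \<mu>" "z0 + \<mu>" "mmul (adj Q) (\<alpha>, \<beta>, 0, 1)"])
    show "dt (mmul (adj Q) (\<alpha>, \<beta>, 0, 1)) \<noteq> 0" using Q \<open>\<alpha> \<noteq> 0\<close> by (simp add: dt_mmul)
    show "z0 - \<mu> < z0 + \<mu>" "- \<delta> < z0 - \<mu>" "z0 + \<mu> < \<delta>"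
      using \<mu> pz qz pq w \<delta> by auto
    fix s assume "s \<in> {z0 - \<mu><..<z0 + \<mu>}"
    then have s: "s \<in> {z0 - \<mu>..z0 + \<mu>}" by auto
    have "mrel (\<alpha>, \<beta>, 0, 1) s (v s)" using \<alpha>[OF s] by simp
    then show "mrel (mmul (adj Q) (\<alpha>, \<beta>, 0, 1)) s (u s)"
      using moebius_mmul moebius_adj gu(1)[OF memJ(2)[OF s]] by blast
  qed
qed


section \<open>The circle, local lifts and regularity\<close>

lemma continuous_on_circle_of: "continuous_on UNIV circle_of"
  by (simp add: continuous_on_open_vimage open_circle_def)

lemma tendsto_circle_of: "(circle_of \<longlongrightarrow> circle_of t) (nhds t)"
  using continuous_on_circle_of
  by (metis UNIV_I continuous_on_def at_within_open open_UNIV tendsto_at_iff_tendsto_nhds)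

lemma circle_of_surj: obtains t where "x = circle_of t"
proof -
  have "\<exists>t. x = circle_of t" by (induct x rule: circle.abs_induct) blast
  then show thesis using that by blast
qed

lemma circle_of_add_Ints [simp]: "k \<in> \<int> \<Longrightarrow> circle_of (t + k) = circle_of t"
  "k \<in> \<int> \<Longrightarrow> circle_of (t - k) = circle_of t"
  by (simp_all add: circle_of_eq_iff)

text \<open>The map \<open>t \<mapsto> e^(2 pi i t)\<close> factored through the circle. It serves
  to pull the Hausdorff property back from the complex plane.\<close>

definition circle_exp :: "circle \<Rightarrow> complex" where
  "circle_exp x = cis (2 * pi * (SOME t. circle_of t = x))"

lemma circle_exp_circle_of: "circle_exp (circle_of t) = cis (2 * pi * t)"
proof -
  define s where "s = (SOME s. circle_of s = circle_of t)"
  have "circle_of s = circle_of t" unfolding s_def by (rule someI) simp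
  then obtain k :: int where "s - t = of_int k" by (auto simp: circle_of_eq_iff elim: Ints_cases)
  then have "2 * pi * s = 2 * pi * t + 2 * pi * of_int k" by (simp add: algebra_simps)
  then have "cis (2 * pi * s) = cis (2 * pi * t) * cis (2 * pi * of_int k)" by (simp only: cis_mult)
  moreover have "cis (2 * pi * of_int k) = 1" by (rule cis_multiple_2pi) simp
  ultimately show ?thesis by (simp add: circle_exp_def s_def)
qed

lemma continuous_on_circle_exp: "continuous_on UNIV circle_exp"
proof -
  have "open (circle_exp -` B)" if "open B" for B
  proof -
    have "continuous_on UNIV (\<lambda>t. cis (2 * pi * t))" by (intro continuous_intros)
    then have "open ((\<lambda>t. cis (2 * pi * t)) -` B)" using that by (simp add: continuous_on_open_vimage)
    also have "(\<lambda>t. cis (2 * pi * t)) -` B = circle_of -` (circle_exp -` B)"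
      by (auto simp: circle_exp_circle_of)
    finally show ?thesis by (simp add: open_circle_def)
  qed
  then show ?thesis by (simp add: continuous_on_open_vimage)
qed

lemma inj_circle_exp: "inj circle_exp"
proof (rule injI)
  fix x y assume eq: "circle_exp x = circle_exp y"
  obtain s t where st: "x = circle_of s" "y = circle_of t" by (metis circle_of_surj)
  have "cis (2 * pi * s) = cis (2 * pi * t)" using eq by (simp add: st circle_exp_circle_of)
  then have "cis (2 * pi * s - 2 * pi * t) = 1" by (simp add: cis_divide[symmetric])
  then have "cos (2 * pi * s - 2 * pi * t) = 1" by (metis cis.sel(1) one_complex.sel(1))
  then obtain n :: int where "2 * pi * s - 2 * pi * t = of_int n * 2 * pi" using cos_one_2pi_int by blast
  then have "2 * pi * (s - t - of_int n) = 0" by (simp add: algebra_simps)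
  then have "s - t = of_int n" by simp
  then show "x = y" by (simp add: st circle_of_eq_iff)
qed

instance circle :: t2_space
proof
  fix x y :: circle assume "x \<noteq> y"
  then have "circle_exp x \<noteq> circle_exp y" using inj_circle_exp by (auto dest: injD)
  then obtain U V where "open U" "open V" "circle_exp x \<in> U" "circle_exp y \<in> V" "U \<inter> V = {}"
    by (metis hausdorff)
  moreover have "open (circle_exp -` W)" if "open W" for W
    using that continuous_on_circle_exp by (simp add: continuous_on_open_vimage)
  ultimately show "\<exists>U V. open U \<and> open V \<and> x \<in> U \<and> y \<in> V \<and> U \<inter> V = {}"
    by (intro exI[of _ "circle_exp -` U"] exI[of _ "circle_exp -` V"]) auto
qed

lemma compact_UNIV_circle: "compact (UNIV :: circle set)"
proof -
  have "circle_of ` {0..1} = UNIV"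
  proof -
    have "x \<in> circle_of ` {0..1}" for x
    proof -
      obtain t where "x = circle_of t" by (rule circle_of_surj)
      then have "x = circle_of (frac t)" by (simp add: frac_def)
      then show ?thesis using frac_ge_0[of t] frac_lt_1[of t] by auto
    qed
    then show ?thesis by blast
  qed
  moreover have "compact (circle_of ` {0..1})"
    by (intro compact_continuous_image continuous_on_subset[OF continuous_on_circle_of]) auto
  ultimately show ?thesis by simp
qed

lemma connected_UNIV_circle: "connected (UNIV :: circle set)"
proof -
  have "connected (range circle_of)"
    by (intro connected_continuous_image continuous_on_circle_of) simp
  moreover have "range circle_of = UNIV" using circle_of_surj by (metis surj_def)
  ultimately show ?thesis by simp
qed

lemma continuous_on_UNIV_tendsto:
  fixes f :: "'a::topological_space \<Rightarrow> 'b::topological_space"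
  assumes "continuous_on UNIV f"
  shows "(f \<longlongrightarrow> f x) (nhds x)"
  using assms by (metis UNIV_I continuous_on_def at_within_open open_UNIV tendsto_at_iff_tendsto_nhds)

lemma continuous_on_tendsto_nhds:
  fixes f :: "'a::topological_space \<Rightarrow> 'b::topological_space"
  assumes "continuous_on S f" "open S" "x \<in> S"
  shows "(f \<longlongrightarrow> f x) (nhds x)"
  using assms by (metis continuous_on_def at_within_open tendsto_at_iff_tendsto_nhds)

text \<open>A continuous function with integer values is locally constant. For two lifts of one
  circle-valued map this says that they differ locally by a fixed integer, which is how charts and
  lifts are exchanged below.\<close>

lemma eventually_diff_const:
  fixes f g :: "'a::topological_space \<Rightarrow> real"
  assumes f: "(f \<longlongrightarrow> f x) (nhds x)" and g: "(g \<longlongrightarrow> g x) (nhds x)"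
    and Z: "\<forall>\<^sub>F y in nhds x. f y - g y \<in> \<int>"
  shows "\<forall>\<^sub>F y in nhds x. f y - g y = f x - g x"
proof -
  have "((\<lambda>y. f y - g y) \<longlongrightarrow> f x - g x) (nhds x)" by (intro tendsto_intros f g)
  then have "\<forall>\<^sub>F y in nhds x. dist (f y - g y) (f x - g x) < 1" by (rule tendstoD) simp
  then show ?thesis using Z
  proof eventually_elim
    case (elim y)
    then have "(f y - g y) - (f x - g x) \<in> \<int>"
      using Ints_diff[OF _ eventually_nhds_x_imp_x[OF Z]] by blast
    moreover have "\<bar>(f y - g y) - (f x - g x)\<bar> < 1" using elim by (simp add: dist_real_def)
    ultimately show ?case by (metis Ints_nonzero_abs_less1 right_minus_eq)
  qed
qed

lemma local_coordinate_tendsto: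
  assumes "local_coordinate U \<sigma>" "x \<in> U"
  shows "(\<sigma> \<longlongrightarrow> \<sigma> x) (nhds x)"
  using assms continuous_on_tendsto_nhds[of U \<sigma> x] by (auto simp: local_coordinate_def)

lemma local_coordinate_eventually:
  assumes "local_coordinate U \<sigma>" "x \<in> U"
  shows "\<forall>\<^sub>F y in nhds x. y \<in> U \<and> circle_of (\<sigma> y) = y"
  using assms eventually_nhds_in_open[of U x] by (auto simp: local_coordinate_def elim: eventually_mono)

lemma local_coordinate_circle_of:
  assumes "local_coordinate U \<sigma>" "circle_of t \<in> U" "\<sigma> (circle_of t) = t"
  shows "\<forall>\<^sub>F s in nhds t. circle_of s \<in> U \<and> \<sigma> (circle_of s) = s"
proof -
  have 1: "\<forall>\<^sub>F s in nhds t. circle_of s \<in> U \<and> circle_of (\<sigma> (circle_of s)) = circle_of s"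
    by (rule eventually_compose_filterlim[OF local_coordinate_eventually[OF assms(1,2)] tendsto_circle_of])
  have "\<forall>\<^sub>F s in nhds t. \<sigma> (circle_of s) - s = \<sigma> (circle_of t) - t"
  proof (rule eventually_diff_const)
    show "((\<lambda>s. \<sigma> (circle_of s)) \<longlongrightarrow> \<sigma> (circle_of t)) (nhds t)"
      by (rule filterlim_compose[OF local_coordinate_tendsto[OF assms(1,2)] tendsto_circle_of])
    show "\<forall>\<^sub>F s in nhds t. \<sigma> (circle_of s) - s \<in> \<int>"
      using 1 by (auto simp: circle_of_eq_iff elim: eventually_mono)
  qed (rule filterlim_ident)
  with 1 show ?thesis using assms(3) by (auto elim: eventually_elim2)
qed

lemma local_lift:
  fixes \<psi> :: "'a::topological_space \<Rightarrow> circle"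
  assumes "continuous_on UNIV \<psi>" "\<psi> x = circle_of z"
  obtains U u where "open U" "x \<in> U" "continuous_on U u" "u x = z" "\<And>y. y \<in> U \<Longrightarrow> circle_of (u y) = \<psi> y"
proof -
  obtain V \<sigma> where V: "local_coordinate V \<sigma>" "circle_of z \<in> V" "\<sigma> (circle_of z) = z"
    using local_coordinate_exists by blast
  have "open V" "continuous_on V \<sigma>" using V by (auto simp: local_coordinate_def)
  show thesis
  proof (rule that[of "\<psi> -` V" "\<sigma> \<circ> \<psi>"])
    show "open (\<psi> -` V)" using assms(1) \<open>open V\<close> by (simp add: continuous_on_open_vimage)
    show "continuous_on (\<psi> -` V) (\<sigma> \<circ> \<psi>)"
      by (rule continuous_on_compose) (auto intro: continuous_on_subset[OF assms(1)]
          continuous_on_subset[OF \<open>continuous_on V \<sigma>\<close>])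
  qed (use V assms(2) in \<open>auto simp: local_coordinate_def\<close>)
qed


text \<open>Local projectivity and differentiability of a circle map, read off at a point of the universal
  cover \<open>\<real>\<close> through local lifts instead of charts.\<close>

definition lproj :: "(circle \<Rightarrow> circle) \<Rightarrow> real \<Rightarrow> bool" where
  "lproj f t \<longleftrightarrow> (\<exists>M g. dt M \<noteq> 0 \<and>
    (\<forall>\<^sub>F s in nhds t. mrel M s (g s) \<and> f (circle_of s) = circle_of (g s)))"

definition lc1 :: "(circle \<Rightarrow> circle) \<Rightarrow> real \<Rightarrow> bool" where
  "lc1 f t \<longleftrightarrow> (\<exists>g D. \<forall>\<^sub>F s in nhds t. (g has_real_derivative D s) (at s) \<and> isCont D s \<and>
    f (circle_of s) = circle_of (g s))"

section \<open>Calculus of lifted Moebius maps\<close>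

lemma moebius_solve:
  assumes "dt (a, b, c, d) \<noteq> 0" "mrel (a, b, c, d) z w"
  shows "c * z + d \<noteq> 0 \<and> w = (a * z + b) / (c * z + d)"
  using moebius_denominator[OF assms] assms(2) by (simp add: field_simps)

lemma moebius_derivative:
  assumes M: "dt M \<noteq> 0" and ev: "\<forall>\<^sub>F s in nhds t. mrel M s (g s)"
  obtains D where "\<forall>\<^sub>F s in nhds t. (g has_real_derivative D s) (at s) \<and> isCont D s"
proof -
  obtain a b c d where Md: "M = (a, b, c, d)" by (cases M)
  define D where "D = (\<lambda>s. (a * d - b * c) / (c * s + d)\<^sup>2)"
  have ev': "\<forall>\<^sub>F s in nhds t. c * s + d \<noteq> 0 \<and> (a * s + b) / (c * s + d) = g s"
    using ev
  proof eventually_elim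
    case (elim s)
    show ?case using moebius_solve[OF M[unfolded Md] elim[unfolded Md]] by simp
  qed
  then have "\<forall>\<^sub>F s in nhds t. \<forall>\<^sub>F r in nhds s. c * r + d \<noteq> 0 \<and> (a * r + b) / (c * r + d) = g r"
    by (simp add: eventually_eventually)
  then have "\<forall>\<^sub>F s in nhds t. (g has_real_derivative D s) (at s) \<and> isCont D s"
    using ev'
  proof eventually_elim
    case (elim s)
    have "((\<lambda>r. (a * r + b) / (c * r + d)) has_real_derivative D s) (at s)"
      unfolding D_def using elim(2)
      by (auto intro!: derivative_eq_intros simp: power2_eq_square algebra_simps)
    moreover have "\<forall>\<^sub>F r in nhds s. (a * r + b) / (c * r + d) = g r"
      using elim(1) by eventually_elim simp
    ultimately have "(g has_real_derivative D s) (at s)"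
      using DERIV_cong_ev[of s s "\<lambda>r. (a * r + b) / (c * r + d)" g "D s" "D s"] by simp
    moreover have "isCont D s"
      unfolding D_def using elim(2) by (intro continuous_intros) auto
    ultimately show ?case by blast
  qed
  then show thesis by (rule that)
qed

lemma moebius_tendsto_nhds:
  assumes "dt M \<noteq> 0" "\<forall>\<^sub>F s in nhds t. mrel M s (g s)"
  shows "(g \<longlongrightarrow> g t) (nhds t)"
proof -
  obtain D where "\<forall>\<^sub>F s in nhds t. (g has_real_derivative D s) (at s) \<and> isCont D s"
    using moebius_derivative[OF assms] .
  then have "(g has_real_derivative D t) (at t)" using eventually_nhds_x_imp_x by blast
  then have "isCont g t" by (rule DERIV_isCont)
  then show ?thesis by (simp add: isCont_def tendsto_at_iff_tendsto_nhds)
qed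

text \<open>The relation in coordinates translated by \<open>k\<close> in the source and by
  \<open>j\<close> in the target; for integers this is a change of lift.\<close>

lemma moebius_shift:
  assumes "mrel M (z - k) w"
  shows "mrel (mmul (1, j, 0, 1) (mmul M (1, - k, 0, 1))) z (w + j)"
  by (intro moebius_mmul[OF moebius_mmul, of _ _ "z - k" _ w] assms) auto

lemma lproj_imp_lc1: "lproj f t \<Longrightarrow> lc1 f t"
proof -
  assume "lproj f t"
  then obtain M g where M: "dt M \<noteq> 0"
    and ev: "\<forall>\<^sub>F s in nhds t. mrel M s (g s) \<and> f (circle_of s) = circle_of (g s)"
    by (auto simp: lproj_def)
  have "\<forall>\<^sub>F s in nhds t. mrel M s (g s)" using ev by eventually_elim simp
  from moebius_derivative[OF M this] obtain D where
    "\<forall>\<^sub>F s in nhds t. (g has_real_derivative D s) (at s) \<and> isCont D s" .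
  with ev have "\<forall>\<^sub>F s in nhds t. (g has_real_derivative D s) (at s) \<and> isCont D s \<and>
    f (circle_of s) = circle_of (g s)"
    by eventually_elim simp
  then show ?thesis unfolding lc1_def by blast
qed

lemma lproj_compose:
  assumes f: "lproj f t" and w: "f (circle_of t) = circle_of w" and f': "lproj f' w"
  shows "lproj (f' \<circ> f) t"
proof -
  obtain M g where M: "dt M \<noteq> 0"
    and ev: "\<forall>\<^sub>F s in nhds t. mrel M s (g s) \<and> f (circle_of s) = circle_of (g s)"
    using f by (auto simp: lproj_def)
  obtain M' g' where M': "dt M' \<noteq> 0"
    and ev': "\<forall>\<^sub>F s in nhds w. mrel M' s (g' s) \<and> f' (circle_of s) = circle_of (g' s)"
    using f' by (auto simp: lproj_def)
  \<comment> \<open>The lift \<open>g\<close> need not take the value \<open>w\<close> at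
    \<open>t\<close>, but misses it by an integer, which is subtracted before \<open>g'\<close> is
    applied.\<close>
  define k where "k = g t - w"
  have "circle_of (g t) = circle_of w" using eventually_nhds_x_imp_x[OF ev] w by simp
  then have k: "k \<in> \<int>" by (simp only: k_def circle_of_eq_iff)
  have "(g \<longlongrightarrow> g t) (nhds t)"
    by (rule moebius_tendsto_nhds[OF M]) (use ev in \<open>auto elim: eventually_mono\<close>)
  then have "((\<lambda>s. g s - k) \<longlongrightarrow> g t - k) (nhds t)" by (intro tendsto_intros)
  then have "filterlim (\<lambda>s. g s - k) (nhds w) (nhds t)" by (simp add: k_def)
  from eventually_compose_filterlim[OF ev' this] ev
  have "\<forall>\<^sub>F s in nhds t. mrel (mmul (mmul (1, 0, 0, 1) (mmul M' (1, - k, 0, 1))) M) s (g' (g s - k)) \<and>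
    (f' \<circ> f) (circle_of s) = circle_of (g' (g s - k))"
  proof eventually_elim
    case (elim s)
    then have "mrel M' (g s - k) (g' (g s - k))" "mrel M s (g s)" by auto
    then have "mrel (mmul (mmul (1, 0, 0, 1) (mmul M' (1, - k, 0, 1))) M) s (g' (g s - k) + 0)"
      by (intro moebius_mmul[OF _ moebius_shift])
    moreover have "(f' \<circ> f) (circle_of s) = circle_of (g' (g s - k))"
      using elim k by simp
    ultimately show ?case by simp
  qed
  moreover have "dt (mmul (mmul (1, 0, 0, 1) (mmul M' (1, - k, 0, 1))) M) \<noteq> 0"
    using M M' by (simp add: dt_mmul)
  ultimately show ?thesis
    unfolding lproj_def
    by (intro exI[of _ "mmul (mmul (1, 0, 0, 1) (mmul M' (1, - k, 0, 1))) M"]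
        exI[of _ "\<lambda>s. g' (g s - k)"]) simp
qed

lemma lc1_compose:
  assumes f: "lc1 f t" and w: "f (circle_of t) = circle_of w" and f': "lc1 f' w"
  shows "lc1 (f' \<circ> f) t"
proof -
  obtain g D where
    ev: "\<forall>\<^sub>F s in nhds t. (g has_real_derivative D s) (at s) \<and> isCont D s \<and> f (circle_of s) = circle_of (g s)"
    using f by (auto simp: lc1_def)
  obtain g' D' where
    ev': "\<forall>\<^sub>F s in nhds w. (g' has_real_derivative D' s) (at s) \<and> isCont D' s \<and> f' (circle_of s) = circle_of (g' s)"
    using f' by (auto simp: lc1_def)
  define k where "k = g t - w"
  have "circle_of (g t) = circle_of w" using eventually_nhds_x_imp_x[OF ev] w by simp
  then have k: "k \<in> \<int>" by (simp only: k_def circle_of_eq_iff)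
  have "isCont g t" using eventually_nhds_x_imp_x[OF ev] DERIV_isCont by blast
  then have "(g \<longlongrightarrow> g t) (nhds t)" by (simp add: isCont_def tendsto_at_iff_tendsto_nhds)
  then have "((\<lambda>s. g s - k) \<longlongrightarrow> g t - k) (nhds t)" by (intro tendsto_intros)
  then have "filterlim (\<lambda>s. g s - k) (nhds w) (nhds t)" by (simp add: k_def)
  from eventually_compose_filterlim[OF ev' this] ev
  have "\<forall>\<^sub>F s in nhds t. ((\<lambda>s. g' (g s - k)) has_real_derivative D' (g s - k) * D s) (at s) \<and>
    isCont (\<lambda>s. D' (g s - k) * D s) s \<and> (f' \<circ> f) (circle_of s) = circle_of (g' (g s - k))"
  proof eventually_elim
    case (elim s)
    have 1: "((\<lambda>s. g s - k) has_real_derivative D s) (at s)"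
      using elim by (auto intro!: derivative_eq_intros)
    have "((\<lambda>s. g' (g s - k)) has_real_derivative D' (g s - k) * D s) (at s)"
      using DERIV_chain2[OF _ 1] elim by blast
    moreover have "isCont (\<lambda>s. D' (g s - k) * D s) s"
    proof (rule continuous_mult)
      show "isCont (\<lambda>s. D' (g s - k)) s"
        by (rule isCont_o2[OF DERIV_isCont[OF 1]]) (use elim in blast)
    qed (use elim in blast)
    ultimately show ?case using elim k by simp
  qed
  then show ?thesis unfolding lc1_def
    by (intro exI[of _ "\<lambda>s. g' (g s - k)"] exI[of _ "\<lambda>s. D' (g s - k) * D s"])
qed

lemma lproj_eventually: "lproj f t \<Longrightarrow> \<forall>\<^sub>F s in nhds t. lproj f s"
proof -
  assume "lproj f t"
  then obtain M g where M: "dt M \<noteq> 0"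
    and ev: "\<forall>\<^sub>F s in nhds t. mrel M s (g s) \<and> f (circle_of s) = circle_of (g s)"
    by (auto simp: lproj_def)
  have "\<forall>\<^sub>F s in nhds t. \<forall>\<^sub>F r in nhds s. mrel M r (g r) \<and> f (circle_of r) = circle_of (g r)"
    using ev by (simp add: eventually_eventually)
  then show ?thesis by eventually_elim (use M in \<open>auto simp: lproj_def\<close>)
qed

text \<open>The definition quantifies over all charts, while \<open>lproj\<close> asks for a single
  lift. Any two choices differ locally by integer translations, which are themselves Moebius maps,
  so one lift decides every chart.\<close>

lemma locally_projective_at_iff:
  assumes cont: "continuous_on UNIV f"
  shows "locally_projective_at f (circle_of t) \<longleftrightarrow> lproj f t"
proof
  assume L: "locally_projective_at f (circle_of t)"
  obtain U \<sigma> where U: "local_coordinate U \<sigma>" "circle_of t \<in> U" "\<sigma> (circle_of t) = t"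
    using local_coordinate_exists by blast
  obtain V \<tau> where V: "local_coordinate V \<tau>" "f (circle_of t) \<in> V"
    using local_coordinate_exists circle_of_surj by metis
  obtain a b c d where nz: "a * d - b * c \<noteq> 0" and
    ev: "\<forall>\<^sub>F y in nhds (circle_of t). c * \<sigma> y + d \<noteq> 0 \<and> \<tau> (f y) = (a * \<sigma> y + b) / (c * \<sigma> y + d)"
    using L U(1,2) V unfolding locally_projective_at_def by blast
  have "\<forall>\<^sub>F s in nhds t. f (circle_of s) \<in> V \<and> circle_of (\<tau> (f (circle_of s))) = f (circle_of s)"
    by (rule eventually_compose_filterlim[OF local_coordinate_eventually[OF V]
        filterlim_compose[OF continuous_on_UNIV_tendsto[OF cont] tendsto_circle_of]])
  with eventually_compose_filterlim[OF ev tendsto_circle_of] local_coordinate_circle_of[OF U]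
  have "\<forall>\<^sub>F s in nhds t. mrel (a, b, c, d) s (\<tau> (f (circle_of s))) \<and>
      f (circle_of s) = circle_of (\<tau> (f (circle_of s)))"
    by eventually_elim simp
  then show "lproj f t" unfolding lproj_def using nz
    by (intro exI[of _ "(a, b, c, d)"] exI[of _ "\<lambda>s. \<tau> (f (circle_of s))"]) simp
next
  assume "lproj f t"
  then obtain M g where M: "dt M \<noteq> 0"
    and ev: "\<forall>\<^sub>F s in nhds t. mrel M s (g s) \<and> f (circle_of s) = circle_of (g s)"
    by (auto simp: lproj_def)
  have gt: "(g \<longlongrightarrow> g t) (nhds t)"
    by (rule moebius_tendsto_nhds[OF M]) (use ev in \<open>auto elim: eventually_mono\<close>)
  show "locally_projective_at f (circle_of t)"
    unfolding locally_projective_at_def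
  proof (intro allI impI, elim conjE)
    fix U \<sigma> V \<tau>
    assume U: "local_coordinate U \<sigma>" "circle_of t \<in> U" and V: "local_coordinate V \<tau>" "f (circle_of t) \<in> V"
    define x where "x = circle_of t"
    define k where "k = \<sigma> x - t"
    have "circle_of (\<sigma> x) = circle_of t" using U by (simp add: x_def local_coordinate_def)
    then have k: "k \<in> \<int>" by (simp only: k_def circle_of_eq_iff)
    have "((\<lambda>y. \<sigma> y - k) \<longlongrightarrow> \<sigma> x - k) (nhds x)"
      using local_coordinate_tendsto[OF U] by (intro tendsto_intros) (simp add: x_def)
    then have lim: "filterlim (\<lambda>y. \<sigma> y - k) (nhds t) (nhds x)" by (simp add: k_def)
    have U': "\<forall>\<^sub>F y in nhds x. y \<in> U \<and> circle_of (\<sigma> y) = y"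
      unfolding x_def by (rule local_coordinate_eventually[OF U])
    have V': "\<forall>\<^sub>F y in nhds x. f y \<in> V \<and> circle_of (\<tau> (f y)) = f y"
      unfolding x_def
      by (rule eventually_compose_filterlim[OF local_coordinate_eventually[OF V] continuous_on_UNIV_tendsto[OF cont]])
    have ev1: "\<forall>\<^sub>F y in nhds x. mrel M (\<sigma> y - k) (g (\<sigma> y - k)) \<and> f y = circle_of (g (\<sigma> y - k))"
      using eventually_compose_filterlim[OF ev lim] U' by eventually_elim (use k in auto)
    define j where "j = \<tau> (f x) - g (\<sigma> x - k)"
    have "\<forall>\<^sub>F y in nhds x. \<tau> (f y) - g (\<sigma> y - k) = j"
      unfolding j_def
    proof (rule eventually_diff_const)
      show "((\<lambda>y. \<tau> (f y)) \<longlongrightarrow> \<tau> (f x)) (nhds x)" unfolding x_def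
        by (rule filterlim_compose[OF local_coordinate_tendsto[OF V] continuous_on_UNIV_tendsto[OF cont]])
      have "g (\<sigma> x - k) = g t" by (simp add: k_def)
      then show "((\<lambda>y. g (\<sigma> y - k)) \<longlongrightarrow> g (\<sigma> x - k)) (nhds x)"
        using filterlim_compose[OF gt lim] by simp
      show "\<forall>\<^sub>F y in nhds x. \<tau> (f y) - g (\<sigma> y - k) \<in> \<int>"
        using ev1 V' by eventually_elim (simp add: circle_of_eq_iff[symmetric])
    qed
    define N where "N = mmul (1, j, 0, 1) (mmul M (1, - k, 0, 1))"
    have N: "dt N \<noteq> 0" using M by (simp add: N_def dt_mmul)
    obtain a b c d where Nd: "N = (a, b, c, d)" by (cases N)
    have "\<forall>\<^sub>F y in nhds x. c * \<sigma> y + d \<noteq> 0 \<and> \<tau> (f y) = (a * \<sigma> y + b) / (c * \<sigma> y + d)"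
      using \<open>\<forall>\<^sub>F y in nhds x. \<tau> (f y) - g (\<sigma> y - k) = j\<close> ev1
    proof eventually_elim
      case (elim y)
      then have "mrel N (\<sigma> y) (g (\<sigma> y - k) + j)" unfolding N_def by (intro moebius_shift) simp
      moreover have "g (\<sigma> y - k) + j = \<tau> (f y)" using elim by simp
      ultimately have "mrel (a, b, c, d) (\<sigma> y) (\<tau> (f y))" by (simp add: Nd)
      then show ?case using moebius_solve N Nd by blast
    qed
    then show "\<exists>a b c d. a * d - b * c \<noteq> 0 \<and>
      (\<forall>\<^sub>F y in nhds (circle_of t). c * \<sigma> y + d \<noteq> 0 \<and> \<tau> (f y) = (a * \<sigma> y + b) / (c * \<sigma> y + d))"
      using N Nd unfolding x_def by (intro exI[of _ a] exI[of _ b] exI[of _ c] exI[of _ d]) simp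
  qed
qed

lemma C1_map_imp_lc1:
  assumes cont: "continuous_on UNIV f" and C1: "C1_map f"
  shows "lc1 f t"
proof -
  obtain U \<sigma> where U: "local_coordinate U \<sigma>" "circle_of t \<in> U" "\<sigma> (circle_of t) = t"
    using local_coordinate_exists by blast
  obtain V \<tau> where V: "local_coordinate V \<tau>" "f (circle_of t) \<in> V"
    using local_coordinate_exists circle_of_surj by metis
  obtain W D where W: "open W" "t \<in> W" "f ` circle_of ` W \<subseteq> V"
    and D: "\<And>t. t \<in> W \<Longrightarrow> ((\<lambda>s. \<tau> (f (circle_of s))) has_real_derivative D t) (at t)" "continuous_on W D"
    using C1 U V unfolding C1_map_def by metis
  have "\<forall>\<^sub>F s in nhds t. s \<in> W" by (rule eventually_nhds_in_open[OF W(1,2)])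
  then have "\<forall>\<^sub>F s in nhds t. ((\<lambda>s. \<tau> (f (circle_of s))) has_real_derivative D s) (at s) \<and> isCont D s \<and>
    f (circle_of s) = circle_of (\<tau> (f (circle_of s)))"
  proof eventually_elim
    case (elim s)
    then have "f (circle_of s) \<in> V" "isCont D s"
      using D(2) W(1,3) by (auto simp: continuous_on_eq_continuous_at)
    then show ?case using D(1)[OF elim] V(1) by (simp add: local_coordinate_def)
  qed
  then show ?thesis unfolding lc1_def
    by (intro exI[of _ "\<lambda>s. \<tau> (f (circle_of s))"] exI[of _ D])
qed

text \<open>Near \<open>t\<close>, the map read in any charts differs from the given lift
  \<open>g\<close> by a constant \<open>j\<close>, so the same derivative \<open>D\<close> serves
  all charts.\<close>

lemma lc1_imp_C1_map:
  assumes cont: "continuous_on UNIV f" and lc1: "\<And>t. lc1 f t"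
  shows "C1_map f"
  unfolding C1_map_def
proof (intro allI impI, elim conjE)
  fix x U \<sigma> V \<tau>
  assume U: "local_coordinate U \<sigma>" "x \<in> U" and V: "local_coordinate V \<tau>" "f x \<in> V"
  define t where "t = \<sigma> x"
  have cx: "circle_of (\<sigma> x) = x" using U by (simp add: local_coordinate_def)
  then have x: "x = circle_of t" by (simp add: t_def)
  obtain g D where
    ev: "\<forall>\<^sub>F s in nhds t. (g has_real_derivative D s) (at s) \<and> isCont D s \<and> f (circle_of s) = circle_of (g s)"
    using lc1[of t] by (auto simp: lc1_def)
  have evU: "\<forall>\<^sub>F s in nhds t. circle_of s \<in> U \<and> \<sigma> (circle_of s) = s"
    by (rule local_coordinate_circle_of) (use U cx in \<open>simp_all add: t_def\<close>)
  have fc: "((\<lambda>s. f (circle_of s)) \<longlongrightarrow> f (circle_of t)) (nhds t)"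
    by (rule filterlim_compose[OF continuous_on_UNIV_tendsto[OF cont] tendsto_circle_of])
  note V' = V[unfolded x]
  have evV: "\<forall>\<^sub>F s in nhds t. f (circle_of s) \<in> V \<and> circle_of (\<tau> (f (circle_of s))) = f (circle_of s)"
    by (rule eventually_compose_filterlim[OF local_coordinate_eventually[OF V'] fc])
  define j where "j = \<tau> (f (circle_of t)) - g t"
  have "\<forall>\<^sub>F s in nhds t. \<tau> (f (circle_of s)) - g s = j"
    unfolding j_def
  proof (rule eventually_diff_const)
    show "((\<lambda>s. \<tau> (f (circle_of s))) \<longlongrightarrow> \<tau> (f (circle_of t))) (nhds t)"
      by (rule filterlim_compose[OF local_coordinate_tendsto[OF V'] fc])
    have "isCont g t" using eventually_nhds_x_imp_x[OF ev] DERIV_isCont by blast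
    then show "(g \<longlongrightarrow> g t) (nhds t)" by (simp add: isCont_def tendsto_at_iff_tendsto_nhds)
    show "\<forall>\<^sub>F s in nhds t. \<tau> (f (circle_of s)) - g s \<in> \<int>"
      using ev evV by eventually_elim (simp add: circle_of_eq_iff[symmetric])
  qed
  with ev evU evV have "\<forall>\<^sub>F s in nhds t. circle_of s \<in> U \<and> \<sigma> (circle_of s) = s \<and> f (circle_of s) \<in> V \<and>
    \<tau> (f (circle_of s)) = g s + j \<and> (g has_real_derivative D s) (at s) \<and> isCont D s"
    by eventually_elim auto
  then obtain W where W: "open W" "t \<in> W" and W': "\<And>s. s \<in> W \<Longrightarrow> circle_of s \<in> U \<and> \<sigma> (circle_of s) = s \<and>
    f (circle_of s) \<in> V \<and> \<tau> (f (circle_of s)) = g s + j \<and> (g has_real_derivative D s) (at s) \<and> isCont D s"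
    unfolding eventually_nhds by blast
  have "((\<lambda>s. \<tau> (f (circle_of s))) has_real_derivative D s) (at s)" if s: "s \<in> W" for s
  proof (rule has_field_derivative_transform_within_open[OF _ W(1) s])
    show "((\<lambda>s. g s + j) has_real_derivative D s) (at s)"
      using W'[OF s] by (auto intro!: derivative_eq_intros)
  qed (use W' in auto)
  moreover have "continuous_on W D"
    using W' by (intro continuous_at_imp_continuous_on) blast
  moreover have "W \<subseteq> \<sigma> ` U" using W' by (metis image_eqI subsetI)
  moreover have "f ` circle_of ` W \<subseteq> V" using W' by blast
  ultimately show "\<exists>W D. open W \<and> \<sigma> x \<in> W \<and> W \<subseteq> \<sigma> ` U \<and> f ` circle_of ` W \<subseteq> V \<and>
      (\<forall>t\<in>W. ((\<lambda>s. \<tau> (f (circle_of s))) has_real_derivative D t) (at t)) \<and> continuous_on W D"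
    using W by (intro exI[of _ W] exI[of _ D]) (auto simp: t_def)
qed


section \<open>Flows on the circle\<close>

text \<open>Only separate continuity is demanded. In time it will come from the compact-open
  topology tested on single points, in space from each map being a homeomorphism.\<close>

locale circle_flow =
  fixes F :: "real \<Rightarrow> circle \<Rightarrow> circle"
  assumes zero: "F 0 x = x" and add: "F (s + t) x = F s (F t x)"
    and cont_time: "continuous_on UNIV (\<lambda>t. F t x)" and cont_space: "continuous_on UNIV (F t)"
begin

definition fixed :: "circle \<Rightarrow> bool" where "fixed x \<longleftrightarrow> (\<forall>t. F t x = x)"

abbreviation orbit :: "circle \<Rightarrow> circle set" where "orbit x \<equiv> range (\<lambda>t. F t x)"

lemma inverse [simp]: "F (- t) (F t x) = x" "F t (F (- t) x) = x"
  using add[of "- t" t x] add[of t "- t" x] by (simp_all add: zero)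

lemma commute: "F s (F t x) = F t (F s x)"
  by (simp add: add[symmetric] add.commute)

lemma open_image: "open U \<Longrightarrow> open (F t ` U)"
proof -
  assume "open U"
  have "F t ` U = F (- t) -` U"
    by (auto simp: image_iff) (metis inverse(2))
  then show ?thesis using \<open>open U\<close> cont_space by (simp add: continuous_on_open_vimage)
qed

lemma fixed_flow: "fixed (F t x) \<Longrightarrow> fixed x"
  unfolding fixed_def by (metis commute inverse(1))

lemma period_int: "F T x = x \<Longrightarrow> F (of_int k * T) x = x"
proof -
  assume T: "F T x = x"
  have nat: "F (of_nat n * T) x = x" for n
    by (induction n) (simp_all add: zero T add distrib_right)
  show ?thesis
  proof (cases "k \<ge> 0")
    case True
    then show ?thesis using nat[of "nat k"] by simp
  next
    case False
    then have "F (- (of_int k * T)) x = x" using nat[of "nat (- k)"] by simp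
    then show ?thesis using inverse(2)[of "of_int k * T" x] by simp
  qed
qed

text \<open>If all times shorter than \<open>\<epsilon>\<close> fixed \<open>x\<close>, then so
  would every \<open>t\<close>, being a multiple of some short \<open>t / n\<close>.\<close>

lemma nonfixed_small_time:
  assumes "\<not> fixed x" "\<epsilon> > 0"
  obtains t where "\<bar>t\<bar> < \<epsilon>" "F t x \<noteq> x"
proof -
  obtain t where t: "F t x \<noteq> x" using assms by (auto simp: fixed_def)
  obtain n :: nat where n: "\<bar>t\<bar> / \<epsilon> < n" using reals_Archimedean2 by blast
  have n0: "real n > 0" using n assms(2) by (smt (verit) divide_nonneg_pos abs_ge_zero)
  show thesis
  proof (rule that[of "t / n"])
    show "\<bar>t / n\<bar> < \<epsilon>" using n n0 assms(2) by (simp add: abs_divide field_simps)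
    show "F (t / n) x \<noteq> x"
      using period_int[of "t / n" x "int n"] t n0 by auto
  qed
qed

text \<open>Lifted to the line, a short nonconstant piece of the orbit is connected and so contains
  an open interval; hence the piece itself contains a nonempty open set \<open>O'\<close>. Flowing
  back from a point of \<open>O'\<close> to \<open>x\<close> turns this set into a neighbourhood of
  \<open>x\<close>.\<close>

lemma nonfixed_neighbourhood:
  assumes nf: "\<not> fixed x" and \<epsilon>: "\<epsilon> > 0"
  obtains U where "open U" "x \<in> U" "U \<subseteq> (\<lambda>t. F t x) ` {-\<epsilon><..<\<epsilon>}"
proof -
  obtain z where z: "x = circle_of z" by (rule circle_of_surj)
  obtain V u where V: "open V" "0 \<in> V" "continuous_on V u" "u 0 = z"
    and u: "\<And>t. t \<in> V \<Longrightarrow> circle_of (u t) = F t x"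
    using local_lift[OF cont_time[of x], of 0 z] z by (metis zero)
  obtain e where e: "e > 0" "ball 0 e \<subseteq> V" using V openE by blast
  \<comment> \<open>The bound \<open>\<epsilon> / 2\<close> is there because flowing back combines
    two times from \<open>K\<close>.\<close>
  obtain t1 where t1: "\<bar>t1\<bar> < min e (\<epsilon> / 2)" "F t1 x \<noteq> x"
    using nonfixed_small_time[OF nf, of "min e (\<epsilon> / 2)"] e \<epsilon> by auto
  define K where "K = {- \<bar>t1\<bar>..\<bar>t1\<bar>}"
  have KV: "K \<subseteq> V" using t1 e(2) by (auto simp: K_def subset_iff dist_real_def)
  have uK: "connected (u ` K)"
    by (intro connected_continuous_image continuous_on_subset[OF V(3) KV]) (simp add: K_def)
  have mem: "0 \<in> K" "t1 \<in> K" by (auto simp: K_def)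
  have ne: "u t1 \<noteq> z" using u[of t1] KV mem t1(2) z by auto
  define B where "B = {min z (u t1)<..<max z (u t1)}"
  have "{min z (u t1)..max z (u t1)} \<subseteq> u ` K"
    by (rule connected_contains_Icc[OF uK]) (use mem V(4) in \<open>auto simp: min_def max_def\<close>)
  then have B: "B \<subseteq> u ` K" by (auto simp: B_def)
  define O' where "O' = circle_of ` B"
  have O': "open O'" unfolding O'_def by (rule open_circle_of_image) (simp add: B_def)
  have OK: "O' \<subseteq> (\<lambda>t. F t x) ` K" using B u KV by (fastforce simp: O'_def)
  have "(z + u t1) / 2 \<in> B" using ne by (auto simp: B_def min_def max_def)
  then have mid: "circle_of ((z + u t1) / 2) \<in> O'" unfolding O'_def by blast
  then obtain t0 where t0: "t0 \<in> K" "circle_of ((z + u t1) / 2) = F t0 x" using OK by blast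
  with mid have t0': "F t0 x \<in> O'" by simp
  show thesis
  proof (rule that[of "F (- t0) ` O'"])
    show "open (F (- t0) ` O')" by (rule open_image[OF O'])
    show "x \<in> F (- t0) ` O'" using t0' inverse(1)[of t0 x] by (metis imageI)
    show "F (- t0) ` O' \<subseteq> (\<lambda>t. F t x) ` {-\<epsilon><..<\<epsilon>}"
    proof
      fix y assume "y \<in> F (- t0) ` O'"
      then obtain s where s: "s \<in> K" "y = F (- t0) (F s x)" using OK by blast
      then have "y = F (s - t0) x" by (simp add: add[symmetric])
      moreover have "s - t0 \<in> {-\<epsilon><..<\<epsilon>}"
        using s(1) t0(1) t1(1) unfolding K_def atLeastAtMost_iff greaterThanLessThan_iff by linarith
      ultimately show "y \<in> (\<lambda>t. F t x) ` {-\<epsilon><..<\<epsilon>}" by blast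
    qed
  qed
qed

lemma open_interval_orbit:
  assumes nf: "\<not> fixed x"
  shows "open ((\<lambda>t. F t x) ` {-a<..<a})"
proof (rule topological_space_class.openI)
  fix y assume "y \<in> (\<lambda>t. F t x) ` {-a<..<a}"
  then obtain t where "t \<in> {-a<..<a}" and ty: "y = F t x" by blast
  then have t: "\<bar>t\<bar> < a" "y = F t x" by auto
  have nfy: "\<not> fixed y" using nf fixed_flow t by blast
  have a: "a - \<bar>t\<bar> > 0" using t by simp
  then obtain U where U: "open U" "y \<in> U" "U \<subseteq> (\<lambda>s. F s y) ` {-(a - \<bar>t\<bar>)<..<a - \<bar>t\<bar>}"
    using nonfixed_neighbourhood[OF nfy a] by blast
  have "U \<subseteq> (\<lambda>t. F t x) ` {-a<..<a}"
  proof
    fix w assume "w \<in> U"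
    then obtain s where "s \<in> {-(a - \<bar>t\<bar>)<..<a - \<bar>t\<bar>}" and w: "w = F s y" using U(3) by blast
    then have s: "\<bar>s\<bar> < a - \<bar>t\<bar>" "w = F (s + t) x" using t by (auto simp: add)
    then have "s + t \<in> {-a<..<a}" by auto
    then show "w \<in> (\<lambda>t. F t x) ` {-a<..<a}" using s by blast
  qed
  then show "\<exists>T. open T \<and> y \<in> T \<and> T \<subseteq> (\<lambda>t. F t x) ` {-a<..<a}" using U by blast
qed

lemma open_orbit:
  assumes "\<not> fixed x" shows "open (orbit x)"
proof -
  have "orbit x = (\<Union>n::nat. (\<lambda>t. F t x) ` {-real n<..<real n})"
  proof (intro subset_antisym subsetI)
    fix y assume "y \<in> orbit x"
    then obtain t where t: "y = F t x" by blast
    obtain n :: nat where "\<bar>t\<bar> < n" using reals_Archimedean2 by blast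
    then have "t \<in> {-real n<..<real n}" by (auto simp: abs_less_iff)
    then show "y \<in> (\<Union>n::nat. (\<lambda>t. F t x) ` {-real n<..<real n})" using t by blast
  qed auto
  then show ?thesis using open_interval_orbit[OF assms] by auto
qed

lemma clopen_circle: "open (S :: circle set) \<Longrightarrow> closed S \<Longrightarrow> S \<noteq> {} \<Longrightarrow> S = UNIV"
  using connected_UNIV_circle unfolding connected_clopen by (metis closedin_closed_eq closed_UNIV
      inf_top_left openin_open_eq open_UNIV subtopology_UNIV open_openin closed_closedin)

text \<open>Periodicity makes the orbit the image of the compact interval \<open>{0..T'}\<close>,
  hence closed; being open as well, it exhausts the connected circle.\<close>

lemma periodic_transitive:
  assumes nf: "\<not> fixed x" and T: "F T x = x" "T \<noteq> 0"
  shows "orbit x = UNIV"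
proof (rule clopen_circle)
  define T' where "T' = \<bar>T\<bar>"
  have T': "T' > 0" "F T' x = x"
    using T period_int[OF T(1), of "-1"] by (auto simp: T'_def abs_if)
  have "orbit x = (\<lambda>t. F t x) ` {0..T'}"
  proof (intro subset_antisym subsetI)
    fix y assume "y \<in> orbit x"
    then obtain t where t: "y = F t x" by blast
    define k where "k = \<lfloor>t / T'\<rfloor>"
    have "of_int k \<le> t / T'" "t / T' \<le> of_int k + 1" unfolding k_def by linarith+
    then have "of_int k * T' \<le> t" "t \<le> (of_int k + 1) * T'" using T'(1)
      by (simp_all add: pos_le_divide_eq pos_divide_le_eq)
    then have "t - of_int k * T' \<in> {0..T'}" by (simp add: algebra_simps)
    moreover have "y = F (t - of_int k * T') (F (of_int k * T') x)" using t by (simp add: add[symmetric])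
    ultimately show "y \<in> (\<lambda>t. F t x) ` {0..T'}" using period_int[OF T'(2)] by auto
  qed auto
  moreover have "compact ((\<lambda>t. F t x) ` {0..T'})"
    by (intro compact_continuous_image continuous_on_subset[OF cont_time]) auto
  ultimately show "closed (orbit x)" by (simp add: compact_imp_closed)
qed (use open_orbit[OF nf] in auto)

text \<open>The complement of an orbit is a union of open orbits, so the orbit is everything. By
  compactness it is already swept out by the times in some \<open>{-n<..<n}\<close>; the point at
  time \<open>n\<close> is therefore also reached at a time strictly below \<open>n\<close>, and the
  difference is a period.\<close>

lemma no_fixed_point:
  assumes "\<And>x. \<not> fixed x"
  shows "orbit x = UNIV" "\<exists>T. T \<noteq> 0 \<and> F T x = x"
proof -
  show orb: "orbit x = UNIV"
  proof (rule clopen_circle)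
    have "- orbit x = (\<Union>y\<in>- orbit x. orbit y)"
    proof (intro subset_antisym subsetI)
      fix y assume "y \<in> - orbit x"
      then show "y \<in> (\<Union>y\<in>- orbit x. orbit y)" using zero[of y] by (metis UN_I rangeI)
    next
      fix w assume "w \<in> (\<Union>y\<in>- orbit x. orbit y)"
      then obtain y t where y: "y \<notin> orbit x" "w = F t y" by blast
      have False if "w = F s x" for s
      proof -
        have "y = F (- t) (F s x)" using that y by (metis inverse(1))
        then show False using y(1) by (simp add: add[symmetric])
      qed
      then show "w \<in> - orbit x" by blast
    qed
    moreover have "open (\<Union>y\<in>- orbit x. orbit y)" using open_orbit assms by auto
    ultimately show "closed (orbit x)" by (simp add: closed_def)
  qed (use open_orbit[OF assms] in auto)
  define V where "V n = (\<lambda>t. F t x) ` {-real n<..<real n}" for n :: nat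
  have "\<exists>n::nat. y \<in> V n" for y
  proof -
    obtain t where "y = F t x" using orb by (metis UNIV_I imageE)
    moreover obtain n :: nat where "\<bar>t\<bar> < n" using reals_Archimedean2 by blast
    then have "t \<in> {-real n<..<real n}" by (auto simp: abs_less_iff)
    ultimately show ?thesis unfolding V_def by blast
  qed
  then have cov: "UNIV \<subseteq> \<Union>(range V)" by blast
  have "\<And>B. B \<in> range V \<Longrightarrow> open B" using open_interval_orbit[OF assms] by (auto simp: V_def)
  then obtain \<D> where \<D>: "\<D> \<subseteq> range V" "finite \<D>" "UNIV \<subseteq> \<Union>\<D>"
    using compactE[OF compact_UNIV_circle cov] by metis
  obtain N where N: "finite N" "\<D> = V ` N" using finite_subset_image[OF \<D>(2,1)] by blast
  define n where "n = Max (insert 0 N)"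
  have "V m \<subseteq> V n" if "m \<in> N" for m
  proof -
    have "m \<le> n" using that N(1) by (auto simp: n_def)
    then show ?thesis unfolding V_def by (intro image_mono) auto
  qed
  then have "F n x \<in> V n" using \<D>(3) N(2) by blast
  then obtain t where "t \<in> {-real n<..<real n}" and t': "F n x = F t x" unfolding V_def by blast
  then have t: "t < n" "F n x = F t x" by auto
  then have "F (n - t) x = x" by (metis add commute diff_add_cancel inverse(1) uminus_add_conv_diff)
  then show "\<exists>T. T \<noteq> 0 \<and> F T x = x" using t(1) by (intro exI[of _ "n - t"]) auto
qed

lemma transitive_stabilizer:
  assumes "orbit x = UNIV" "F T x = x"
  shows "F T y = y"
proof -
  obtain s where "y = F s x" using assms(1) by (metis UNIV_I imageE)
  then show ?thesis using commute[of T s x] assms(2) by simp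
qed

lemma closed_fixed: "closed {x. fixed x}"
proof -
  have "closed {x. F t x = x}" for t
  proof -
    have "open {x. F t x \<noteq> x}"
    proof (rule topological_space_class.openI)
      fix x assume "x \<in> {x. F t x \<noteq> x}"
      then have "F t x \<noteq> x" by simp
      from hausdorff[OF this] obtain U V
        where UV: "open U" "open V" "F t x \<in> U" "x \<in> V" "U \<inter> V = {}" by blast
      have "open (F t -` U \<inter> V)" using cont_space UV by (simp add: continuous_on_open_vimage open_Int)
      then show "\<exists>T. open T \<and> x \<in> T \<and> T \<subseteq> {x. F t x \<noteq> x}"
        using UV by (intro exI[of _ "F t -` U \<inter> V"]) auto
    qed
    moreover have "{x. F t x \<noteq> x} = - {x. F t x = x}" by auto
    ultimately show ?thesis by (simp add: closed_def)
  qed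
  moreover have "{x. fixed x} = (\<Inter>t. {x. F t x = x})" by (auto simp: fixed_def)
  ultimately show ?thesis by auto
qed

end

section \<open>Circle actions of the affine group\<close>

locale affine_action = N: circle_flow N + A: circle_flow A for N A +
  assumes rel: "A s (N t x) = N (exp (2 * s) * t) (A s x)"
    and free: "T \<noteq> 0 \<Longrightarrow> \<exists>x. N T x \<noteq> x"
begin

lemma N_has_fixed: "\<exists>x. N.fixed x"
proof (rule ccontr)
  assume *: "\<nexists>x. N.fixed x"
  obtain x :: circle where True by blast
  obtain T where "T \<noteq> 0" "N T x = x" using N.no_fixed_point(2) * by blast
  then show False using free N.transitive_stabilizer N.no_fixed_point(1) * by metis
qed

lemma N_has_nonfixed: "\<exists>x. \<not> N.fixed x"
  using free[of 1] by (auto simp: N.fixed_def)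

text \<open>A nonzero period at one nonfixed point would make the flow transitive, and
  \<open>N T\<close> would then be the identity, against \<open>free\<close>.\<close>

lemma N_free_on_nonfixed:
  assumes "\<not> N.fixed x" "N T x = x" shows "T = 0"
  using N.periodic_transitive[OF assms] N.transitive_stabilizer[OF _ assms(2)] free by blast

text \<open>A non-interior point of the fixed point set of \<open>N\<close> is fixed by \<open>A\<close>: otherwise its \<open>A\<close>-orbit
  would be an open neighbourhood of it consisting of fixed points of \<open>N\<close>.\<close>

lemma common_fixed_point: "\<exists>x. N.fixed x \<and> A.fixed x"
proof -
  define C where "C = {x. N.fixed x}"
  have AC: "A s x \<in> C" if "x \<in> C" for s x
  proof -
    \<comment> \<open>\<open>N t\<close> passes through \<open>A s\<close> at the cost of replacing
      \<open>t\<close> by \<open>exp (- (2 * s)) * t\<close>.\<close>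
    have "N t (A s x) = A s x" for t
      using rel[of s "exp (- (2 * s)) * t" x] that
      by (simp add: mult.assoc[symmetric] exp_add[symmetric] C_def N.fixed_def)
    then show ?thesis by (simp add: C_def N.fixed_def)
  qed
  have "closed C" unfolding C_def by (rule N.closed_fixed)
  moreover have "C \<noteq> {}" "C \<noteq> UNIV" using N_has_fixed N_has_nonfixed by (auto simp: C_def)
  ultimately have "\<not> open C" using N.clopen_circle by blast
  then obtain x where x: "x \<in> C" "\<And>U. open U \<Longrightarrow> x \<in> U \<Longrightarrow> \<not> U \<subseteq> C"
    by (metis topological_space_class.openI)
  have "A.fixed x"
  proof (rule ccontr)
    assume "\<not> A.fixed x"
    then have "open (A.orbit x)" by (rule A.open_orbit)
    moreover have "x \<in> A.orbit x" by (metis A.zero rangeI)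
    moreover have "A.orbit x \<subseteq> C" using AC x(1) by blast
    ultimately show False using x(2) by blast
  qed
  then show ?thesis using x(1) by (auto simp: C_def)
qed

end

text \<open>The lifts \<open>v\<close> and \<open>g \<circ> u\<close> of one curve differ by a
  locally constant integer, which a translation absorbs. Projectivity of a circle map thereby
  becomes a relation between two real curves.\<close>

lemma lproj_chart:
  assumes f: "lproj f (u s)" and u: "isCont u s" and v: "isCont v s"
    and eq: "\<forall>\<^sub>F s' in nhds s. f (circle_of (u s')) = circle_of (v s')"
  shows "\<exists>M. dt M \<noteq> 0 \<and> (\<forall>\<^sub>F s' in nhds s. mrel M (u s') (v s'))"
proof -
  obtain M g where M: "dt M \<noteq> 0"
    and ev: "\<forall>\<^sub>F z in nhds (u s). mrel M z (g z) \<and> f (circle_of z) = circle_of (g z)"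
    using f by (auto simp: lproj_def)
  have ul: "filterlim u (nhds (u s)) (nhds s)" and vl: "filterlim v (nhds (v s)) (nhds s)"
    using u v by (simp_all add: isCont_def tendsto_at_iff_tendsto_nhds)
  have gl: "(g \<longlongrightarrow> g (u s)) (nhds (u s))"
    by (rule moebius_tendsto_nhds[OF M]) (use ev in \<open>auto elim: eventually_mono\<close>)
  note ev' = eventually_compose_filterlim[OF ev ul]
  have "\<forall>\<^sub>F s' in nhds s. v s' - g (u s') = v s - g (u s)"
  proof (rule eventually_diff_const[OF vl])
    show "((\<lambda>s'. g (u s')) \<longlongrightarrow> g (u s)) (nhds s)" by (rule filterlim_compose[OF gl ul])
    show "\<forall>\<^sub>F s' in nhds s. v s' - g (u s') \<in> \<int>"
      using ev' eq by eventually_elim (simp add: circle_of_eq_iff[symmetric])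
  qed
  with ev' have "\<forall>\<^sub>F s' in nhds s. mrel (mmul (1, v s - g (u s), 0, 1) M) (u s') (v s')"
  proof eventually_elim
    case (elim s')
    show ?case by (rule moebius_mmul[of _ _ "g (u s')"]) (use elim in auto)
  qed
  then show ?thesis using M by (intro exI[of _ "mmul (1, v s - g (u s), 0, 1) M"]) (simp add: dt_mmul)
qed

lemma PC0_ProjD:
  assumes "f \<in> PC0_Proj"
  obtains F where "continuous_on UNIV f" "inj f" "finite F" "\<And>t. circle_of t \<notin> F \<Longrightarrow> lproj f t"
proof -
  obtain F where F: "finite F" "\<And>x. x \<notin> F \<Longrightarrow> locally_projective_at f x" and H: "f \<in> Homeo"
    using assms by (auto simp: PC0_Proj_def)
  obtain g where g: "homeomorphism UNIV UNIV f g" using H by (auto simp: Homeo_def)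
  show thesis
  proof (rule that[OF _ _ F(1)])
    show "continuous_on UNIV f" using g by (simp add: homeomorphism_def)
    then show "lproj f t" if "circle_of t \<notin> F" for t using F(2)[OF that] locally_projective_at_iff by blast
    show "inj f" using g by (metis homeomorphism_apply1 injI UNIV_I)
  qed
qed

text \<open>On the lifted orbit map \<open>u\<close>, the map \<open>N t\<close> acts as
  \<open>s \<mapsto> s + t\<close>, and \<open>A \<sigma>\<close> acts as
  \<open>s \<mapsto> r * s + c\<close> with \<open>r = exp (2 * \<sigma>)\<close> and
  \<open>A \<sigma> x = N c x\<close>. So \<open>u\<close> is a chart of the kind treated in
  \<open>affine_equivariant_chart_moebius\<close>.\<close>

lemma (in affine_action) orbit_chart_moebius:
  assumes N: "\<And>t. N t \<in> PC0_Proj" and A: "\<And>s. A s \<in> PC0_Proj"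
    and nf: "\<not> N.fixed x" and \<delta>: "\<delta> > 0"
    and u: "continuous_on {-\<delta><..<\<delta>} u" "\<And>t. t \<in> {-\<delta><..<\<delta>} \<Longrightarrow> circle_of (u t) = N t x"
  obtains p q M where "p < q" "- \<delta> < p" "q < \<delta>" "dt M \<noteq> 0" "\<And>s. s \<in> {p<..<q} \<Longrightarrow> mrel M s (u s)"
proof -
  have N_inj: "s = t" if "N s x = N t x" for s t
  proof -
    have "N (s - t) x = x" using that N.add[of "- t" s x] by simp
    then show ?thesis using N_free_on_nonfixed[OF nf] by fastforce
  qed
  have inj: "inj_on u {-\<delta><..<\<delta>}" by (rule inj_onI) (metis N_inj u(2))
  have isCont_u: "isCont u s" if "\<bar>s\<bar> < \<delta>" for s
    using u(1) that by (simp add: continuous_on_eq_continuous_at abs_less_iff)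
  have near: "\<exists>M. dt M \<noteq> 0 \<and> (\<forall>\<^sub>F s' in nhds s. mrel M (u s') (u (r * s' + c)))"
    if f: "lproj f (u s)" and s: "\<bar>s\<bar> < \<delta>" "\<bar>r * s + c\<bar> < \<delta>"
      and eq: "\<And>s. f (N s x) = N (r * s + c) x" for f r s c
  proof (rule lproj_chart[OF f isCont_u[OF s(1)]])
    show "isCont (\<lambda>s. u (r * s + c)) s"
      by (rule isCont_o2[where g = u]) (intro continuous_intros, rule isCont_u[OF s(2)])
    have "((\<lambda>s'. \<bar>s'\<bar>) \<longlongrightarrow> \<bar>s\<bar>) (nhds s)" "((\<lambda>s'. \<bar>r * s' + c\<bar>) \<longlongrightarrow> \<bar>r * s + c\<bar>) (nhds s)"
      by (intro tendsto_intros filterlim_ident)+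
    then have "\<forall>\<^sub>F s' in nhds s. \<bar>s'\<bar> < \<delta>" "\<forall>\<^sub>F s' in nhds s. \<bar>r * s' + c\<bar> < \<delta>"
      using s order_tendstoD(2) by blast+
    then show "\<forall>\<^sub>F s' in nhds s. f (circle_of (u s')) = circle_of (u (r * s' + c))"
      by eventually_elim (simp add: u(2) eq abs_less_iff)
  qed
  \<comment> \<open>The orbit map is injective, so finitely many bad points of the circle are met at
    finitely many times only.\<close>
  have bad: "finite {s. \<bar>s\<bar> < \<delta> \<and> circle_of (u s) \<in> F}" if "finite F" for F
  proof (rule finite_imageD)
    show "finite ((\<lambda>s. N s x) ` {s. \<bar>s\<bar> < \<delta> \<and> circle_of (u s) \<in> F})"
      by (rule finite_subset[OF _ that]) (auto simp: u(2) abs_less_iff)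
    show "inj_on (\<lambda>s. N s x) {s. \<bar>s\<bar> < \<delta> \<and> circle_of (u s) \<in> F}" using N_inj by (auto simp: inj_on_def)
  qed
  show thesis
  proof (rule affine_equivariant_chart_moebius[OF \<delta> u(1) inj])
    fix t assume t: "\<bar>t\<bar> < \<delta> / 2"
    obtain F where F: "finite F" "\<And>z. circle_of z \<notin> F \<Longrightarrow> lproj (N t) z" using PC0_ProjD[OF N[of t]] by metis
    have "\<exists>M. dt M \<noteq> 0 \<and> (\<forall>\<^sub>F s' in nhds s. mrel M (u s') (u (1 * s' + t)))"
      if "\<bar>s\<bar> < \<delta> / 2" "s \<notin> {s. \<bar>s\<bar> < \<delta> \<and> circle_of (u s) \<in> F}" for s
    proof (rule near)
      have "\<bar>s\<bar> < \<delta>" using that(1) by linarith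
      then show "lproj (N t) (u s)" "\<bar>s\<bar> < \<delta>" using that(2) by (auto intro: F(2))
      show "\<bar>1 * s + t\<bar> < \<delta>" using that(1) t by linarith
      show "N t (N s x) = N (1 * s + t) x" for s by (simp add: N.add[symmetric] add.commute)
    qed
    then show "\<exists>F. finite F \<and> (\<forall>s. \<bar>s\<bar> < \<delta> / 2 \<longrightarrow> s \<notin> F \<longrightarrow>
        (\<exists>M. dt M \<noteq> 0 \<and> (\<forall>\<^sub>F s' in nhds s. mrel M (u s') (u (s' + t)))))"
      using bad[OF F(1)] by (intro exI[of _ "{s. \<bar>s\<bar> < \<delta> \<and> circle_of (u s) \<in> F}"]) auto
  next
    fix \<eta> :: real assume \<eta>: "\<eta> > 0"
    \<comment> \<open>\<open>e\<close> will bound both \<open>\<bar>r - 1\<bar>\<close> and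
      \<open>\<bar>c\<bar>\<close>; the values \<open>1 / 4\<close> and \<open>\<delta> / 8\<close>
      keep \<open>\<bar>r * s + c\<bar>\<close> below
      \<open>(5 / 4) * (\<delta> / 2) + \<delta> / 8 < \<delta>\<close>.\<close>
    define e where "e = min \<eta> (min (1 / 4) (\<delta> / 8))"
    have e: "e > 0" "e \<le> \<eta>" "e \<le> 1 / 4" "e \<le> \<delta> / 8" using \<eta> \<delta> unfolding e_def by linarith+
    \<comment> \<open>As \<open>\<sigma>\<close> tends to 0, \<open>A \<sigma> x\<close> tends to
      \<open>x\<close> and so enters a neighbourhood swept out by short times of \<open>N\<close>;
      this yields a small \<open>c\<close>.\<close>
    obtain U where U: "open U" "x \<in> U" "U \<subseteq> (\<lambda>t. N t x) ` {-e<..<e}"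
      using N.nonfixed_neighbourhood[OF nf e(1)] .
    have "\<forall>\<^sub>F \<sigma> in nhds 0. A \<sigma> x \<in> U"
      using continuous_on_UNIV_tendsto[OF A.cont_time[of x], of 0] topological_tendstoD U(1,2)
      by (metis A.zero)
    moreover have "((\<lambda>\<sigma>. exp (2 * \<sigma>)) \<longlongrightarrow> exp (2 * 0)) (nhds (0::real))"
      by (intro tendsto_intros filterlim_ident)
    then have "\<forall>\<^sub>F \<sigma> in nhds (0::real). dist (exp (2 * \<sigma>)) (exp (2 * 0)) < e" using e(1) by (rule tendstoD)
    ultimately have "\<forall>\<^sub>F \<sigma> in nhds (0::real). A \<sigma> x \<in> U \<and> dist (exp (2 * \<sigma>)) (exp (2 * 0)) < e"
      by eventually_elim simp
    then obtain d where d: "d > 0" "\<And>\<sigma>. dist \<sigma> 0 < d \<Longrightarrow> A \<sigma> x \<in> U \<and> dist (exp (2 * \<sigma>)) (exp (2 * 0)) < e"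
      unfolding eventually_nhds_metric by blast
    define \<sigma> where "\<sigma> = d / 2"
    have \<sigma>: "\<sigma> > 0" "A \<sigma> x \<in> U" "\<bar>exp (2 * \<sigma>) - 1\<bar> < e"
      using d(1) d(2)[of \<sigma>] by (auto simp: \<sigma>_def dist_real_def)
    define r where "r = exp (2 * \<sigma>)"
    have r: "r \<noteq> 1" "\<bar>r - 1\<bar> < e" using \<sigma> by (auto simp: r_def)
    obtain c where "c \<in> {-e<..<e}" and cx: "A \<sigma> x = N c x" using U(3) \<sigma>(2) by blast
    then have c: "\<bar>c\<bar> < e" "A \<sigma> x = N c x" by auto
    obtain F where F: "finite F" "\<And>z. circle_of z \<notin> F \<Longrightarrow> lproj (A \<sigma>) z" using PC0_ProjD[OF A[of \<sigma>]] by metis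
    have "\<exists>M. dt M \<noteq> 0 \<and> (\<forall>\<^sub>F s' in nhds s. mrel M (u s') (u (r * s' + c)))"
      if s: "\<bar>s\<bar> < \<delta> / 2" "s \<notin> {s. \<bar>s\<bar> < \<delta> \<and> circle_of (u s) \<in> F}" for s
    proof (rule near)
      have s': "\<bar>s\<bar> < \<delta>" using s(1) by linarith
      then show "lproj (A \<sigma>) (u s)" "\<bar>s\<bar> < \<delta>" using s(2) by (auto intro: F(2))
      have "\<bar>r * s\<bar> \<le> (5 / 4) * \<bar>s\<bar>" unfolding abs_mult using r(2) e(3) by (intro mult_right_mono) auto
      then show "\<bar>r * s + c\<bar> < \<delta>" using s(1) c(1) e(4) by linarith
      show "A \<sigma> (N s x) = N (r * s + c) x" for s
        by (simp add: rel c(2) r_def N.add)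
    qed
    then show "\<exists>r c F. r \<noteq> 1 \<and> \<bar>r - 1\<bar> < \<eta> \<and> \<bar>c\<bar> < \<eta> \<and> finite F \<and> (\<forall>s. \<bar>s\<bar> < \<delta> / 2 \<longrightarrow> s \<notin> F \<longrightarrow>
        (\<exists>M. dt M \<noteq> 0 \<and> (\<forall>\<^sub>F s' in nhds s. mrel M (u s') (u (r * s' + c)))))"
      using r c e(2) bad[OF F(1)]
      by (intro exI[of _ r] exI[of _ c] exI[of _ "{s. \<bar>s\<bar> < \<delta> \<and> circle_of (u s) \<in> F}"]) auto
  qed (rule that)
qed


section \<open>Coverings of \<open>PSL\<^sub>2(R)\<close>\<close>

definition M2 :: "real \<Rightarrow> real \<Rightarrow> real \<Rightarrow> real \<Rightarrow> real^2^2" where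
  "M2 a b c d = (\<chi> i j. if i = 1 then (if j = 1 then a else b) else (if j = 1 then c else d))"

lemma M2_nth [simp]: "M2 a b c d $ 1 $ 1 = a" "M2 a b c d $ 1 $ 2 = b"
  "M2 a b c d $ 2 $ 1 = c" "M2 a b c d $ 2 $ 2 = d"
  by (simp_all add: M2_def)

lemma M2_eq_iff: "A = M2 a b c d \<longleftrightarrow> A $ 1 $ 1 = a \<and> A $ 1 $ 2 = b \<and> A $ 2 $ 1 = c \<and> A $ 2 $ 2 = d"
  by (auto simp: vec_eq_iff forall_2)

lemma M2_mult: "M2 a b c d ** M2 a' b' c' d' =
    M2 (a * a' + b * c') (a * b' + b * d') (c * a' + d * c') (c * b' + d * d')"
  unfolding M2_eq_iff by (simp add: matrix_matrix_mult_def sum_2)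

lemma M2_minus: "- M2 a b c d = M2 (- a) (- b) (- c) (- d)"
  unfolding M2_eq_iff by simp

lemma mat_1_M2: "mat 1 = M2 1 0 0 1"
  unfolding M2_eq_iff by (simp add: mat_def)

lemma M2_SL2: "M2 a b c d \<in> SL2 \<longleftrightarrow> a * d - b * c = 1"
  by (simp add: SL2_def det_2)

lemma psl2_of_eq_iff: "A \<in> SL2 \<Longrightarrow> B \<in> SL2 \<Longrightarrow> psl2_of A = psl2_of B \<longleftrightarrow> A = B \<or> A = - B"
  using Quotient3_rel[OF Quotient3_psl2, of A B] by auto

lemma psl2_of_surj: obtains A where "A \<in> SL2" "x = psl2_of A"
proof -
  have "\<exists>A. A \<in> SL2 \<and> x = psl2_of A" by (induct x rule: psl2.abs_induct) auto
  then show thesis using that by blast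
qed

lemma psl2_mult_of: "A \<in> SL2 \<Longrightarrow> B \<in> SL2 \<Longrightarrow> psl2_of A \<otimes>\<^bsub>PSL2\<^esub> psl2_of B = psl2_of (A ** B)"
  by (simp add: PSL2_def psl2_mult.abs_eq eq_onp_def)

lemma psl2_one_of: "\<one>\<^bsub>PSL2\<^esub> = psl2_of (M2 1 0 0 1)"
  by (simp add: PSL2_def psl2_one.abs_eq mat_1_M2)

lemma continuous_on_psl2_of:
  fixes f :: "'a::topological_space \<Rightarrow> real^2^2"
  assumes "continuous_on UNIV f" "\<And>t. f t \<in> SL2"
  shows "continuous_on UNIV (\<lambda>t. psl2_of (f t))"
proof -
  have "open ((\<lambda>t. psl2_of (f t)) -` U)" if "open U" for U
  proof -
    have "openin (top_of_set SL2) {A \<in> SL2. psl2_of A \<in> U}" using that by (simp add: open_psl2_def)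
    then obtain T where T: "open T" "{A \<in> SL2. psl2_of A \<in> U} = SL2 \<inter> T"
      unfolding openin_open by blast
    have "(\<lambda>t. psl2_of (f t)) -` U = f -` T"
      using T(2) assms(2) by blast
    then show ?thesis using T(1) assms(1) by (simp add: continuous_on_open_vimage)
  qed
  then show ?thesis by (simp add: continuous_on_open_vimage)
qed

lemma continuous_on_M2:
  assumes "continuous_on S a" "continuous_on S b" "continuous_on S c" "continuous_on S d"
  shows "continuous_on S (\<lambda>t. M2 (a t) (b t) (c t) (d t))"
  unfolding M2_def
proof (intro continuous_on_vec_lambda)
  fix i j :: 2
  show "continuous_on S (\<lambda>t. if i = 1 then (if j = 1 then a t else b t) else (if j = 1 then c t else d t))"
    using assms by (cases "i = 1"; cases "j = 1") simp_all
qed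

text \<open>A matrix is identified with its negative, so \<open>rot\<close> is already trivial at
  the multiples of \<open>pi\<close>. The diagonal entries \<open>exp t\<close> and
  \<open>exp (- t)\<close> of \<open>dia\<close> are the origin of the factor
  \<open>exp (2 * s)\<close> in \<open>dia_uni\<close>.\<close>

definition rot :: "real \<Rightarrow> psl2" where "rot t = psl2_of (M2 (cos t) (- sin t) (sin t) (cos t))"
definition dia :: "real \<Rightarrow> psl2" where "dia t = psl2_of (M2 (exp t) 0 0 (exp (- t)))"
definition uni :: "real \<Rightarrow> psl2" where "uni t = psl2_of (M2 1 t 0 1)"

lemma SL2_simps [simp]: "M2 (cos t) (- sin t) (sin t) (cos t) \<in> SL2"
  "M2 (exp t) 0 0 (exp (- t)) \<in> SL2" "M2 1 t 0 1 \<in> SL2" "M2 1 0 0 1 \<in> SL2"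
  by (simp_all add: M2_SL2 exp_minus power2_eq_square[symmetric])

lemma rot_add: "rot (s + t) = rot s \<otimes>\<^bsub>PSL2\<^esub> rot t"
  by (simp add: rot_def psl2_mult_of M2_mult cos_add sin_add algebra_simps)

lemma dia_add: "dia (s + t) = dia s \<otimes>\<^bsub>PSL2\<^esub> dia t"
  by (simp add: dia_def psl2_mult_of M2_mult exp_add[symmetric] algebra_simps)

lemma uni_add: "uni (s + t) = uni s \<otimes>\<^bsub>PSL2\<^esub> uni t"
  by (simp add: uni_def psl2_mult_of M2_mult algebra_simps)

lemma continuous_on_rot: "continuous_on UNIV rot"
  unfolding rot_def[abs_def] by (intro continuous_on_psl2_of continuous_on_M2 continuous_intros) simp
lemma continuous_on_dia: "continuous_on UNIV dia"
  unfolding dia_def[abs_def] by (intro continuous_on_psl2_of continuous_on_M2 continuous_intros) simp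
lemma continuous_on_uni: "continuous_on UNIV uni"
  unfolding uni_def[abs_def] by (intro continuous_on_psl2_of continuous_on_M2 continuous_intros) simp

lemma dia_uni: "dia s \<otimes>\<^bsub>PSL2\<^esub> uni t = uni (exp (2 * s) * t) \<otimes>\<^bsub>PSL2\<^esub> dia s"
proof -
  have "exp (2 * s) = exp s * exp s" by (metis exp_add mult_2)
  then have *: "exp (2 * s) * t * exp (- s) = exp s * t" by (simp add: exp_minus)
  show ?thesis by (simp add: dia_def uni_def psl2_mult_of M2_mult) (simp only: *)
qed

lemma rot_pi: "rot (of_nat j * pi) = \<one>\<^bsub>PSL2\<^esub>"
proof -
  have "sin (of_nat j * pi) = 0" by simp
  moreover have "cos (of_nat j * pi) = 1 \<or> cos (of_nat j * pi) = - 1"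
    by (metis cos_npi minus_one_power_iff)
  ultimately show ?thesis
    by (auto simp: rot_def psl2_one_of psl2_of_eq_iff M2_minus M2_SL2)
qed

lemma rot_half_pi: "rot (pi / 2) \<noteq> \<one>\<^bsub>PSL2\<^esub>"
proof -
  have "M2 0 (-1) 1 0 \<in> SL2" by (simp add: M2_SL2)
  then show ?thesis by (simp add: rot_def psl2_one_of psl2_of_eq_iff M2_minus M2_eq_iff)
qed

lemma uni_nontrivial: "t \<noteq> 0 \<Longrightarrow> uni t \<noteq> \<one>\<^bsub>PSL2\<^esub>"
  by (simp add: uni_def psl2_one_of psl2_of_eq_iff M2_minus M2_eq_iff)

text \<open>The first column of \<open>A\<close> has a polar form with radius \<open>r\<close> and
  angle \<open>\<theta>\<close>; undoing the rotation leaves an upper triangular matrix with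
  diagonal \<open>r\<close>, \<open>1 / r\<close>.\<close>

lemma iwasawa: "\<exists>\<theta> s t. x = rot \<theta> \<otimes>\<^bsub>PSL2\<^esub> (dia s \<otimes>\<^bsub>PSL2\<^esub> uni t)"
proof -
  obtain A where A: "A \<in> SL2" "x = psl2_of A" by (rule psl2_of_surj)
  obtain a b c d where abcd: "A = M2 a b c d" by (metis M2_eq_iff)
  have det: "a * d - b * c = 1" using A(1) abcd by (simp add: M2_SL2)
  define r where "r = sqrt (a\<^sup>2 + c\<^sup>2)"
  have "a \<noteq> 0 \<or> c \<noteq> 0" using det by auto
  then have "a\<^sup>2 + c\<^sup>2 > 0" by (simp add: sum_power2_gt_zero_iff)
  then have r: "r > 0" "r\<^sup>2 = a\<^sup>2 + c\<^sup>2" unfolding r_def by (simp_all only: real_sqrt_gt_0_iff real_sqrt_pow2 less_imp_le)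
  have "(a / r)\<^sup>2 + (c / r)\<^sup>2 = (a\<^sup>2 + c\<^sup>2) / r\<^sup>2" by (simp add: power_divide add_divide_distrib)
  also have "\<dots> = 1" using r(1) unfolding r(2)[symmetric] by simp
  finally have "(a / r)\<^sup>2 + (c / r)\<^sup>2 = 1" .
  then obtain \<theta> where \<theta>: "a / r = cos \<theta>" "c / r = sin \<theta>" by (metis sincos_total_2pi)
  have ac: "a = r * cos \<theta>" "c = r * sin \<theta>" using \<theta> r by (simp_all add: field_simps)
  define s where "s = ln r"
  have s: "exp s = r" "exp (- s) = inverse r" using r by (simp_all add: s_def exp_minus)
  \<comment> \<open>\<open>r * t\<close> is the upper right entry that remains after undoing the
    rotation; the lower right entry \<open>inverse r\<close> comes from the determinant.\<close>
  define t where "t = (b * cos \<theta> + d * sin \<theta>) / r"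
  have "inverse r = d * cos \<theta> - b * sin \<theta>"
    using det r unfolding ac by (simp add: field_simps)
  note ir0 = this
  have ir: "cos \<theta> * inverse r = d * (cos \<theta>)\<^sup>2 - b * sin \<theta> * cos \<theta>"
    "sin \<theta> * inverse r = d * sin \<theta> * cos \<theta> - b * (sin \<theta>)\<^sup>2"
    unfolding ir0 by (simp_all add: power2_eq_square algebra_simps)
  have rt: "r * t = b * cos \<theta> + d * sin \<theta>" using r by (simp add: t_def)
  have c2: "cos \<theta> * cos \<theta> = 1 - sin \<theta> * sin \<theta>" using sin_cos_squared_add3[of \<theta>] by linarith
  have 1: "cos \<theta> * (r * t) - sin \<theta> * inverse r = b"
    unfolding ir rt by (simp add: power2_eq_square c2 algebra_simps)
  have 2: "sin \<theta> * (r * t) + cos \<theta> * inverse r = d"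
    unfolding ir rt by (simp add: power2_eq_square c2 algebra_simps)
  have "A = M2 (cos \<theta>) (- sin \<theta>) (sin \<theta>) (cos \<theta>) ** (M2 (exp s) 0 0 (exp (- s)) ** M2 1 t 0 1)"
    unfolding abcd M2_mult M2_eq_iff s using ac 1 2 by (simp add: algebra_simps)
  moreover have "M2 (exp s) 0 0 (exp (- s)) ** M2 1 t 0 1 \<in> SL2"
    using SL2_simps(2)[of s] SL2_simps(3)[of t] by (simp add: SL2_def det_mul)
  ultimately have "x = rot \<theta> \<otimes>\<^bsub>PSL2\<^esub> (dia s \<otimes>\<^bsub>PSL2\<^esub> uni t)"
    unfolding A(2) rot_def dia_def uni_def by (simp add: psl2_mult_of)
  then show ?thesis by blast
qed

text \<open>\<open>F t\<close> is forced to be the \<open>n\<close>-th power of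
  \<open>f (t / n)\<close> for large \<open>n\<close>. Two choices of \<open>n\<close> agree through
  their product, and additivity holds because \<open>s + t = t + s\<close> makes
  \<open>f (s / n)\<close> and \<open>f (t / n)\<close> commute.\<close>

lemma (in group) local_hom_extends:
  fixes f :: "real \<Rightarrow> 'a"
  assumes \<epsilon>: "\<epsilon> > 0" and G: "\<And>t. \<bar>t\<bar> < \<epsilon> \<Longrightarrow> f t \<in> carrier G"
    and hom: "\<And>s t. \<bar>s\<bar> < \<epsilon> \<Longrightarrow> \<bar>t\<bar> < \<epsilon> \<Longrightarrow> \<bar>s + t\<bar> < \<epsilon> \<Longrightarrow> f (s + t) = f s \<otimes> f t"
  obtains F where "\<And>t. F t \<in> carrier G" "\<And>s t. F (s + t) = F s \<otimes> F t" "\<And>t. \<bar>t\<bar> < \<epsilon> \<Longrightarrow> F t = f t"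
proof -
  have f0: "f 0 = \<one>"
    using hom[of 0 0] G[of 0] \<epsilon> by (metis abs_zero add_0 l_cancel_one')
  have pow: "f (of_nat m * h) = f h [^] m" if "\<bar>of_nat m * h\<bar> < \<epsilon>" for m h
    using that
  proof (induction m)
    case (Suc m)
    have "\<bar>of_nat m * h\<bar> \<le> \<bar>of_nat (Suc m) * h\<bar>" "1 * \<bar>h\<bar> \<le> \<bar>of_nat (Suc m) * h\<bar>"
      unfolding abs_mult by (intro mult_right_mono; simp)+
    then have "\<bar>of_nat m * h\<bar> < \<epsilon>" "\<bar>h\<bar> < \<epsilon>" using Suc.prems by linarith+
    moreover have "of_nat (Suc m) * h = of_nat m * h + h" by (simp add: algebra_simps)
    ultimately show ?case using Suc hom[of "of_nat m * h" h] G by simp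
  qed (simp add: f0)
  define P where "P n t \<longleftrightarrow> n > 0 \<and> \<bar>t\<bar> < of_nat n * \<epsilon>" for n :: nat and t
  have small: "\<bar>t / of_nat n\<bar> < \<epsilon>" if "P n t" for n t
    using that by (simp add: P_def abs_divide pos_divide_less_eq mult.commute)
  have refine: "f (t / of_nat n) [^] n = f (t / of_nat (m * n)) [^] (m * n)" if "P n t" "m > 0" for n m t
  proof -
    have "of_nat m * (t / of_nat (m * n)) = t / of_nat n" using that by (simp add: P_def)
    moreover have "\<bar>t / of_nat n\<bar> < \<epsilon>" by (rule small[OF that(1)])
    ultimately have eq: "f (t / of_nat n) = f (t / of_nat (m * n)) [^] m"
      using pow[of m "t / of_nat (m * n)"] by simp
    have "P (m * n) t"
    proof -
      have "1 * (real n * \<epsilon>) \<le> real m * (real n * \<epsilon>)" using that \<epsilon> by (intro mult_right_mono) simp_all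
      moreover have "real (m * n) * \<epsilon> = real m * (real n * \<epsilon>)" by simp
      moreover have "\<bar>t\<bar> < real n * \<epsilon>" "m * n > 0" using that by (simp_all add: P_def)
      ultimately show ?thesis unfolding P_def by linarith
    qed
    then have "f (t / of_nat (m * n)) \<in> carrier G" using small G by blast
    then show ?thesis unfolding eq by (simp add: nat_pow_pow mult.commute)
  qed
  have exP: "\<exists>n. P n t" for t
  proof -
    obtain n :: nat where "\<bar>t\<bar> / \<epsilon> < n" using reals_Archimedean2 by blast
    then have "P (Suc n) t" using \<epsilon> by (simp add: P_def pos_divide_less_eq algebra_simps)
    then show ?thesis by blast
  qed
  define F where "F t = (let n = (SOME n. P n t) in f (t / of_nat n) [^] n)" for t
  have F: "F t = f (t / of_nat n) [^] n" if "P n t" for n t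
  proof -
    define m where "m = (SOME n. P n t)"
    have "P m t" unfolding m_def using exP by (rule someI_ex)
    then have "f (t / of_nat n) [^] n = f (t / of_nat m) [^] m"
      using refine[OF that, of m] refine[OF \<open>P m t\<close>, of n] that by (simp add: P_def mult.commute)
    then show ?thesis by (simp add: F_def Let_def m_def)
  qed
  show thesis
  proof (rule that[of F])
    show "F t \<in> carrier G" for t using exP[of t] F G small by (metis nat_pow_closed)
    show "F t = f t" if "\<bar>t\<bar> < \<epsilon>" for t using F[of 1 t] that G by (simp add: P_def)
    fix s t
    obtain n where n: "P n (\<bar>s\<bar> + \<bar>t\<bar>)" using exP by blast
    have "\<bar>s + t\<bar> \<le> \<bar>\<bar>s\<bar> + \<bar>t\<bar>\<bar>" by linarith
    then have P: "P n s" "P n t" "P n (s + t)" using n by (auto simp: P_def)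
    note sm = small[OF P(1)] small[OF P(2)] small[OF P(3)]
    have st: "(s + t) / of_nat n = s / of_nat n + t / of_nat n" by (simp add: add_divide_distrib)
    have e1: "f ((s + t) / of_nat n) = f (s / of_nat n) \<otimes> f (t / of_nat n)"
      using hom[OF sm(1,2)] sm(3) st by simp
    moreover have "f ((s + t) / of_nat n) = f (t / of_nat n) \<otimes> f (s / of_nat n)"
      using hom[OF sm(2,1)] sm(3) st by (simp add: add.commute)
    ultimately have "f ((s + t) / of_nat n) [^] n = f (s / of_nat n) [^] n \<otimes> f (t / of_nat n) [^] n"
      using pow_mult_distrib[of "f (s / of_nat n)" "f (t / of_nat n)" n] G sm by simp
    then show "F (s + t) = F s \<otimes> F t" using F[OF P(1)] F[OF P(2)] F[OF P(3)] by simp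
  qed
qed

section \<open>Lifting curves and one-parameter subgroups\<close>

locale psl2_covering =
  fixes n :: nat and H :: "('h::topological_space) monoid" and p :: "'h \<Rightarrow> psl2"
  assumes n: "n \<ge> 1" and cov: "connected_covering_of_PSL2 n H p"
begin

sublocale group H
  using cov by (simp add: connected_covering_of_PSL2_def topological_group_def)

sublocale P: group_hom H PSL2 p
  using cov group_PSL2 is_group
  by (simp add: connected_covering_of_PSL2_def group_hom_def group_hom_axioms_def)

lemma continuous_on_mult:
  assumes "continuous_on S f" "continuous_on S g" "f ` S \<subseteq> carrier H" "g ` S \<subseteq> carrier H"
  shows "continuous_on S (\<lambda>t. f t \<otimes>\<^bsub>H\<^esub> g t)"
proof -
  have "continuous_on (carrier H \<times> carrier H) (\<lambda>(x, y). x \<otimes>\<^bsub>H\<^esub> y)"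
    using cov by (simp add: connected_covering_of_PSL2_def topological_group_def)
  from continuous_on_compose2[OF this, of S "\<lambda>t. (f t, g t)"] show ?thesis
    using assms by (auto intro: continuous_on_Pair)
qed

lemma continuous_on_inv:
  assumes "continuous_on S f" "f ` S \<subseteq> carrier H"
  shows "continuous_on S (\<lambda>t. inv\<^bsub>H\<^esub> f t)"
proof -
  have "continuous_on (carrier H) (\<lambda>x. inv\<^bsub>H\<^esub> x)"
    using cov by (simp add: connected_covering_of_PSL2_def topological_group_def)
  from continuous_on_compose2[OF this assms] show ?thesis .
qed

lemma local_section:
  assumes "z \<in> carrier H"
  obtains u T q where "openin (top_of_set (carrier H)) u" "z \<in> u" "open T" "homeomorphism u T p q"
proof -
  have "covering_space (carrier H) p UNIV" using cov by (simp add: connected_covering_of_PSL2_def)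
  then obtain T v where T: "p z \<in> T" "openin (top_of_set UNIV) T" and v: "\<Union>v = carrier H \<inter> p -` T"
    "\<forall>u\<in>v. openin (top_of_set (carrier H)) u" "\<forall>u\<in>v. \<exists>q. homeomorphism u T p q"
    unfolding covering_space_def by (metis UNIV_I)
  have "z \<in> \<Union>v" using assms T(1) v(1) by blast
  then obtain u where "u \<in> v" "z \<in> u" by blast
  then show thesis using that T(2) v by (metis open_openin subtopology_UNIV)
qed

text \<open>The reason is that the fibres of \<open>p\<close> are discrete.\<close>

lemma lift_of_one:
  fixes f :: "'a::topological_space \<Rightarrow> 'h"
  assumes S: "connected S" and f: "continuous_on S f" "f ` S \<subseteq> carrier H"
    and p: "\<And>t. t \<in> S \<Longrightarrow> p (f t) = \<one>\<^bsub>PSL2\<^esub>" and s: "s \<in> S" "f s = \<one>\<^bsub>H\<^esub>" and t: "t \<in> S"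
  shows "f t = \<one>\<^bsub>H\<^esub>"
proof -
  have "\<forall>a\<in>S. eventually (\<lambda>b. f a = f b) (at a within S)"
  proof
    fix a assume a: "a \<in> S"
    obtain u T q where u: "openin (top_of_set (carrier H)) u" "f a \<in> u" and h: "homeomorphism u T p q"
      using local_section f(2) a by (metis image_subset_iff)
    obtain U where U: "open U" "u = carrier H \<inter> U" using u(1) by (auto simp: openin_open)
    have "(f \<longlongrightarrow> f a) (at a within S)" using f(1) a by (simp add: continuous_on_def)
    then have "eventually (\<lambda>b. f b \<in> U) (at a within S)"
      using U u(2) by (metis IntD2 topological_tendstoD)
    moreover have "eventually (\<lambda>b. b \<in> S) (at a within S)" by (simp add: eventually_at_filter)
    ultimately show "eventually (\<lambda>b. f a = f b) (at a within S)"
    proof eventually_elim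
      case (elim b)
      then have "f b \<in> u" using U f(2) by auto
      then show ?case using h u(2) p[OF elim(2)] p[OF a] by (metis homeomorphism_apply1)
    qed
  qed
  from connected_local_const[OF S s(1) t this] show ?thesis using s(2) by simp
qed

text \<open>The quotient of \<open>f\<close> by \<open>g\<close> lies over the identity, so
  \<open>lift_of_one\<close> applies to it. Identities in \<open>PSL2\<close> are lifted to
  \<open>H\<close> in this way.\<close>

lemma lifts_agree:
  fixes f g :: "'a::topological_space \<Rightarrow> 'h"
  assumes S: "connected S" and f: "continuous_on S f" "f ` S \<subseteq> carrier H"
    and g: "continuous_on S g" "g ` S \<subseteq> carrier H"
    and p: "\<And>t. t \<in> S \<Longrightarrow> p (f t) = p (g t)" and s: "s \<in> S" "f s = g s" and t: "t \<in> S"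
  shows "f t = g t"
proof -
  have c: "f t \<in> carrier H" "g t \<in> carrier H" if "t \<in> S" for t using f(2) g(2) that by auto
  have "f t \<otimes>\<^bsub>H\<^esub> inv\<^bsub>H\<^esub> g t = \<one>\<^bsub>H\<^esub>"
  proof (rule lift_of_one[OF S _ _ _ s(1) _ t])
    show "continuous_on S (\<lambda>t. f t \<otimes>\<^bsub>H\<^esub> inv\<^bsub>H\<^esub> g t)"
      by (intro continuous_on_mult continuous_on_inv f g) (use c in auto)
    show "p (f t \<otimes>\<^bsub>H\<^esub> inv\<^bsub>H\<^esub> g t) = \<one>\<^bsub>PSL2\<^esub>" if "t \<in> S" for t
      using p[OF that] c[OF that] by simp
  qed (use c s in auto)
  then show ?thesis using c[OF t] by (metis inv_closed inv_equality inv_inv)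
qed

text \<open>Composing \<open>c\<close> with a local section \<open>q\<close> of \<open>p\<close>
  gives a lift near 0. It is additive there by uniqueness of lifts, and
  \<open>local_hom_extends\<close> carries it to the whole line.\<close>

lemma one_parameter_lift:
  fixes c :: "real \<Rightarrow> psl2"
  assumes c: "continuous_on UNIV c" and hom: "\<And>s t. c (s + t) = c s \<otimes>\<^bsub>PSL2\<^esub> c t"
  obtains F where "\<And>t. F t \<in> carrier H" "\<And>s t. F (s + t) = F s \<otimes>\<^bsub>H\<^esub> F t" "continuous_on UNIV F"
    "\<And>t. p (F t) = c t"
proof -
  have cG: "c t \<in> carrier PSL2" for t by (simp add: PSL2_def)
  have c0: "c 0 = \<one>\<^bsub>PSL2\<^esub>"
    using hom[of 0 0] cG[of 0] by (metis add_0 P.H.l_cancel_one')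
  obtain u T q where u: "openin (top_of_set (carrier H)) u" "\<one>\<^bsub>H\<^esub> \<in> u" "open T" and q: "homeomorphism u T p q"
    using local_section[OF one_closed] by metis
  have uH: "u \<subseteq> carrier H" using u(1) by (rule openin_imp_subset)
  have "c 0 \<in> T" using q u(2) c0 by (metis P.hom_one homeomorphism_image1 imageI)
  then have "\<forall>\<^sub>F t in nhds 0. c t \<in> T"
    using continuous_on_UNIV_tendsto[OF c, of 0] u(3) topological_tendstoD by blast
  then obtain \<epsilon> where \<epsilon>: "\<epsilon> > 0" "\<And>t. \<bar>t\<bar> < \<epsilon> \<Longrightarrow> c t \<in> T"
    unfolding eventually_nhds_metric by (auto simp: dist_real_def)
  define I where "I = {-\<epsilon><..<\<epsilon>}"
  define f where "f t = q (c t)" for t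
  have fu: "f t \<in> u" and pf: "p (f t) = c t" if "\<bar>t\<bar> < \<epsilon>" for t
    using q \<epsilon>(2)[OF that] by (auto simp: f_def homeomorphism_def)
  have fH: "f t \<in> carrier H" if "\<bar>t\<bar> < \<epsilon>" for t using fu[OF that] uH by blast
  have f0: "f 0 = \<one>\<^bsub>H\<^esub>"
    using q u(2) c0 by (metis P.hom_one f_def homeomorphism_apply1)
  have fc: "continuous_on I f"
    unfolding f_def
  proof (rule continuous_on_compose2[of T q])
    show "continuous_on T q" using q by (simp add: homeomorphism_def)
    show "continuous_on I c" by (rule continuous_on_subset[OF c]) simp
    show "c ` I \<subseteq> T" using \<epsilon>(2) by (auto simp: I_def abs_less_iff)
  qed
  \<comment> \<open>In the variable \<open>t\<close> both sides lift \<open>c (s + t)\<close> and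
    agree at 0. The intersection of the two intervals is connected and keeps both \<open>t\<close>
    and \<open>s + t\<close> in the range where \<open>f\<close> is a lift.\<close>
  have fhom: "f (s + t) = f s \<otimes>\<^bsub>H\<^esub> f t" if s: "\<bar>s\<bar> < \<epsilon>" and t: "\<bar>t\<bar> < \<epsilon>" "\<bar>s + t\<bar> < \<epsilon>" for s t
  proof (rule lifts_agree[of "{-\<epsilon><..<\<epsilon>} \<inter> {-\<epsilon> - s<..<\<epsilon> - s}" "\<lambda>t. f (s + t)" "\<lambda>t. f s \<otimes>\<^bsub>H\<^esub> f t" 0])
    let ?S = "{-\<epsilon><..<\<epsilon>} \<inter> {-\<epsilon> - s<..<\<epsilon> - s}"
    have S: "\<bar>r\<bar> < \<epsilon>" "\<bar>s + r\<bar> < \<epsilon>" if "r \<in> ?S" for r using that by auto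
    show "connected ?S" by (intro convex_connected convex_Int) auto
    show "continuous_on ?S (\<lambda>t. f (s + t))"
      by (rule continuous_on_compose2[OF fc]) (auto intro!: continuous_intros simp: I_def)
    show "continuous_on ?S (\<lambda>t. f s \<otimes>\<^bsub>H\<^esub> f t)"
      by (intro continuous_on_mult continuous_on_const continuous_on_subset[OF fc])
         (use fH s S in \<open>auto simp: I_def\<close>)
    show "(\<lambda>t. f (s + t)) ` ?S \<subseteq> carrier H" "(\<lambda>t. f s \<otimes>\<^bsub>H\<^esub> f t) ` ?S \<subseteq> carrier H"
      using fH s S by auto
    show "p (f (s + r)) = p (f s \<otimes>\<^bsub>H\<^esub> f r)" if "r \<in> ?S" for r
      using S[OF that] s fH by (simp add: pf hom)
    show "0 \<in> ?S" "t \<in> ?S" using s t \<epsilon> by auto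
    show "f (s + 0) = f s \<otimes>\<^bsub>H\<^esub> f 0" using fH[OF s] f0 by simp
  qed
  obtain F where F: "\<And>t. F t \<in> carrier H" "\<And>s t. F (s + t) = F s \<otimes>\<^bsub>H\<^esub> F t" "\<And>t. \<bar>t\<bar> < \<epsilon> \<Longrightarrow> F t = f t"
    using local_hom_extends[of \<epsilon> f, OF \<epsilon>(1) fH fhom] by blast
  have F0: "F 0 = \<one>\<^bsub>H\<^esub>" using F(3)[of 0] f0 \<epsilon>(1) by simp
  show thesis
  proof (rule that[of F, OF F(1,2)])
    have "isCont F t" for t
    proof -
      have "continuous_on (ball t \<epsilon>) (\<lambda>r. F t \<otimes>\<^bsub>H\<^esub> f (r - t))"
        by (intro continuous_on_mult continuous_on_const continuous_on_compose2[OF fc])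
           (use F(1) fH in \<open>auto intro!: continuous_intros simp: I_def dist_real_def\<close>)
      moreover have "F r = F t \<otimes>\<^bsub>H\<^esub> f (r - t)" if "r \<in> ball t \<epsilon>" for r
        using F(2)[of t "r - t"] F(3)[of "r - t"] that by (simp add: dist_real_def)
      ultimately have "continuous_on (ball t \<epsilon>) F" by (metis (no_types, lifting) continuous_on_cong)
      then show ?thesis using \<epsilon>(1) by (simp add: continuous_on_eq_continuous_at)
    qed
    then show "continuous_on UNIV F" by (simp add: continuous_at_imp_continuous_on)
    fix t
    obtain m :: nat where m: "\<bar>t\<bar> / \<epsilon> < m" using reals_Archimedean2 by blast
    have m0: "real m > 0" using m \<epsilon>(1) by (smt (verit) divide_nonneg_pos abs_ge_zero)
    have h: "\<bar>t / m\<bar> < \<epsilon>" using m m0 \<epsilon>(1) by (simp add: abs_divide field_simps)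
    \<comment> \<open>\<open>F\<close> is known to lift \<open>c\<close> only for short times; the
      identity is propagated in steps of length \<open>t / m\<close>.\<close>
    have "p (F (of_nat k * (t / m))) = c (of_nat k * (t / m))" for k :: nat
    proof (induction k)
      case (Suc k)
      have "of_nat (Suc k) * (t / m) = of_nat k * (t / m) + t / m" by (simp only: of_nat_Suc distrib_right mult_1)
      moreover have "p (F (t / m)) = c (t / m)" using F(3)[OF h] pf[OF h] by simp
      ultimately show ?case by (simp only: F(2) hom P.hom_mult[OF F(1) F(1)] Suc.IH)
    qed (simp add: F0 c0)
    from this[of m] show "p (F t) = c t" using m0 by simp
  qed
qed

end

section \<open>The lifted Iwasawa subgroups and the kernel\<close>

context psl2_covering
begin

definition one_parameter :: "(real \<Rightarrow> 'h) \<Rightarrow> (real \<Rightarrow> psl2) \<Rightarrow> bool" where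
  "one_parameter F c \<longleftrightarrow> (\<forall>t. F t \<in> carrier H) \<and> (\<forall>s t. F (s + t) = F s \<otimes>\<^bsub>H\<^esub> F t) \<and>
    continuous_on UNIV F \<and> (\<forall>t. p (F t) = c t)"

text \<open>The choice depends on \<open>H\<close> and \<open>p\<close> alone, so two actions of
  \<open>H\<close> are compared along the same subgroups.\<close>

definition k where "k = (SOME F. one_parameter F rot)"
definition a where "a = (SOME F. one_parameter F dia)"
definition u where "u = (SOME F. one_parameter F uni)"

lemma one_parameter_k: "one_parameter k rot"
  and one_parameter_a: "one_parameter a dia"
  and one_parameter_u: "one_parameter u uni"
proof -
  have "\<exists>F. one_parameter F c"
    if "continuous_on UNIV c" "\<And>s t. c (s + t) = c s \<otimes>\<^bsub>PSL2\<^esub> c t" for c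
    using one_parameter_lift[OF that] unfolding one_parameter_def by metis
  then show "one_parameter k rot" "one_parameter a dia" "one_parameter u uni"
    unfolding k_def a_def u_def
    using continuous_on_rot rot_add continuous_on_dia dia_add continuous_on_uni uni_add
    by (blast intro: someI_ex[of "\<lambda>F. one_parameter F _"])+
qed

lemma one_parameterD:
  assumes "one_parameter F c"
  shows "F t \<in> carrier H" "F (s + t) = F s \<otimes>\<^bsub>H\<^esub> F t" "continuous_on S F" "p (F t) = c t"
    "F 0 = \<one>\<^bsub>H\<^esub>" "inv\<^bsub>H\<^esub> F t = F (- t)"
proof -
  show G: "F t \<in> carrier H" and add: "F (s + t) = F s \<otimes>\<^bsub>H\<^esub> F t" and "p (F t) = c t" for s t
    using assms by (simp_all add: one_parameter_def)
  show "continuous_on S F"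
    using assms continuous_on_subset by (auto simp: one_parameter_def)
  show F0: "F 0 = \<one>\<^bsub>H\<^esub>" using add[of 0 0] G[of 0] by (metis add_0 l_cancel_one')
  have "F (- t) \<otimes>\<^bsub>H\<^esub> F t = \<one>\<^bsub>H\<^esub>" using add[of "- t" t] F0 by simp
  then show "inv\<^bsub>H\<^esub> F t = F (- t)" using inv_equality G by blast
qed

lemmas k = one_parameterD[OF one_parameter_k]
lemmas a = one_parameterD[OF one_parameter_a]
lemmas u = one_parameterD[OF one_parameter_u]

text \<open>For fixed \<open>s\<close>, both sides lift the same curve in \<open>t\<close>, by
  \<open>dia_uni\<close>, and both start at \<open>a s\<close>.\<close>

lemma a_u: "a s \<otimes>\<^bsub>H\<^esub> u t = u (exp (2 * s) * t) \<otimes>\<^bsub>H\<^esub> a s"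
proof (rule lifts_agree[of UNIV "\<lambda>t. a s \<otimes>\<^bsub>H\<^esub> u t" "\<lambda>t. u (exp (2 * s) * t) \<otimes>\<^bsub>H\<^esub> a s" 0])
  have "continuous_on UNIV (\<lambda>t. u (exp (2 * s) * t))"
    by (rule continuous_on_compose2[OF u(3)[of UNIV]]) (auto intro!: continuous_intros)
  then show "continuous_on UNIV (\<lambda>t. u (exp (2 * s) * t) \<otimes>\<^bsub>H\<^esub> a s)"
    by (intro continuous_on_mult continuous_on_const) (use a(1) u(1) in auto)
  show "continuous_on UNIV (\<lambda>t. a s \<otimes>\<^bsub>H\<^esub> u t)"
    by (intro continuous_on_mult continuous_on_const u(3)) (use a(1) u(1) in auto)
qed (use a u dia_uni in auto)

text \<open>Both sides lift \<open>rot t\<close> and agree at \<open>t = 0\<close>; this is the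
  usual argument that a discrete normal subgroup of a connected group is central, restricted to
  \<open>k\<close>.\<close>

lemma kernel_commutes_k:
  assumes z: "z \<in> carrier H" "p z = \<one>\<^bsub>PSL2\<^esub>"
  shows "z \<otimes>\<^bsub>H\<^esub> k t = k t \<otimes>\<^bsub>H\<^esub> z"
proof (rule lifts_agree[of UNIV "\<lambda>t. z \<otimes>\<^bsub>H\<^esub> k t" "\<lambda>t. k t \<otimes>\<^bsub>H\<^esub> z" 0])
  show "continuous_on UNIV (\<lambda>t. z \<otimes>\<^bsub>H\<^esub> k t)" "continuous_on UNIV (\<lambda>t. k t \<otimes>\<^bsub>H\<^esub> z)"
    by (intro continuous_on_mult continuous_on_const k(3); use k(1) z in auto)+
  show "p (z \<otimes>\<^bsub>H\<^esub> k t) = p (k t \<otimes>\<^bsub>H\<^esub> z)" for t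
    using z k(1)[of t] P.hom_closed[OF k(1)[of t]] by simp
qed (use k z in auto)

text \<open>The elements \<open>k (j * pi)\<close> all lie in the kernel of \<open>p\<close>, which
  has exactly \<open>n \<ge> 1\<close> elements and so is finite; hence two of them
  coincide.\<close>

lemma k_periodic: "\<exists>L>0. k L = \<one>\<^bsub>H\<^esub>"
proof -
  define Z where "Z = {x \<in> carrier H. p x = \<one>\<^bsub>PSL2\<^esub>}"
  have "card Z = n" using cov by (simp add: connected_covering_of_PSL2_def Z_def)
  then have "finite Z" using n by (metis card.infinite not_one_le_zero)
  moreover have "range (\<lambda>j::nat. k (of_nat j * pi)) \<subseteq> Z" using k(1,4) rot_pi by (auto simp: Z_def)
  ultimately have "finite (range (\<lambda>j::nat. k (of_nat j * pi)))" by (rule rev_finite_subset)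
  then have "\<not> inj (\<lambda>j::nat. k (of_nat j * pi))" using finite_imageD infinite_UNIV_nat by blast
  then obtain i j :: nat where "k (of_nat i * pi) = k (of_nat j * pi)" "i \<noteq> j" by (auto simp: inj_def)
  then obtain i j :: nat where ij: "k (of_nat i * pi) = k (of_nat j * pi)" "i < j" by (metis nat_neq_iff)
  have "k (of_nat j * pi - of_nat i * pi) = k (of_nat j * pi) \<otimes>\<^bsub>H\<^esub> inv\<^bsub>H\<^esub> k (of_nat i * pi)"
    unfolding k(6) k(2)[symmetric] by simp
  also have "\<dots> = \<one>\<^bsub>H\<^esub>" using ij(1) k(1) by simp
  finally show ?thesis using ij(2) by (intro exI[of _ "of_nat j * pi - of_nat i * pi"]) simp
qed

lemma iwasawa_lift:
  assumes g: "g \<in> carrier H"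
  obtains z \<theta> s t where "z \<in> carrier H" "p z = \<one>\<^bsub>PSL2\<^esub>" "g = z \<otimes>\<^bsub>H\<^esub> (k \<theta> \<otimes>\<^bsub>H\<^esub> (a s \<otimes>\<^bsub>H\<^esub> u t))"
proof -
  obtain \<theta> s t where *: "p g = rot \<theta> \<otimes>\<^bsub>PSL2\<^esub> (dia s \<otimes>\<^bsub>PSL2\<^esub> uni t)" using iwasawa by blast
  define b where "b = k \<theta> \<otimes>\<^bsub>H\<^esub> (a s \<otimes>\<^bsub>H\<^esub> u t)"
  have b: "b \<in> carrier H" using k(1) a(1) u(1) by (simp add: b_def)
  have pb: "p b = p g" using k(1,4) a(1,4) u(1,4) * by (simp add: b_def)
  show thesis
  proof (rule that[of "g \<otimes>\<^bsub>H\<^esub> inv\<^bsub>H\<^esub> b" \<theta> s t])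
    show "p (g \<otimes>\<^bsub>H\<^esub> inv\<^bsub>H\<^esub> b) = \<one>\<^bsub>PSL2\<^esub>" using b g pb by simp
    show "g = g \<otimes>\<^bsub>H\<^esub> inv\<^bsub>H\<^esub> b \<otimes>\<^bsub>H\<^esub> (k \<theta> \<otimes>\<^bsub>H\<^esub> (a s \<otimes>\<^bsub>H\<^esub> u t))"
      using b g by (simp add: b_def[symmetric] m_assoc)
  qed (use b g in simp)
qed

end

section \<open>Faithful actions of the covering on the circle\<close>

locale circle_action = psl2_covering n H p
  for n and H :: "('h::topological_space) monoid" and p +
  fixes \<phi> :: "'h \<Rightarrow> circle \<Rightarrow> circle"
  assumes hom: "\<phi> \<in> hom H Homeo_group"
    and cont: "continuous_map (top_of_set (carrier H)) compact_open \<phi>"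
    and inj: "inj_on \<phi> (carrier H)"
begin

lemma action_mult: "g \<in> carrier H \<Longrightarrow> h \<in> carrier H \<Longrightarrow> \<phi> (g \<otimes>\<^bsub>H\<^esub> h) x = \<phi> g (\<phi> h x)"
  using hom_mult[OF hom, of g h] by (simp add: Homeo_group_def)

lemma action_Homeo: "g \<in> carrier H \<Longrightarrow> \<phi> g \<in> Homeo"
  using hom_in_carrier[OF hom, of g] by (simp add: Homeo_group_def)

lemma action_one: "\<phi> \<one>\<^bsub>H\<^esub> x = x"
proof -
  obtain f where "homeomorphism UNIV UNIV (\<phi> \<one>\<^bsub>H\<^esub>) f"
    using action_Homeo[OF one_closed] by (auto simp: Homeo_def)
  then have "f (\<phi> \<one>\<^bsub>H\<^esub> (\<phi> \<one>\<^bsub>H\<^esub> x)) = \<phi> \<one>\<^bsub>H\<^esub> x" "f (\<phi> \<one>\<^bsub>H\<^esub> x) = x"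
    by (auto simp: homeomorphism_def)
  moreover have "\<phi> \<one>\<^bsub>H\<^esub> (\<phi> \<one>\<^bsub>H\<^esub> x) = \<phi> \<one>\<^bsub>H\<^esub> x" using action_mult[of "\<one>\<^bsub>H\<^esub>" "\<one>\<^bsub>H\<^esub>" x] by simp
  ultimately show ?thesis by metis
qed

lemma action_continuous: "g \<in> carrier H \<Longrightarrow> continuous_on UNIV (\<phi> g)"
  using action_Homeo by (auto simp: Homeo_def homeomorphism_def)

lemma action_inv: "g \<in> carrier H \<Longrightarrow> \<phi> (inv\<^bsub>H\<^esub> g) (\<phi> g x) = x"
  using action_mult[of "inv\<^bsub>H\<^esub> g" g x] by (simp add: action_one)

lemma faithful:
  assumes "g \<in> carrier H" "\<And>x. \<phi> g x = x" shows "g = \<one>\<^bsub>H\<^esub>"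
proof -
  have "\<phi> g = \<phi> \<one>\<^bsub>H\<^esub>" using assms(2) action_one by (simp add: fun_eq_iff)
  then show ?thesis using inj assms(1) by (simp add: inj_on_eq_iff)
qed

lemma one_parameter_flow:
  assumes F: "one_parameter F c"
  shows "circle_flow (\<lambda>t. \<phi> (F t))"
proof
  note F = one_parameterD[OF F]
  show "\<phi> (F 0) x = x" for x by (simp add: F(5) action_one)
  show "\<phi> (F (s + t)) x = \<phi> (F s) (\<phi> (F t) x)" for s t x using F(1) by (simp add: F(2) action_mult)
  show "continuous_on UNIV (\<phi> (F t))" for t by (rule action_continuous[OF F(1)])
  show "continuous_on UNIV (\<lambda>t. \<phi> (F t) x)" for x
  proof -
    have "open ((\<lambda>t. \<phi> (F t) x) -` U)" if "open U" for U
    proof -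
      \<comment> \<open>The subbasic set of the compact-open topology given by the compact set
        \<open>{x}\<close> tests continuity of a single orbit map.\<close>
      define B where "B = {f \<in> Homeo. f ` {x} \<subseteq> U}"
      have "openin compact_open B"
        unfolding compact_open_def B_def
        by (rule topology_generated_by_Basis) (use that compact_sing in blast)
      then have "openin (top_of_set (carrier H)) {g \<in> carrier H. \<phi> g \<in> B}"
        using openin_continuous_map_preimage[OF cont] by fastforce
      then obtain T where T: "open T" "{g \<in> carrier H. \<phi> g \<in> B} = carrier H \<inter> T"
        unfolding openin_open by blast
      have "(\<lambda>t. \<phi> (F t) x) -` U = F -` T"
      proof -
        have "\<phi> (F t) x \<in> U \<longleftrightarrow> F t \<in> T" for t
          using T(2) F(1)[of t] action_Homeo[OF F(1)[of t]] by (auto simp: B_def)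
        then show ?thesis by auto
      qed
      then show ?thesis using T(1) F(3)[of UNIV] by (simp add: continuous_on_open_vimage)
    qed
    then show ?thesis by (simp add: continuous_on_open_vimage)
  qed
qed

sublocale K: circle_flow "\<lambda>t. \<phi> (k t)" by (rule one_parameter_flow[OF one_parameter_k])

sublocale AU: affine_action "\<lambda>t. \<phi> (u t)" "\<lambda>t. \<phi> (a t)"
proof (intro affine_action.intro affine_action_axioms.intro)
  show "circle_flow (\<lambda>t. \<phi> (u t))" by (rule one_parameter_flow[OF one_parameter_u])
  show "circle_flow (\<lambda>t. \<phi> (a t))" by (rule one_parameter_flow[OF one_parameter_a])
  show "\<phi> (a s) (\<phi> (u t) x) = \<phi> (u (exp (2 * s) * t)) (\<phi> (a s) x)" for s t x
    using a(1) u(1) by (simp add: action_mult[symmetric] a_u)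
  show "\<exists>x. \<phi> (u T) x \<noteq> x" if "T \<noteq> 0" for T
  proof (rule ccontr)
    assume "\<nexists>x. \<phi> (u T) x \<noteq> x"
    then have "u T = \<one>\<^bsub>H\<^esub>" using faithful u(1) by blast
    then have "uni T = \<one>\<^bsub>PSL2\<^esub>" using u(4)[of T] by simp
    then show False using uni_nontrivial that by blast
  qed
qed

text \<open>\<open>rot (pi / 2)\<close> is nontrivial, so by faithfulness \<open>k\<close> moves
  some point; since \<open>k\<close> is periodic, the orbit of that point is the whole
  circle.\<close>

lemma K_transitive: "\<exists>t. y = \<phi> (k t) x"
proof -
  obtain L where L: "L > 0" "k L = \<one>\<^bsub>H\<^esub>" using k_periodic by blast
  have "\<exists>x. \<not> K.fixed x"
  proof (rule ccontr)
    assume "\<nexists>x. \<not> K.fixed x"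
    then have "k (pi / 2) = \<one>\<^bsub>H\<^esub>" using faithful k(1) by (auto simp: K.fixed_def)
    then have "rot (pi / 2) = \<one>\<^bsub>PSL2\<^esub>" using k(4)[of "pi / 2"] by simp
    then show False using rot_half_pi by blast
  qed
  then obtain w where w: "\<not> K.fixed w" by blast
  have "K.orbit w = UNIV"
    by (rule K.periodic_transitive[OF w, of L]) (use L action_one in auto)
  then have "x \<in> K.orbit w" "y \<in> K.orbit w" by simp_all
  then obtain s t where "x = \<phi> (k s) w" "y = \<phi> (k t) w" by blast
  then have "y = \<phi> (k (t - s)) x" by (simp add: K.add[symmetric])
  then show ?thesis by blast
qed

lemma K_stabilizer:
  assumes "\<phi> (k t) x = x" shows "k t = \<one>\<^bsub>H\<^esub>"
proof (rule faithful[OF k(1)])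
  have "K.orbit x = UNIV" using K_transitive by blast
  then show "\<phi> (k t) y = y" for y using K.transitive_stabilizer assms by blast
qed

text \<open>An element of the kernel of \<open>p\<close> commutes with the transitive flow \<open>k\<close>, so it acts like some
  \<open>k \<theta>\<close> and equals it by faithfulness.\<close>

lemma iwasawa_k:
  assumes g: "g \<in> carrier H"
  obtains \<theta> s t where "g = k \<theta> \<otimes>\<^bsub>H\<^esub> (a s \<otimes>\<^bsub>H\<^esub> u t)"
proof -
  obtain z \<theta> s t where z: "z \<in> carrier H" "p z = \<one>\<^bsub>PSL2\<^esub>"
    and gz: "g = z \<otimes>\<^bsub>H\<^esub> (k \<theta> \<otimes>\<^bsub>H\<^esub> (a s \<otimes>\<^bsub>H\<^esub> u t))" using iwasawa_lift[OF g] .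
  obtain x :: circle where True by blast
  obtain r where r: "\<phi> z x = \<phi> (k r) x" using K_transitive by blast
  have "z \<otimes>\<^bsub>H\<^esub> k (- r) = \<one>\<^bsub>H\<^esub>"
  proof (rule faithful)
    fix y
    obtain t where y: "y = \<phi> (k t) x" using K_transitive by blast
    have zc: "\<phi> z (\<phi> (k t) w) = \<phi> (k t) (\<phi> z w)" for t w
      using action_mult[OF z(1) k(1), of t w] action_mult[OF k(1) z(1), of t w] kernel_commutes_k[OF z, of t]
      by metis
    have "\<phi> (z \<otimes>\<^bsub>H\<^esub> k (- r)) y = \<phi> z (\<phi> (k (t - r)) x)"
      using action_mult[OF z(1) k(1), of "- r" y] K.add[of "- r" t x] by (simp add: y)
    also have "\<dots> = \<phi> (k (t - r)) (\<phi> (k r) x)" by (simp only: zc r)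
    also have "\<dots> = y" using K.add[of "t - r" r x] by (simp add: y)
    finally show "\<phi> (z \<otimes>\<^bsub>H\<^esub> k (- r)) y = y" .
  qed (use z k(1) in simp)
  then have "z = k r" using z k(1) k(6)[of "- r"] by (metis inv_equality minus_minus)
  then have "g = k (r + \<theta>) \<otimes>\<^bsub>H\<^esub> (a s \<otimes>\<^bsub>H\<^esub> u t)"
    using k(1) a(1) u(1) by (simp add: gz k(2) m_assoc)
  then show thesis by (rule that)
qed

end


section \<open>Comparison of two actions\<close>

text \<open>Inverts an orbit chart: time becomes a function of position, continuous at the given
  point and still related through \<open>M\<close>.\<close>

lemma moebius_local_inverse:
  assumes M: "dt M \<noteq> 0" and m: "mrel M s z"
  obtains g where "g z = s" "(g \<longlongrightarrow> s) (nhds z)" "\<forall>\<^sub>F w in nhds z. mrel M (g w) w"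
proof -
  obtain a b c d where Md: "M = (a, b, c, d)" by (cases M)
  have A: "dt (d, - b, - c, a) \<noteq> 0" using M Md by (simp add: mult.commute)
  have "mrel (d, - b, - c, a) z s" using moebius_adj[OF m] Md by simp
  note s = moebius_solve[OF A this]
  define g where "g = (\<lambda>w. (d * w + - b) / (- c * w + a))"
  have den: "- c * z + a \<noteq> 0" and gz: "g z = s" using s by (auto simp: g_def)
  have "isCont g z" unfolding g_def using den by (intro continuous_intros) auto
  then have "(g \<longlongrightarrow> g z) (nhds z)" by (simp add: isCont_def tendsto_at_iff_tendsto_nhds)
  then have g: "(g \<longlongrightarrow> s) (nhds z)" unfolding gz .
  have "((\<lambda>w. - c * w + a) \<longlongrightarrow> - c * z + a) (nhds z)" by (intro tendsto_intros filterlim_ident)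
  then have "\<forall>\<^sub>F w in nhds z. - c * w + a \<noteq> 0" using den by (rule tendsto_imp_eventually_ne)
  then have "\<forall>\<^sub>F w in nhds z. mrel M (g w) w"
  proof eventually_elim
    case (elim w)
    have "mrel (d, - b, - c, a) w (g w)" using elim by (simp add: g_def)
    from moebius_adj[OF this] show ?case by (simp add: Md)
  qed
  with gz g show thesis by (rule that)
qed

lemma finite_exceptions_compact:
  fixes P :: "circle \<Rightarrow> bool"
  assumes "\<And>x. \<exists>W F. open W \<and> x \<in> W \<and> finite F \<and> (\<forall>y\<in>W. y \<notin> F \<longrightarrow> P y)"
  shows "\<exists>F. finite F \<and> (\<forall>y. y \<notin> F \<longrightarrow> P y)"
proof -
  obtain W F where WF: "\<And>x. open (W x)" "\<And>x. x \<in> W x" "\<And>x. finite (F x)"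
    "\<And>x y. y \<in> W x \<Longrightarrow> y \<notin> F x \<Longrightarrow> P y"
    using assms by metis
  have cov: "UNIV \<subseteq> (\<Union>x\<in>UNIV. W x)" using WF(2) by blast
  obtain X where "X \<subseteq> UNIV" and X: "finite X" "UNIV \<subseteq> (\<Union>x\<in>X. W x)"
    by (rule compactE_image[OF compact_UNIV_circle WF(1) cov])
  show ?thesis
  proof (intro exI[of _ "\<Union>x\<in>X. F x"] conjI allI impI)
    show "finite (\<Union>x\<in>X. F x)" using X(1) WF(3) by blast
    fix y assume y: "y \<notin> (\<Union>x\<in>X. F x)"
    have "y \<in> (\<Union>x\<in>X. W x)" using X(2) by blast
    then show "P y" using WF(4) y by blast
  qed
qed

locale circle_action_pair = circle_action n H p \<phi> + B: circle_action n H p \<phi>'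
  for n and H :: "('h::topological_space) monoid" and p \<phi> \<phi>'
begin

text \<open>The formula on the \<open>k\<close>-orbit of \<open>x\<close> is well defined by
  \<open>K_stabilizer\<close>. It is equivariant under all of \<open>H\<close> because the
  decomposition of \<open>g \<otimes> k \<theta>\<close> takes place in \<open>H\<close>: its
  factors \<open>a s\<close> and \<open>u t\<close> fix both \<open>x\<close> and \<open>x'\<close>,
  so the same \<open>\<theta>'\<close> serves both actions.\<close>

lemma equivariant_map:
  assumes x: "AU.N.fixed x" "AU.A.fixed x" and x': "B.AU.N.fixed x'" "B.AU.A.fixed x'"
  obtains h where "continuous_on UNIV h" "\<And>g y. g \<in> carrier H \<Longrightarrow> h (\<phi> g y) = \<phi>' g (h y)" "h x = x'"
proof -
  define h where "h y = \<phi>' (k (SOME \<theta>. y = \<phi> (k \<theta>) x)) x'" for y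
  have h: "h (\<phi> (k \<theta>) x) = \<phi>' (k \<theta>) x'" for \<theta>
  proof -
    define \<theta>' where "\<theta>' = (SOME \<theta>'. \<phi> (k \<theta>) x = \<phi> (k \<theta>') x)"
    have "\<phi> (k \<theta>) x = \<phi> (k \<theta>') x" unfolding \<theta>'_def by (rule someI) (rule refl)
    then have "\<phi> (k (\<theta>' - \<theta>)) x = x"
      using K.add[of "- \<theta>" \<theta>' x] by (metis K.inverse(1) uminus_add_conv_diff)
    then have "k (\<theta>' - \<theta>) = \<one>\<^bsub>H\<^esub>" by (rule K_stabilizer)
    then have "k \<theta>' = k \<theta>" using k(2)[of "\<theta>' - \<theta>" \<theta>] k(1) by simp
    then show ?thesis by (simp add: h_def \<theta>'_def)
  qed
  obtain L where L: "L > 0" "k L = \<one>\<^bsub>H\<^esub>" using k_periodic by blast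
  have range: "\<exists>\<theta>\<in>{0..L}. y = \<phi> (k \<theta>) x" for y
  proof -
    obtain \<theta> where \<theta>: "y = \<phi> (k \<theta>) x" using K_transitive by blast
    define j where "j = \<lfloor>\<theta> / L\<rfloor>"
    have "of_int j \<le> \<theta> / L" "\<theta> / L \<le> of_int j + 1" unfolding j_def by linarith+
    then have "of_int j * L \<le> \<theta>" "\<theta> \<le> (of_int j + 1) * L" using L(1)
      by (simp_all add: pos_le_divide_eq pos_divide_le_eq)
    then have "\<theta> - of_int j * L \<in> {0..L}" by (simp add: algebra_simps)
    moreover have "\<phi> (k (of_int j * L)) x = x" by (rule K.period_int) (simp add: L(2) action_one)
    then have "y = \<phi> (k (\<theta> - of_int j * L)) x"
      using K.add[of "\<theta> - of_int j * L" "of_int j * L" x] by (simp add: \<theta>)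
    ultimately show ?thesis by blast
  qed
  \<comment> \<open>Over the compact interval \<open>{0..L}\<close> the orbit map of
    \<open>x\<close> is onto and sends closed sets to closed sets, so continuity of \<open>h\<close>
    can be tested after composing with it.\<close>
  have "closed (h -` C)" if C: "closed C" for C
  proof -
    have "h -` C = (\<lambda>\<theta>. \<phi> (k \<theta>) x) ` ({0..L} \<inter> (\<lambda>\<theta>. \<phi>' (k \<theta>) x') -` C)"
    proof (intro subset_antisym subsetI)
      fix y assume "y \<in> h -` C"
      moreover obtain \<theta> where \<theta>: "\<theta> \<in> {0..L}" "y = \<phi> (k \<theta>) x" using range by blast
      ultimately have "\<phi>' (k \<theta>) x' \<in> C" using h[of \<theta>] by simp
      then show "y \<in> (\<lambda>\<theta>. \<phi> (k \<theta>) x) ` ({0..L} \<inter> (\<lambda>\<theta>. \<phi>' (k \<theta>) x') -` C)" using \<theta> by blast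
    next
      fix y assume "y \<in> (\<lambda>\<theta>. \<phi> (k \<theta>) x) ` ({0..L} \<inter> (\<lambda>\<theta>. \<phi>' (k \<theta>) x') -` C)"
      then show "y \<in> h -` C" using h by auto
    qed
    moreover have "closed ((\<lambda>\<theta>. \<phi>' (k \<theta>) x') -` C)"
      using B.K.cont_time[of x'] C by (simp add: continuous_on_closed_vimage)
    then have "compact ({0..L} \<inter> (\<lambda>\<theta>. \<phi>' (k \<theta>) x') -` C)" by (intro compact_Int_closed) simp_all
    then have "compact ((\<lambda>\<theta>. \<phi> (k \<theta>) x) ` ({0..L} \<inter> (\<lambda>\<theta>. \<phi>' (k \<theta>) x') -` C))"
      by (intro compact_continuous_image continuous_on_subset[OF K.cont_time]) simp_all
    ultimately show ?thesis by (simp add: compact_imp_closed)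
  qed
  then have cont: "continuous_on UNIV h" by (simp add: continuous_on_closed_vimage)
  show thesis
  proof (rule that[OF cont])
    fix g y assume g: "g \<in> carrier H"
    obtain \<theta> where y: "y = \<phi> (k \<theta>) x" using K_transitive by blast
    obtain \<theta>' s t where i: "g \<otimes>\<^bsub>H\<^esub> k \<theta> = k \<theta>' \<otimes>\<^bsub>H\<^esub> (a s \<otimes>\<^bsub>H\<^esub> u t)"
      using iwasawa_k[of "g \<otimes>\<^bsub>H\<^esub> k \<theta>"] g k(1) by blast
    have "\<phi> g (\<phi> (k \<theta>) x) = \<phi> (g \<otimes>\<^bsub>H\<^esub> k \<theta>) x" using g k(1) by (simp add: action_mult)
    also have "\<dots> = \<phi> (k \<theta>') x"
      unfolding i using x k(1) a(1) u(1) by (simp add: action_mult AU.N.fixed_def AU.A.fixed_def)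
    finally have 1: "\<phi> g y = \<phi> (k \<theta>') x" by (simp add: y)
    have "\<phi>' g (\<phi>' (k \<theta>) x') = \<phi>' (g \<otimes>\<^bsub>H\<^esub> k \<theta>) x'" using g k(1) by (simp add: B.action_mult)
    also have "\<dots> = \<phi>' (k \<theta>') x'"
      unfolding i using x' k(1) a(1) u(1) by (simp add: B.action_mult B.AU.N.fixed_def B.AU.A.fixed_def)
    finally have "\<phi>' g (\<phi>' (k \<theta>) x') = \<phi>' (k \<theta>') x'" .
    moreover have "h (\<phi> g y) = \<phi>' (k \<theta>') x'" "h y = \<phi>' (k \<theta>) x'"
      unfolding 1 by (rule h, unfold y, rule h)
    ultimately show "h (\<phi> g y) = \<phi>' g (h y)" by simp
  next
    show "h x = x'" using h[of 0] by (simp add: k(5) action_one B.action_one)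
  qed
qed

lemma swap: "circle_action_pair n H p \<phi>' \<phi>"
  by (intro circle_action_pair.intro B.circle_action_axioms circle_action_axioms)

text \<open>The construction with the roles exchanged sends \<open>x'\<close> back to
  \<open>x\<close>. The composites are equivariant and fix a point of a transitive action, so they
  are identities.\<close>

lemma equivariant_homeomorphism:
  obtains h h' where "homeomorphism UNIV UNIV h h'"
    "\<And>g y. g \<in> carrier H \<Longrightarrow> h (\<phi> g y) = \<phi>' g (h y)"
    "\<And>g y. g \<in> carrier H \<Longrightarrow> h' (\<phi>' g y) = \<phi> g (h' y)"
proof -
  interpret S: circle_action_pair n H p \<phi>' \<phi> by (rule swap)
  obtain x where x: "AU.N.fixed x" "AU.A.fixed x" using AU.common_fixed_point by blast
  obtain x' where x': "B.AU.N.fixed x'" "B.AU.A.fixed x'" using B.AU.common_fixed_point by blast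
  obtain h where h: "continuous_on UNIV h" "\<And>g y. g \<in> carrier H \<Longrightarrow> h (\<phi> g y) = \<phi>' g (h y)" "h x = x'"
    using equivariant_map[OF x x'] by blast
  obtain h' where h': "continuous_on UNIV h'" "\<And>g y. g \<in> carrier H \<Longrightarrow> h' (\<phi>' g y) = \<phi> g (h' y)" "h' x' = x"
    using S.equivariant_map[OF x' x] by blast
  have 1: "h' (h y) = y" for y
  proof -
    obtain \<theta> where "y = \<phi> (k \<theta>) x" using K_transitive by blast
    then show ?thesis using k(1) by (simp add: h(2,3) h'(2,3))
  qed
  have 2: "h (h' y) = y" for y
  proof -
    obtain \<theta> where "y = \<phi>' (k \<theta>) x'" using B.K_transitive by blast
    then show ?thesis using k(1) by (simp add: h(2,3) h'(2,3))
  qed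
  have "homeomorphism UNIV UNIV h h'"
    using h(1) h'(1) 1 2 by (intro homeomorphismI) auto
  then show thesis by (rule that[OF _ h(2) h'(2)])
qed

section \<open>Regularity of the conjugating homeomorphism\<close>

text \<open>On a nonfixed orbit of \<open>u\<close>, position is locally a Moebius function of time
  in both actions, and \<open>h\<close> preserves time up to a shift. So \<open>h\<close> is locally
  the inverse of one chart followed by the shift and the other chart.\<close>

lemma equivariant_lproj_somewhere:
  assumes PC: "\<And>g. g \<in> carrier H \<Longrightarrow> \<phi> g \<in> PC0_Proj" "\<And>g. g \<in> carrier H \<Longrightarrow> \<phi>' g \<in> PC0_Proj"
    and h: "inj h" "\<And>g y. g \<in> carrier H \<Longrightarrow> h (\<phi> g y) = \<phi>' g (h y)"
  shows "\<exists>z. lproj h z"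
proof -
  note PCs = PC(1)[OF u(1)] PC(1)[OF a(1)] PC(2)[OF u(1)] PC(2)[OF a(1)]
  obtain x where x: "\<not> AU.N.fixed x" using AU.N_has_nonfixed by blast
  have lift: "\<exists>\<delta>>0. \<delta> \<le> e \<and> (\<exists>v. continuous_on {-\<delta><..<\<delta>} v \<and> (\<forall>t\<in>{-\<delta><..<\<delta>}. circle_of (v t) = \<psi> t))"
    if cont: "continuous_on UNIV \<psi>" and e: "e > 0" for \<psi> :: "real \<Rightarrow> circle" and e
  proof -
    obtain z where z: "\<psi> 0 = circle_of z" by (rule circle_of_surj)
    obtain U v where U: "open U" "0 \<in> U" "continuous_on U v" "\<And>y. y \<in> U \<Longrightarrow> circle_of (v y) = \<psi> y"
      using local_lift[OF cont z] by metis
    obtain d where d: "d > 0" "ball 0 d \<subseteq> U" using U(1,2) openE by blast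
    define \<delta> where "\<delta> = min d e"
    have \<delta>: "\<delta> > 0" "\<delta> \<le> e" "\<delta> \<le> d" using d(1) e by (auto simp: \<delta>_def)
    have sub: "{-\<delta><..<\<delta>} \<subseteq> U" using d(2) \<delta>(3) by (auto simp: subset_iff dist_real_def)
    show ?thesis
      by (intro exI[of _ \<delta>] conjI \<delta> exI[of _ v] continuous_on_subset[OF U(3) sub] ballI U(4) subsetD[OF sub])
  qed
  obtain \<delta> v where \<delta>: "\<delta> > 0" and v: "continuous_on {-\<delta><..<\<delta>} v"
    "\<And>t. t \<in> {-\<delta><..<\<delta>} \<Longrightarrow> circle_of (v t) = \<phi> (u t) x"
    using lift[OF AU.N.cont_time[of x] zero_less_one] by blast
  obtain b c M where bc: "b < c" "- \<delta> < b" "c < \<delta>" and M: "dt M \<noteq> 0" "\<And>s. s \<in> {b<..<c} \<Longrightarrow> mrel M s (v s)"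
    using AU.orbit_chart_moebius[OF PCs(1,2) x \<delta> v] by metis
  \<comment> \<open>\<open>orbit_chart_moebius\<close> yields an interval at an unpredictable place
    in its domain. Restarting the second orbit at the midpoint time \<open>s0\<close>, with
    \<open>\<delta>' \<le> (c - b) / 2\<close>, forces the second interval, shifted by
    \<open>s0\<close>, into \<open>{b<..<c}\<close>.\<close>
  define s0 where "s0 = (b + c) / 2"
  define x2 where "x2 = \<phi> (u s0) x"
  have nf: "\<not> B.AU.N.fixed (h x2)"
  proof
    assume "B.AU.N.fixed (h x2)"
    then have "h (\<phi> (u t) x2) = h x2" for t using h(2)[OF u(1)] by (simp add: B.AU.N.fixed_def)
    then have "AU.N.fixed x2" using h(1) by (simp add: AU.N.fixed_def inj_eq)
    then show False using x AU.N.fixed_flow by (simp add: x2_def)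
  qed
  have "(c - b) / 2 > 0" using bc by simp
  from lift[OF B.AU.N.cont_time[of "h x2"] this]
  obtain \<delta>' v' where \<delta>': "\<delta>' > 0" "\<delta>' \<le> (c - b) / 2" and v': "continuous_on {-\<delta>'<..<\<delta>'} v'"
    "\<And>t. t \<in> {-\<delta>'<..<\<delta>'} \<Longrightarrow> circle_of (v' t) = \<phi>' (u t) (h x2)"
    by blast
  obtain b' c' M' where bc': "b' < c'" "- \<delta>' < b'" "c' < \<delta>'"
    and M': "dt M' \<noteq> 0" "\<And>s. s \<in> {b'<..<c'} \<Longrightarrow> mrel M' s (v' s)"
    using B.AU.orbit_chart_moebius[OF PCs(3,4) nf \<delta>'(1) v'] by metis
  define s1 where "s1 = s0 + (b' + c') / 2"
  have in_bc: "s \<in> {b<..<c}" if "s - s0 \<in> {b'<..<c'}" for s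
    using that bc' \<delta>'(2) unfolding s0_def by (auto simp: field_simps)
  have s1: "s1 - s0 \<in> {b'<..<c'}" using bc' by (simp add: s1_def)
  define z where "z = v s1"
  have "mrel M s1 z" unfolding z_def by (rule M(2)[OF in_bc[OF s1]])
  then obtain g where g: "g z = s1" "(g \<longlongrightarrow> s1) (nhds z)" "\<forall>\<^sub>F w in nhds z. mrel M (g w) w"
    using moebius_local_inverse[OF M(1)] by blast
  have "((\<lambda>w. g w - s0) \<longlongrightarrow> s1 - s0) (nhds z)" by (intro tendsto_intros g(2))
  then have "\<forall>\<^sub>F w in nhds z. g w - s0 \<in> {b'<..<c'}"
    by (rule topological_tendstoD[OF _ _ s1]) simp
  \<comment> \<open>The matrix product, from right to left: position to time by
    \<open>adj M\<close>, subtraction of \<open>s0\<close>, time to position by \<open>M'\<close>;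
    the identity factor is the instance \<open>j = 0\<close> of
    \<open>moebius_shift\<close>.\<close>
  with g(3) have "\<forall>\<^sub>F w in nhds z. mrel (mmul (mmul (1, 0, 0, 1) (mmul M' (1, - s0, 0, 1))) (adj M)) w (v' (g w - s0)) \<and>
      h (circle_of w) = circle_of (v' (g w - s0))"
  proof eventually_elim
    case (elim w)
    have gw: "g w \<in> {b<..<c}" by (rule in_bc[OF elim(2)])
    have "v (g w) = w" by (rule moebius_functional[OF M(1) M(2)[OF gw] elim(1)])
    then have "circle_of w = \<phi> (u (g w)) x" using v(2)[of "g w"] gw bc by auto
    also have "\<dots> = \<phi> (u (g w - s0)) x2" using AU.N.add[of "g w - s0" s0 x] by (simp add: x2_def)
    finally have "h (circle_of w) = \<phi>' (u (g w - s0)) (h x2)" by (simp add: h(2)[OF u(1)])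
    then have "h (circle_of w) = circle_of (v' (g w - s0))" using v'(2)[of "g w - s0"] elim(2) bc' by auto
    moreover have "mrel (mmul (1, 0, 0, 1) (mmul M' (1, - s0, 0, 1))) (g w) (v' (g w - s0) + 0)"
      by (rule moebius_shift[OF M'(2)[OF elim(2)]])
    then have "mrel (mmul (mmul (1, 0, 0, 1) (mmul M' (1, - s0, 0, 1))) (adj M)) w (v' (g w - s0))"
      using moebius_mmul[OF moebius_adj[OF elim(1)]] by simp
    ultimately show ?case by blast
  qed
  moreover have "dt (mmul (mmul (1, 0, 0, 1) (mmul M' (1, - s0, 0, 1))) (adj M)) \<noteq> 0"
    using M(1) M'(1) by (simp add: dt_mmul)
  ultimately show ?thesis unfolding lproj_def
    by (intro exI[of _ z] exI[of _ "mmul (mmul (1, 0, 0, 1) (mmul M' (1, - s0, 0, 1))) (adj M)"]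
        exI[of _ "\<lambda>w. v' (g w - s0)"]) simp
qed

text \<open>Equivariance \<open>h = \<phi>'(g)\<^sup>-\<^sup>1 \<circ> h \<circ> \<phi>(g)\<close> and transitivity spread the local form of \<open>h\<close> at one point
  over the whole circle.\<close>

lemma equivariant_PC0:
  assumes PC: "\<And>g. g \<in> carrier H \<Longrightarrow> \<phi> g \<in> PC0_Proj" "\<And>g. g \<in> carrier H \<Longrightarrow> \<phi>' g \<in> PC0_Proj"
    and h: "h \<in> Homeo" "continuous_on UNIV h" "inj h" "\<And>g y. g \<in> carrier H \<Longrightarrow> h (\<phi> g y) = \<phi>' g (h y)"
  shows "h \<in> PC0_Proj"
proof -
  obtain z where z: "lproj h z" using equivariant_lproj_somewhere[OF PC h(3,4)] by blast
  obtain V where V: "open V" "z \<in> V" "\<And>s. s \<in> V \<Longrightarrow> lproj h s"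
    using lproj_eventually[OF z] unfolding eventually_nhds by blast
  have "\<exists>W F. open W \<and> x \<in> W \<and> finite F \<and> (\<forall>y\<in>W. y \<notin> F \<longrightarrow> locally_projective_at h y)" for x
  proof -
    obtain \<theta> where \<theta>: "circle_of z = \<phi> (k \<theta>) x" using K_transitive by blast
    define f where "f = \<phi> (k \<theta>)"
    define g where "g = \<phi>' (inv\<^bsub>H\<^esub> k \<theta>)"
    have hfg: "h = (g \<circ> h) \<circ> f"
      using k(1) by (simp add: fun_eq_iff f_def g_def h(4) B.action_inv)
    obtain F where f: "continuous_on UNIV f" "inj f" and F: "finite F" "\<And>t. circle_of t \<notin> F \<Longrightarrow> lproj f t"
      using PC0_ProjD[OF PC(1)[OF k(1)]] unfolding f_def by metis
    obtain F' where F': "finite F'" "\<And>t. circle_of t \<notin> F' \<Longrightarrow> lproj g t"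
      using PC0_ProjD[OF PC(2)[OF inv_closed[OF k(1)]]] unfolding g_def by metis
    define W where "W = f -` (circle_of ` V)"
    have "open W" unfolding W_def
      using f(1) open_circle_of_image[OF V(1)] by (simp add: continuous_on_open_vimage)
    moreover have "x \<in> W" using imageI[OF V(2), of circle_of] \<theta> by (simp add: W_def f_def)
    \<comment> \<open>The exceptions are the break points of \<open>f\<close> and the preimages of
      those of \<open>g\<close> under \<open>h \<circ> f\<close>; injectivity keeps the latter
      finite.\<close>
    moreover have "finite (F \<union> (h \<circ> f) -` F')"
      using F(1) F'(1) inj_compose[OF h(3) f(2)] by (simp add: finite_vimageI)
    moreover have "locally_projective_at h y" if y: "y \<in> W" "y \<notin> F \<union> (h \<circ> f) -` F'" for y
    proof -
      obtain t where t: "y = circle_of t" by (rule circle_of_surj)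
      obtain w where w: "f y = circle_of w" "w \<in> V" using y(1) by (auto simp: W_def)
      obtain r where r: "h (circle_of w) = circle_of r" by (rule circle_of_surj)
      have "lproj g r" by (rule F'(2)) (use y(2) w r in auto)
      from lproj_compose[OF V(3)[OF w(2)] r this] have "lproj (g \<circ> h) w" .
      moreover have "lproj f t" by (rule F(2)) (use y(2) t in auto)
      ultimately have "lproj ((g \<circ> h) \<circ> f) t" using lproj_compose w(1) t by blast
      then show ?thesis using hfg h(2) locally_projective_at_iff t by metis
    qed
    ultimately show ?thesis by blast
  qed
  from finite_exceptions_compact[OF this] show ?thesis using h(1) by (auto simp: PC0_Proj_def)
qed

text \<open>Projectivity at one point gives \<open>lc1\<close> there. The maps \<open>f\<close> and
  \<open>g\<close> satisfy \<open>lc1\<close> everywhere, so, in contrast to projectivity, spreading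
  it over the circle leaves no exceptional points.\<close>

lemma equivariant_C1:
  assumes PC: "\<And>g. g \<in> carrier H \<Longrightarrow> \<phi> g \<in> PC1_Proj" "\<And>g. g \<in> carrier H \<Longrightarrow> \<phi>' g \<in> PC1_Proj"
    and h: "continuous_on UNIV h" "inj h" "\<And>g y. g \<in> carrier H \<Longrightarrow> h (\<phi> g y) = \<phi>' g (h y)"
  shows "C1_map h"
proof (rule lc1_imp_C1_map[OF h(1)])
  fix t
  have "\<exists>z. lproj h z"
    by (rule equivariant_lproj_somewhere[OF _ _ h(2,3)]) (use PC in \<open>auto simp: PC1_Proj_def\<close>)
  then obtain z where z: "lc1 h z" using lproj_imp_lc1 by blast
  obtain \<theta> where \<theta>: "circle_of z = \<phi> (k \<theta>) (circle_of t)" using K_transitive by blast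
  obtain r where r: "h (circle_of z) = circle_of r" by (rule circle_of_surj)
  define f where "f = \<phi> (k \<theta>)"
  define g where "g = \<phi>' (inv\<^bsub>H\<^esub> k \<theta>)"
  have hfg: "h = (g \<circ> h) \<circ> f"
    using k(1) by (simp add: fun_eq_iff f_def g_def h(3) B.action_inv)
  have lc: "lc1 f t" for t
    unfolding f_def using PC(1)[OF k(1)] action_continuous[OF k(1)]
    by (intro C1_map_imp_lc1) (auto simp: PC1_Proj_def)
  have lc': "lc1 g t" for t
    unfolding g_def using PC(2)[OF inv_closed[OF k(1)]] B.action_continuous[OF inv_closed[OF k(1)]]
    by (intro C1_map_imp_lc1) (auto simp: PC1_Proj_def)
  have "lc1 (g \<circ> h) z" by (rule lc1_compose[OF z r lc'])
  then have "lc1 ((g \<circ> h) \<circ> f) t" using lc1_compose[OF lc] \<theta> by (metis f_def)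
  then show "lc1 h t" using hfg by metis
qed

lemma conjugate_images:
  shows "\<phi> ` carrier H \<subseteq> PC0_Proj \<Longrightarrow> \<phi>' ` carrier H \<subseteq> PC0_Proj \<Longrightarrow>
      conjugate_in PC0_Proj (\<phi> ` carrier H) (\<phi>' ` carrier H)"
    and "\<phi> ` carrier H \<subseteq> PC1_Proj \<Longrightarrow> \<phi>' ` carrier H \<subseteq> PC1_Proj \<Longrightarrow>
      conjugate_in PC1_Proj (\<phi> ` carrier H) (\<phi>' ` carrier H)"
proof -
  interpret S: circle_action_pair n H p \<phi>' \<phi> by (rule swap)
  obtain h h' where hh': "homeomorphism UNIV UNIV h h'"
    and h: "\<And>g y. g \<in> carrier H \<Longrightarrow> h (\<phi> g y) = \<phi>' g (h y)"
    and h': "\<And>g y. g \<in> carrier H \<Longrightarrow> h' (\<phi>' g y) = \<phi> g (h' y)"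
    using equivariant_homeomorphism by blast
  have inv: "h' (h y) = y" "h (h' y) = y" for y using hh' by (simp_all add: homeomorphism_def)
  have cont: "continuous_on UNIV h" "continuous_on UNIV h'" using hh' by (simp_all add: homeomorphism_def)
  have inj: "inj h" "inj h'" using inv by (metis injI)+
  have Homeo: "h \<in> Homeo" using hh' by (auto simp: Homeo_def)
  have inv_h: "inv_into UNIV h = h'" using inv inj by (intro ext) (metis inv_f_f)
  have conj: "conjugate_in S (\<phi> ` carrier H) (\<phi>' ` carrier H)" if "h \<in> S" for S
  proof -
    have "h \<circ> \<phi> g \<circ> h' = \<phi>' g" if "g \<in> carrier H" for g using h[OF that] inv by (simp add: fun_eq_iff)
    then have "\<phi>' ` carrier H = (\<lambda>f. h \<circ> f \<circ> h') ` \<phi> ` carrier H"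
      by (simp add: image_image cong: image_cong)
    then show ?thesis using that inv_h by (auto simp: conjugate_in_def)
  qed
  show "conjugate_in PC0_Proj (\<phi> ` carrier H) (\<phi>' ` carrier H)"
    if "\<phi> ` carrier H \<subseteq> PC0_Proj" "\<phi>' ` carrier H \<subseteq> PC0_Proj"
    using that by (intro conj equivariant_PC0[OF _ _ Homeo cont(1) inj(1) h]) auto
  show "conjugate_in PC1_Proj (\<phi> ` carrier H) (\<phi>' ` carrier H)"
    if PC: "\<phi> ` carrier H \<subseteq> PC1_Proj" "\<phi>' ` carrier H \<subseteq> PC1_Proj"
  proof (rule conj)
    have PC1: "\<phi> g \<in> PC1_Proj" "\<phi>' g \<in> PC1_Proj" if "g \<in> carrier H" for g using PC that by auto
    have "h \<in> PC0_Proj"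
      using PC1 by (intro equivariant_PC0[OF _ _ Homeo cont(1) inj(1) h]) (auto simp: PC1_Proj_def)
    moreover have "C1_map h" by (rule equivariant_C1[OF PC1 cont(1) inj(1) h])
    \<comment> \<open>\<open>PC1_Proj\<close> also asks for a C^1 inverse, which is the conjugacy
      for the exchanged pair of actions.\<close>
    moreover have "C1_map h'" by (rule S.equivariant_C1[OF PC1(2,1) cont(2) inj(2) h'])
    ultimately show "h \<in> PC1_Proj" by (simp add: PC1_Proj_def inv_h)
  qed
qed

end

theorem theorem1p14:
  fixes n :: nat
    and H :: "('h::topological_space) monoid"
    and p :: "'h \<Rightarrow> psl2"
  assumes "n \<ge> 1"
    and "connected_covering_of_PSL2 n H p"
  shows "(\<forall>G G'. continuous_injective_image H G \<and> continuous_injective_image H G' \<and>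
            G \<subseteq> PC0_Proj \<and> G' \<subseteq> PC0_Proj \<longrightarrow> conjugate_in PC0_Proj G G') \<and>
         (\<forall>G G'. continuous_injective_image H G \<and> continuous_injective_image H G' \<and>
            G \<subseteq> PC1_Proj \<and> G' \<subseteq> PC1_Proj \<longrightarrow> conjugate_in PC1_Proj G G')"
proof -
  interpret psl2_covering n H p by (rule psl2_covering.intro[OF assms])
  have "\<exists>\<phi> \<phi>'. circle_action_pair n H p \<phi> \<phi>' \<and> G = \<phi> ` carrier H \<and> G' = \<phi>' ` carrier H"
    if "continuous_injective_image H G" "continuous_injective_image H G'" for G G'
  proof -
    have *: "\<exists>\<phi>. circle_action n H p \<phi> \<and> G = \<phi> ` carrier H" if "continuous_injective_image H G" for G
      using that psl2_covering_axioms unfolding continuous_injective_image_def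
      by (auto intro: circle_action.intro circle_action_axioms.intro)
    show ?thesis using *[OF that(1)] *[OF that(2)] circle_action_pair.intro by blast
  qed
  then show ?thesis using circle_action_pair.conjugate_images by metis
qed

end
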